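(* Let $M_j=(X_j,d_j,T_j)$ be $n$-dimensional integral current spaces for $j\in\mathbb{N}\cup\{\infty\}$. Assume $M_j\xrightarrow[Z]{\mathrm F}M_\infty$ for some separable complete metric space $Z$ and metric-isometric embeddings $\varphi_j:X_j\to Z$, $j\in\mathbb{N}\cup\{\infty\}$, and that for $j\in\mathbb N$ one can decompose $\partial M_j=\partial_1M_j+\partial_2M_j$ such that $\partial_2M_j$ converges to the zero space $\mathbf 0$ in the intrinsic flat sense. Define $\Sigma_j:=\operatorname{set}(\partial_1M_j)$ for $j\in\mathbb N$ and $\Sigma_\infty:=\operatorname{set}(\partial M_\infty)$. The following statements hold: (i) If $x_j\in X_j$ and $x_\infty\in\overline X_\infty$ are points with $(M_j,x_j)\xrightarrow[Z]{\mathrm F}(M_\infty,x_\infty)$, then $$d_\infty(x_\infty,\Sigma_\infty)\ge\limsup_{j\to\infty}d_j(x_j,\Sigma_j).$$ (ii) If the $\Sigma_j$ and $\Sigma_\infty$ are compact and $(\Sigma_j,d_j)$ converges to $(\Sigma_\infty,d_\infty)$ in the Gromov--Hausdorff sense, then $(\Sigma_j,d_j)\xrightarrow[Z]{\mathrm{GH}}(\Sigma_\infty,d_\infty)$, i.e. $\varphi_j(\Sigma_j)\to\varphi_\infty(\Sigma_\infty)$ in the Hausdorff sense in $Z$, for the same $Z$ and the same maps $\varphi_j$.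
   Context: An $n$-dimensional integral current space $M=(X,d,T)$ (Sormani--Wenger) consists of a metric space $(X,d)$ and an $n$-dimensional Ambrosio--Kirchheim integral current $T$ on the completion $\overline X$ with $\operatorname{set}(T)=X$, where $\operatorname{set}(T)=\{p:\liminf_{r\to0}\|T\|(B(p,r))/r^n>0\}$ and $\|T\|$ is the mass measure; the zero space $\mathbf 0$ is also allowed. Write $\operatorname{set}(M)=X$. The boundary is the $(n-1)$-dimensional integral current space $\partial M=(\operatorname{set}(\partial T),d,\partial T)$, with $\operatorname{set}(\partial T)\subset\overline X$ and $d$ extended to $\overline X$. A decomposition $\partial M=\partial_1M+\partial_2M$ means $\partial T=S_1+S_2$ with $S_1,S_2$ integral currents and $\partial_iM=(\operatorname{set}(S_i),d,S_i)$. Metric-isometric embeddings are distance-preserving maps; they extend to completions. For a separable complete metric space $Z$ and metric-isometric embeddings $\varphi_j:X_j\to Z$, $M_j\xrightarrow[Z]{\mathrm F}M_\infty$ means ${\varphi_j}_\#(T_j)\to{\varphi_\infty}_\#(T_\infty)$ in the flat distance $d_F^Z(S_1,S_2)=\inf\{\mathbf M(U)+\mathbf M(V):S_1-S_2=U+\partial V\}$, where $U,V$ are integral currents in $Z$ of dimensions $n,n+1$ and $\mathbf M$ is mass. $(M_j,x_j)\xrightarrow[Z]{\mathrm F}(M_\infty,x_\infty)$ means in addition that $\varphi_j(x_j)\to\varphi_\infty(x_\infty)$ in $Z$. Intrinsic flat convergence is convergence with respect to the intrinsic flat distance, the infimum of the flat distances $d_F^Z$ between push-forwards over all separable complete $Z$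 and metric-isometric embeddings into $Z$ (with the current of $\mathbf 0$ being $0$). The distance from a point to a set is the infimum of distances to points of the set (with $\inf\emptyset=+\infty$). *)

theory Defs
  imports "HOL-Analysis.Analysis" "HOL-Library.Extended_Nat"
begin

section \<open>Metric spaces\<close>

definition metric_borel :: "'a metric \<Rightarrow> 'a measure" where
  "metric_borel E = sigma (mspace E) {U. openin (mtopology_of E) U}"

definition metric_isometric_embedding :: "'a metric \<Rightarrow> 'b metric \<Rightarrow> ('a \<Rightarrow> 'b) \<Rightarrow> bool" where
  "metric_isometric_embedding X Z \<phi> \<longleftrightarrow>
     \<phi> \<in> mspace X \<rightarrow> mspace Z \<and>
     (\<forall>x\<in>mspace X. \<forall>y\<in>mspace X. mdist Z (\<phi> x) (\<phi> y) = mdist X x y)"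

text \<open>The extension to \<open>E\<close> of a distance-preserving map \<open>\<phi>\<close> defined on a dense subset \<open>X\<close>.
  It exists and is unique if the target \<open>Z\<close> is complete.\<close>

definition embedding_extension ::
  "'a metric \<Rightarrow> 'a set \<Rightarrow> 'b metric \<Rightarrow> ('a \<Rightarrow> 'b) \<Rightarrow> 'a \<Rightarrow> 'b" where
  "embedding_extension E X Z \<phi> =
     (THE \<psi>. \<psi> \<in> extensional (mspace E) \<and> metric_isometric_embedding E Z \<psi> \<and> (\<forall>x\<in>X. \<psi> x = \<phi> x))"

definition dist_to_set :: "'a metric \<Rightarrow> 'a \<Rightarrow> 'a set \<Rightarrow> ennreal" where
  "dist_to_set E x S = (INF y\<in>S. ennreal (mdist E x y))"

definition hausdorff_dist :: "'a metric \<Rightarrow> 'a set \<Rightarrow> 'a set \<Rightarrow> ennreal" where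
  "hausdorff_dist E A B =
     max (SUP a\<in>A. dist_to_set E a B) (SUP b\<in>B. dist_to_set E b A)"

text \<open>Only the union of the two images matters in the infimum over all metric spaces \<open>Z\<close>, and this
  union injects into the sum of the two underlying types; so nothing is lost by letting \<open>Z\<close> range
  over the metric spaces carried by subsets of the sum type.\<close>

definition gh_dist :: "'a metric \<Rightarrow> 'b metric \<Rightarrow> ennreal" where
  "gh_dist X Y =
     (INF (Z, \<phi>, \<psi>) \<in> {(Z :: ('a + 'b) metric, \<phi>, \<psi>).
          metric_isometric_embedding X Z \<phi> \<and> metric_isometric_embedding Y Z \<psi>}.
        hausdorff_dist Z (\<phi> ` mspace X) (\<psi> ` mspace Y))"

text \<open>Euclidean space \<open>\<real>\<^sup>k\<close> with \<open>k\<close> a variable, on the carrier of the product measure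
  \<open>\<Pi>\<^sub>M i\<in>{..<k}. lborel\<close>.\<close>

definition euclid :: "nat \<Rightarrow> (nat \<Rightarrow> real) metric" where
  "euclid k = metric ({..<k} \<rightarrow>\<^sub>E UNIV, \<lambda>x y. L2_set (\<lambda>i. x i - y i) {..<k})"

lemma Metric_space_euclid: "Metric_space ({..<k::nat} \<rightarrow>\<^sub>E UNIV) (\<lambda>x y. L2_set (\<lambda>i. x i - y i) {..<k})"
proof
  fix x y z :: "nat \<Rightarrow> real"
  show "0 \<le> L2_set (\<lambda>i. x i - y i) {..<k}"
    by simp
  show "L2_set (\<lambda>i. x i - y i) {..<k} = L2_set (\<lambda>i. y i - x i) {..<k}"
    by (simp add: L2_set_def power2_commute)
  show "L2_set (\<lambda>i. x i - z i) {..<k}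
      \<le> L2_set (\<lambda>i. x i - y i) {..<k} + L2_set (\<lambda>i. y i - z i) {..<k}"
    using L2_set_triangle_ineq[of "\<lambda>i. x i - y i" "\<lambda>i. y i - z i" "{..<k}"] by simp
  assume "x \<in> {..<k} \<rightarrow>\<^sub>E UNIV" "y \<in> {..<k} \<rightarrow>\<^sub>E UNIV"
  then show "L2_set (\<lambda>i. x i - y i) {..<k} = 0 \<longleftrightarrow> x = y"
    by (auto simp: L2_set_eq_0_iff intro: PiE_ext)
qed

lemma mspace_euclid [simp]: "mspace (euclid k) = {..<k} \<rightarrow>\<^sub>E UNIV"
  and mdist_euclid [simp]: "mdist (euclid k) = (\<lambda>x y. L2_set (\<lambda>i. x i - y i) {..<k})"
  by (simp_all add: euclid_def Metric_space_euclid Metric_space.mspace_metric Metric_space.mdist_metric)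

definition lebesgue_euclid :: "nat \<Rightarrow> (nat \<Rightarrow> real) measure" where
  "lebesgue_euclid k = completion (\<Pi>\<^sub>M i\<in>{..<k}. lborel)"

subsection \<open>Hausdorff measure and rectifiable sets\<close>

definition ediam :: "'a metric \<Rightarrow> 'a set \<Rightarrow> ennreal" where
  "ediam E B = (SUP x\<in>B. SUP y\<in>B. ennreal (mdist E x y))"

text \<open>The case distinction is needed for \<open>k = 0\<close> only: a point has gauge \<open>1\<close>, the empty set \<open>0\<close>.\<close>

definition hausdorff_gauge :: "nat \<Rightarrow> 'a metric \<Rightarrow> 'a set \<Rightarrow> ennreal" where
  "hausdorff_gauge k E B =
     (if B = {} then 0 else ennreal (unit_ball_vol (real k) / 2 ^ k) * ediam E B ^ k)"

definition hausdorff_measure :: "nat \<Rightarrow> 'a metric \<Rightarrow> 'a set \<Rightarrow> ennreal" where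
  "hausdorff_measure k E A =
     (SUP \<delta>\<in>{0<..}. INF B \<in> {B :: nat \<Rightarrow> 'a set.
          (\<forall>i. B i \<subseteq> mspace E \<and> ediam E (B i) \<le> ennreal \<delta>) \<and> A \<subseteq> (\<Union>i. B i)}.
        \<Sum>i. hausdorff_gauge k E (B i))"

definition hausdorff_measurable :: "nat \<Rightarrow> 'a metric \<Rightarrow> 'a set \<Rightarrow> bool" where
  "hausdorff_measurable k E S \<longleftrightarrow> S \<subseteq> mspace E \<and>
     (\<forall>B\<subseteq>mspace E. hausdorff_measure k E B =
        hausdorff_measure k E (B \<inter> S) + hausdorff_measure k E (B - S))"

definition countably_rectifiable :: "nat \<Rightarrow> 'a metric \<Rightarrow> 'a set \<Rightarrow> bool" where
  "countably_rectifiable k E S \<longleftrightarrow> hausdorff_measurable k E S \<and>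
     (\<exists>(A :: nat \<Rightarrow> (nat \<Rightarrow> real) set) f.
        (\<forall>i. A i \<subseteq> mspace (euclid k) \<and>
             Lipschitz_continuous_map (submetric (euclid k) (A i)) E (f i)) \<and>
        hausdorff_measure k E (S - (\<Union>i. f i ` A i)) = 0)"

section \<open>Ambrosio--Kirchheim currents\<close>

text \<open>A functional of dimension \<open>k\<close> takes a function \<open>f\<close> and the list \<open>[\<pi>\<^sub>1, \<dots>, \<pi>\<^sub>k]\<close>. Its values are
  meaningful only on \<open>forms k E\<close>, and functions enter only through their restriction to
  \<open>mspace E\<close>; accordingly equality of functionals is \<open>cur_eq\<close>, not \<open>(=)\<close>.\<close>

type_synonym 'a functional = "('a \<Rightarrow> real) \<Rightarrow> ('a \<Rightarrow> real) list \<Rightarrow> real"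

definition lip_functions :: "'a metric \<Rightarrow> ('a \<Rightarrow> real) set" where
  "lip_functions E = {p. Lipschitz_continuous_map E euclidean_metric p}"

definition bounded_lip_functions :: "'a metric \<Rightarrow> ('a \<Rightarrow> real) set" where
  "bounded_lip_functions E = {f \<in> lip_functions E. bounded (f ` mspace E)}"

definition lip_const :: "'a metric \<Rightarrow> ('a \<Rightarrow> real) \<Rightarrow> real" where
  "lip_const E p =
     Inf {C. 0 \<le> C \<and> (\<forall>x\<in>mspace E. \<forall>y\<in>mspace E. \<bar>p x - p y\<bar> \<le> C * mdist E x y)}"

definition form_tuples :: "nat \<Rightarrow> 'a metric \<Rightarrow> ('a \<Rightarrow> real) list set" where
  "form_tuples k E = {\<pi>. length \<pi> = k \<and> set \<pi> \<subseteq> lip_functions E}"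

definition forms :: "nat \<Rightarrow> 'a metric \<Rightarrow> (('a \<Rightarrow> real) \<times> ('a \<Rightarrow> real) list) set" where
  "forms k E = bounded_lip_functions E \<times> form_tuples k E"

definition cur_eq :: "nat \<Rightarrow> 'a metric \<Rightarrow> 'a functional \<Rightarrow> 'a functional \<Rightarrow> bool" where
  "cur_eq k E S T \<longleftrightarrow> (\<forall>(f, \<pi>) \<in> forms k E. S f \<pi> = T f \<pi>)"

definition multilinear_functional :: "nat \<Rightarrow> 'a metric \<Rightarrow> 'a functional \<Rightarrow> bool" where
  "multilinear_functional k E T \<longleftrightarrow>
     (\<forall>f\<in>bounded_lip_functions E. \<forall>g\<in>bounded_lip_functions E. \<forall>\<pi>\<in>form_tuples k E. \<forall>a b.
        T (\<lambda>x. a * f x + b * g x) \<pi> = a * T f \<pi> + b * T g \<pi>) \<and>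
     (\<forall>f\<in>bounded_lip_functions E. \<forall>\<pi>\<in>form_tuples k E. \<forall>i<k.
        \<forall>p\<in>lip_functions E. \<forall>q\<in>lip_functions E. \<forall>a b.
        T f (\<pi>[i := (\<lambda>x. a * p x + b * q x)]) = a * T f (\<pi>[i := p]) + b * T f (\<pi>[i := q]))"

definition continuous_functional :: "nat \<Rightarrow> 'a metric \<Rightarrow> 'a functional \<Rightarrow> bool" where
  "continuous_functional k E T \<longleftrightarrow>
     (\<forall>f\<in>bounded_lip_functions E. \<forall>\<pi>\<in>form_tuples k E. \<forall>P :: nat \<Rightarrow> ('a \<Rightarrow> real) list.
        (\<forall>m. P m \<in> form_tuples k E) \<and>
        (\<exists>C. \<forall>m. \<forall>i<k. lip_const E (P m ! i) \<le> C) \<and>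
        (\<forall>i<k. \<forall>x\<in>mspace E. (\<lambda>m. (P m ! i) x) \<longlonglongrightarrow> (\<pi> ! i) x)
        \<longrightarrow> (\<lambda>m. T f (P m)) \<longlonglongrightarrow> T f \<pi>)"

definition local_functional :: "nat \<Rightarrow> 'a metric \<Rightarrow> 'a functional \<Rightarrow> bool" where
  "local_functional k E T \<longleftrightarrow>
     (\<forall>(f, \<pi>) \<in> forms k E.
        (\<exists>i<k. \<exists>U c. openin (mtopology_of E) U \<and> {x \<in> mspace E. f x \<noteq> 0} \<subseteq> U \<and>
           (\<forall>x\<in>U. (\<pi> ! i) x = c))
        \<longrightarrow> T f \<pi> = 0)"

definition mass_bound :: "nat \<Rightarrow> 'a metric \<Rightarrow> 'a functional \<Rightarrow> 'a measure \<Rightarrow> bool" where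
  "mass_bound k E T \<mu> \<longleftrightarrow>
     sets \<mu> = sets (metric_borel E) \<and> finite_measure \<mu> \<and>
     (\<forall>(f, \<pi>) \<in> forms k E.
        \<bar>T f \<pi>\<bar> \<le> prod_list (map (lip_const E) \<pi>) * (\<integral>x. \<bar>f x\<bar> \<partial>\<mu>))"

definition is_current :: "nat \<Rightarrow> 'a metric \<Rightarrow> 'a functional \<Rightarrow> bool" where
  "is_current k E T \<longleftrightarrow>
     multilinear_functional k E T \<and> continuous_functional k E T \<and> local_functional k E T \<and>
     (\<exists>\<mu>. mass_bound k E T \<mu>)"

text \<open>The measure \<open>\<parallel>T\<parallel>\<close> is the least finite Borel measure bounding \<open>T\<close>.\<close>

definition mass_measure :: "nat \<Rightarrow> 'a metric \<Rightarrow> 'a functional \<Rightarrow> 'a measure" where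
  "mass_measure k E T =
     (THE \<mu>. mass_bound k E T \<mu> \<and>
        (\<forall>\<nu>. mass_bound k E T \<nu> \<longrightarrow> (\<forall>A\<in>sets \<mu>. emeasure \<mu> A \<le> emeasure \<nu> A)))"

definition mass :: "nat \<Rightarrow> 'a metric \<Rightarrow> 'a functional \<Rightarrow> ennreal" where
  "mass k E T = emeasure (mass_measure k E T) (mspace E)"

definition cur_set :: "nat \<Rightarrow> 'a metric \<Rightarrow> 'a functional \<Rightarrow> 'a set" where
  "cur_set k E T =
     {p \<in> mspace E.
        0 < Liminf (at_right 0) (\<lambda>r. emeasure (mass_measure k E T) (mball_of E p r) / ennreal (r ^ k))}"

definition cur_boundary :: "'a functional \<Rightarrow> 'a functional" where
  "cur_boundary T = (\<lambda>f \<pi>. T (\<lambda>_. 1) (f # \<pi>))"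

definition push_forward :: "('a \<Rightarrow> 'b) \<Rightarrow> 'a functional \<Rightarrow> 'b functional" where
  "push_forward \<phi> T = (\<lambda>f \<pi>. T (f \<circ> \<phi>) (map (\<lambda>p. p \<circ> \<phi>) \<pi>))"

text \<open>\<open>T\<close> extends in the first argument from bounded Lipschitz functions to bounded Borel functions,
  by density of the former in \<open>L\<^sup>1(\<parallel>T\<parallel>)\<close>. The restriction of \<open>T\<close> to a Borel set is defined through
  this extension.\<close>

definition borel_extension :: "nat \<Rightarrow> 'a metric \<Rightarrow> 'a functional \<Rightarrow> 'a functional" where
  "borel_extension k E T g \<pi> =
     (THE L. \<forall>F :: nat \<Rightarrow> 'a \<Rightarrow> real.
        (\<forall>m. F m \<in> bounded_lip_functions E) \<and>
        (\<lambda>m. \<integral>\<^sup>+x. ennreal \<bar>F m x - g x\<bar> \<partial>mass_measure k E T) \<longlonglongrightarrow> 0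
        \<longrightarrow> (\<lambda>m. T (F m) \<pi>) \<longlonglongrightarrow> L)"

definition cur_restrict :: "nat \<Rightarrow> 'a metric \<Rightarrow> 'a functional \<Rightarrow> 'a set \<Rightarrow> 'a functional" where
  "cur_restrict k E T A = (\<lambda>f \<pi>. borel_extension k E T (\<lambda>x. f x * indicator A x) \<pi>)"

text \<open>The current \<open>(f, \<pi>) \<mapsto> \<integral> \<theta> f det(\<nabla>\<pi>)\<close> on \<open>\<real>\<^sup>k\<close>; the partial derivatives exist almost
  everywhere by Rademacher's theorem.\<close>

definition jacobian :: "nat \<Rightarrow> ((nat \<Rightarrow> real) \<Rightarrow> real) list \<Rightarrow> (nat \<Rightarrow> real) \<Rightarrow> real" where
  "jacobian k \<pi> x =
     (\<Sum>s | s permutes {..<k}. of_int (sign s) *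
        (\<Prod>i<k. deriv (\<lambda>t. (\<pi> ! i) (x(s i := t))) (x (s i))))"

definition euclid_current :: "nat \<Rightarrow> ((nat \<Rightarrow> real) \<Rightarrow> real) \<Rightarrow> (nat \<Rightarrow> real) functional" where
  "euclid_current k \<theta> = (\<lambda>f \<pi>. \<integral>x. \<theta> x * f x * jacobian k \<pi> x \<partial>lebesgue_euclid k)"

definition rectifiable_current :: "nat \<Rightarrow> 'a metric \<Rightarrow> 'a functional \<Rightarrow> bool" where
  "rectifiable_current k E T \<longleftrightarrow> is_current k E T \<and>
     (\<exists>S. countably_rectifiable k E S \<and>
        (\<exists>N \<in> null_sets (mass_measure k E T). mspace E - S \<subseteq> N)) \<and>
     (\<forall>B \<in> sets (metric_borel E).
        hausdorff_measure k E B = 0 \<longrightarrow> emeasure (mass_measure k E T) B = 0)"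

text \<open>For \<open>k = 0\<close> the conditions say that \<open>T\<close> is a finite sum of point masses with integer weights.\<close>

definition integer_rectifiable_current :: "nat \<Rightarrow> 'a metric \<Rightarrow> 'a functional \<Rightarrow> bool" where
  "integer_rectifiable_current k E T \<longleftrightarrow> rectifiable_current k E T \<and>
     (\<forall>\<phi> A. Lipschitz_continuous_map E (euclid k) \<phi> \<and> openin (mtopology_of E) A \<longrightarrow>
        (\<exists>\<theta>. integrable (lebesgue_euclid k) \<theta> \<and> (\<forall>x\<in>mspace (euclid k). \<theta> x \<in> \<int>) \<and>
           cur_eq k (euclid k) (push_forward \<phi> (cur_restrict k E T A)) (euclid_current k \<theta>)))"

definition normal_current :: "nat \<Rightarrow> 'a metric \<Rightarrow> 'a functional \<Rightarrow> bool" where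
  "normal_current k E T \<longleftrightarrow>
     is_current k E T \<and> (k \<ge> 1 \<longrightarrow> is_current (k - 1) E (cur_boundary T))"

definition integral_current :: "nat \<Rightarrow> 'a metric \<Rightarrow> 'a functional \<Rightarrow> bool" where
  "integral_current k E T \<longleftrightarrow> integer_rectifiable_current k E T \<and> normal_current k E T"

definition flat_dist :: "nat \<Rightarrow> 'a metric \<Rightarrow> 'a functional \<Rightarrow> 'a functional \<Rightarrow> ennreal" where
  "flat_dist n Z S T =
     (INF (U, V) \<in> {(U, V). integral_current n Z U \<and> integral_current (Suc n) Z V \<and>
          cur_eq n Z (\<lambda>f \<pi>. S f \<pi> - T f \<pi>) (\<lambda>f \<pi>. U f \<pi> + cur_boundary V f \<pi>)}.
        mass n Z U + mass (Suc n) Z V)"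

section \<open>Integral current spaces\<close>

text \<open>The underlying metric space \<open>X\<close> is \<open>sp_set M\<close> with the metric inherited from its completion
  \<open>sp_compl M\<close>, a complete metric space in which \<open>X\<close> is dense.\<close>

record 'a current_space =
  sp_set :: "'a set"
  sp_compl :: "'a metric"
  sp_cur :: "'a functional"

abbreviation sp_metric :: "'a current_space \<Rightarrow> 'a metric" where
  "sp_metric M \<equiv> submetric (sp_compl M) (sp_set M)"

definition integral_current_space :: "nat \<Rightarrow> 'a current_space \<Rightarrow> bool" where
  "integral_current_space n M \<longleftrightarrow>
     sp_set M \<subseteq> mspace (sp_compl M) \<and>
     mcomplete_of (sp_compl M) \<and>
     mtopology_of (sp_compl M) closure_of sp_set M = mspace (sp_compl M) \<and>
     integral_current n (sp_compl M) (sp_cur M) \<and>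
     cur_set n (sp_compl M) (sp_cur M) = sp_set M"

text \<open>The zero space: the empty metric space with the current \<open>0\<close>.\<close>

definition zero_space :: "'a current_space" where
  "zero_space = \<lparr>sp_set = {}, sp_compl = metric ({}, \<lambda>_ _. 0), sp_cur = (\<lambda>_ _. 0)\<rparr>"

text \<open>An integral current \<open>S\<close> on a complete space \<open>E\<close> is concentrated on \<open>C = closure (cur_set k E S)\<close>.
  Regarded as a current on \<open>C\<close>, it is evaluated by extending Lipschitz functions from \<open>C\<close> to \<open>E\<close>
  (McShane); the value does not depend on the extensions chosen.\<close>

definition lip_extension :: "'a metric \<Rightarrow> 'a set \<Rightarrow> ('a \<Rightarrow> real) \<Rightarrow> 'a \<Rightarrow> real" where
  "lip_extension E C f =
     (SOME g. g \<in> lip_functions E \<and> (\<forall>x\<in>C. g x = f x) \<and>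
        (bounded (f ` C) \<longrightarrow> bounded (g ` mspace E)))"

definition cur_on_subset :: "'a metric \<Rightarrow> 'a set \<Rightarrow> 'a functional \<Rightarrow> 'a functional" where
  "cur_on_subset E C S = (\<lambda>f \<pi>. S (lip_extension E C f) (map (lip_extension E C) \<pi>))"

text \<open>The integral current space \<open>(set(S), d, S)\<close>.\<close>

definition space_of_current :: "nat \<Rightarrow> 'a metric \<Rightarrow> 'a functional \<Rightarrow> 'a current_space" where
  "space_of_current k E S =
     (let C = mtopology_of E closure_of cur_set k E S in
      \<lparr>sp_set = cur_set k E S, sp_compl = submetric E C, sp_cur = cur_on_subset E C S\<rparr>)"

definition space_boundary :: "nat \<Rightarrow> 'a current_space \<Rightarrow> 'a current_space" where
  "space_boundary n M = space_of_current (n - 1) (sp_compl M) (cur_boundary (sp_cur M))"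

definition boundary_decomposition ::
  "nat \<Rightarrow> 'a current_space \<Rightarrow> 'a functional \<Rightarrow> 'a functional \<Rightarrow> bool" where
  "boundary_decomposition n M S\<^sub>1 S\<^sub>2 \<longleftrightarrow>
     integral_current (n - 1) (sp_compl M) S\<^sub>1 \<and> integral_current (n - 1) (sp_compl M) S\<^sub>2 \<and>
     cur_eq (n - 1) (sp_compl M) (cur_boundary (sp_cur M)) (\<lambda>f \<pi>. S\<^sub>1 f \<pi> + S\<^sub>2 f \<pi>)"

text \<open>Extension to the completion of a map defined on the space itself.\<close>

abbreviation sp_extension :: "'a current_space \<Rightarrow> 'z metric \<Rightarrow> ('a \<Rightarrow> 'z) \<Rightarrow> 'a \<Rightarrow> 'z" where
  "sp_extension M Z \<phi> \<equiv> embedding_extension (sp_compl M) (sp_set M) Z \<phi>"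

definition sp_push :: "'a current_space \<Rightarrow> 'z metric \<Rightarrow> ('a \<Rightarrow> 'z) \<Rightarrow> 'z functional" where
  "sp_push M Z \<phi> = push_forward (sp_extension M Z \<phi>) (sp_cur M)"

text \<open>A separable metric space has at most the cardinality of the continuum, so up to isometry every
  separable complete metric space occurs among those carried by sets of reals.\<close>

definition intrinsic_flat_dist :: "nat \<Rightarrow> 'a current_space \<Rightarrow> 'b current_space \<Rightarrow> ennreal" where
  "intrinsic_flat_dist n M N =
     (INF (Z, \<phi>, \<psi>) \<in> {(Z :: real metric, \<phi>, \<psi>).
          mcomplete_of Z \<and> separable_space (mtopology_of Z) \<and>
          metric_isometric_embedding (sp_metric M) Z \<phi> \<and>
          metric_isometric_embedding (sp_metric N) Z \<psi>}.
        flat_dist n Z (sp_push M Z \<phi>) (sp_push N Z \<psi>))"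

definition intrinsic_flat_converges ::
  "nat \<Rightarrow> (nat \<Rightarrow> 'a current_space) \<Rightarrow> 'b current_space \<Rightarrow> bool" where
  "intrinsic_flat_converges n M N \<longleftrightarrow> (\<lambda>j. intrinsic_flat_dist n (M j) N) \<longlonglongrightarrow> 0"

text \<open>Sequences with a limit object are indexed by \<^typ>\<open>enat\<close>, the limit being at \<open>\<infinity>\<close>.\<close>

definition flat_converges_in ::
  "nat \<Rightarrow> 'z metric \<Rightarrow> (enat \<Rightarrow> 'a current_space) \<Rightarrow> (enat \<Rightarrow> 'a \<Rightarrow> 'z) \<Rightarrow> bool" where
  "flat_converges_in n Z M \<phi> \<longleftrightarrow>
     (\<lambda>j. flat_dist n Z (sp_push (M (enat j)) Z (\<phi> (enat j))) (sp_push (M \<infinity>) Z (\<phi> \<infinity>)))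
       \<longlonglongrightarrow> 0"

definition pointed_flat_converges_in ::
  "nat \<Rightarrow> 'z metric \<Rightarrow> (enat \<Rightarrow> 'a current_space) \<Rightarrow> (enat \<Rightarrow> 'a \<Rightarrow> 'z) \<Rightarrow> (enat \<Rightarrow> 'a) \<Rightarrow> bool" where
  "pointed_flat_converges_in n Z M \<phi> x \<longleftrightarrow>
     flat_converges_in n Z M \<phi> \<and>
     limitin (mtopology_of Z) (\<lambda>j. sp_extension (M (enat j)) Z (\<phi> (enat j)) (x (enat j)))
       (sp_extension (M \<infinity>) Z (\<phi> \<infinity>) (x \<infinity>)) sequentially"

end

theory Submission
  imports Defs
begin

text \<open>
  Flat convergence implies weak convergence of the boundaries: for a fixed form
  \<open>(f, \<pi>)\<close> on \<open>Z\<close> the values \<open>\<partial>T\<^sub>j(f, \<pi>)\<close> of the pushed-forward boundaries tend to \<open>\<partial>T\<^sub>\<infinity>(f, \<pi>)\<close>,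
  because a decomposition \<open>T\<^sub>j - T\<^sub>\<infinity> = U + \<partial>V\<close> gives \<open>\<partial>T\<^sub>j - \<partial>T\<^sub>\<infinity> = \<partial>U\<close>, whose value is bounded by a
  constant of the form times \<open>\<^bold>M(U)\<close>. The pieces \<open>S\<^sub>2\<close> tend to \<open>0\<close> on forms as well. They are small in
  the intrinsic flat sense only, so the filling lives in another space; but a form on the carrier of
  \<open>S\<^sub>2\<close> extends to that space with the same bound and the same Lipschitz constants (McShane), and
  the estimate depends on these alone (\<open>intrinsic_flat_dist_zero_estimate\<close>). Hence \<open>S\<^sub>1\<close> converges weakly to \<open>\<partial>T\<^sub>\<infinity>\<close>
  (\<open>boundary_weak_convergence\<close>).

  Let \<open>p \<in> set(\<partial>T\<^sub>\<infinity>)\<close>. Every ball around \<open>p\<close> has positive mass, so some form supported in it has a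
  nonzero value under \<open>\<partial>T\<^sub>\<infinity>\<close> (\<open>mass_ball_witness\<close>), hence eventually under \<open>S\<^sub>1\<close>. Since \<open>S\<^sub>1\<close> is
  concentrated on the closure of its set, that set meets the ball: \<open>p\<close> is a limit of points of
  \<open>\<Sigma>\<^sub>j\<close> (\<open>boundary_points_approached\<close>). Part (i) follows by the triangle inequality. For part (ii) the
  approximation is uniform on the compact set \<open>\<Sigma>\<^sub>\<infinity>\<close>, so that \<open>\<Sigma>\<^sub>\<infinity>\<close> lies near \<open>\<Sigma>\<^sub>j\<close>. Together with an
  almost isometry \<open>\<Sigma>\<^sub>j \<rightarrow> \<Sigma>\<^sub>\<infinity>\<close>, which Gromov--Hausdorff convergence supplies, this yields almost
  isometries of the compact set \<open>\<Sigma>\<^sub>\<infinity>\<close> into itself; a point of \<open>\<Sigma>\<^sub>j\<close> far from \<open>\<Sigma>\<^sub>\<infinity>\<close> would give,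
  under iteration, more separated points of \<open>\<Sigma>\<^sub>\<infinity>\<close> than total boundedness allows (\<open>almost_isometry_almost_onto\<close>).

  Two facts about currents carry the argument. The first is that a current has a least mass bound
  (\<open>least_mass_bound_exists\<close>), obtained by minimising total mass among densities with respect to one
  mass bound; two mass bounds can be combined by using one on a Borel set and the other off it. The
  second is that the mass measure \<open>\<mu>\<close> of a rectifiable current is carried by the closure of its set
  (\<open>rectifiable_mass_carried_by_set\<close>). Up to a null set, \<open>\<mu>\<close> lives on countably many Lipschitz images of subsets of \<open>\<real>\<^sup>k\<close>; if such an image,
  intersected with a closed set \<open>W\<close>, has positive outer measure, then bisecting dyadic cubes and keeping each
  time the piece whose image has the largest outer measure leads to a point of \<open>W\<close> around which
  \<open>\<mu>(B(p,r)) \<ge> c r\<^sup>k\<close> for all small \<open>r\<close>.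
\<close>

section \<open>Lipschitz functions on a metric space\<close>

lemma mdist_refl [simp]: "x \<in> mspace E \<Longrightarrow> mdist E x x = 0"
  by simp

definition lipschitz_bound :: "'a metric \<Rightarrow> real \<Rightarrow> ('a \<Rightarrow> real) \<Rightarrow> bool" where
  "lipschitz_bound E C p \<longleftrightarrow>
     0 \<le> C \<and> (\<forall>x\<in>mspace E. \<forall>y\<in>mspace E. \<bar>p x - p y\<bar> \<le> C * mdist E x y)"

lemma lipschitz_boundI:
  assumes "0 \<le> C" "\<And>x y. x \<in> mspace E \<Longrightarrow> y \<in> mspace E \<Longrightarrow> p x - p y \<le> C * mdist E x y"
  shows "lipschitz_bound E C p"
  unfolding lipschitz_bound_def
proof (intro conjI ballI assms(1))
  fix x y assume "x \<in> mspace E" "y \<in> mspace E"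
  then show "\<bar>p x - p y\<bar> \<le> C * mdist E x y"
    using assms(2)[of x y] assms(2)[of y x] by (simp add: mdist_commute[of E y x] abs_le_iff)
qed

lemma lipschitz_boundD:
  assumes "lipschitz_bound E C p" "x \<in> mspace E" "y \<in> mspace E"
  shows "\<bar>p x - p y\<bar> \<le> C * mdist E x y"
  using assms by (auto simp: lipschitz_bound_def)

lemma lipschitz_bound_nonneg: "lipschitz_bound E C p \<Longrightarrow> 0 \<le> C"
  by (auto simp: lipschitz_bound_def)

lemma lip_functions_iff: "p \<in> lip_functions E \<longleftrightarrow> (\<exists>C. lipschitz_bound E C p)"
proof
  assume "p \<in> lip_functions E"
  then obtain B where "B > 0" "\<forall>x\<in>mspace E. \<forall>y\<in>mspace E. dist (p x) (p y) \<le> B * mdist E x y"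
    by (auto simp: lip_functions_def Lipschitz_continuous_map_pos)
  then show "\<exists>C. lipschitz_bound E C p"
    by (intro exI[of _ B]) (auto simp: lipschitz_bound_def dist_real_def)
next
  assume "\<exists>C. lipschitz_bound E C p"
  then show "p \<in> lip_functions E"
    by (auto simp: lip_functions_def Lipschitz_continuous_map_def lipschitz_bound_def dist_real_def)
qed

lemma lip_functionsI: "lipschitz_bound E C p \<Longrightarrow> p \<in> lip_functions E"
  by (auto simp: lip_functions_iff)

lemma lip_const_bound:
  assumes "p \<in> lip_functions E"
  shows "lipschitz_bound E (lip_const E p) p"
proof -
  let ?S = "{C. 0 \<le> C \<and> (\<forall>x\<in>mspace E. \<forall>y\<in>mspace E. \<bar>p x - p y\<bar> \<le> C * mdist E x y)}"
  obtain C where C: "lipschitz_bound E C p" using assms by (auto simp: lip_functions_iff)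
  then have ne: "?S \<noteq> {}" by (auto simp: lipschitz_bound_def)
  have nonneg: "0 \<le> Inf ?S" using ne by (intro cInf_greatest) auto
  have "\<bar>p x - p y\<bar> \<le> Inf ?S * mdist E x y" if xy: "x \<in> mspace E" "y \<in> mspace E" for x y
  proof (cases "mdist E x y = 0")
    case True
    then show ?thesis using lipschitz_boundD[OF C xy] by simp
  next
    case False
    then have pos: "0 < mdist E x y" using mdist_nonneg[of E x y] by linarith
    have "\<bar>p x - p y\<bar> / mdist E x y \<le> Inf ?S"
      using ne pos xy by (intro cInf_greatest) (auto simp: field_simps)
    then show ?thesis using pos by (simp add: field_simps)
  qed
  then show ?thesis using nonneg by (auto simp: lipschitz_bound_def lip_const_def)
qed

lemma lip_const_le: "lipschitz_bound E C p \<Longrightarrow> lip_const E p \<le> C"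
  unfolding lip_const_def lipschitz_bound_def by (intro cInf_lower bdd_belowI[of _ 0]) auto

lemma lip_const_nonneg: "p \<in> lip_functions E \<Longrightarrow> 0 \<le> lip_const E p"
  using lip_const_bound lipschitz_bound_nonneg by blast

lemma lipschitz_bound_const: "lipschitz_bound E 0 (\<lambda>_. c)"
  by (auto simp: lipschitz_bound_def)

lemma lipschitz_bound_lincomb:
  assumes "lipschitz_bound E C p" "lipschitz_bound E D q"
  shows "lipschitz_bound E (\<bar>a\<bar> * C + \<bar>b\<bar> * D) (\<lambda>x. a * p x + b * q x)"
proof (rule lipschitz_boundI)
  show "0 \<le> \<bar>a\<bar> * C + \<bar>b\<bar> * D" using assms by (simp add: lipschitz_bound_nonneg)
  fix x y assume xy: "x \<in> mspace E" "y \<in> mspace E"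
  have "a * p x + b * q x - (a * p y + b * q y) = a * (p x - p y) + b * (q x - q y)"
    by (simp add: algebra_simps)
  also have "\<dots> \<le> \<bar>a\<bar> * \<bar>p x - p y\<bar> + \<bar>b\<bar> * \<bar>q x - q y\<bar>"
    by (intro add_mono) (simp_all flip: abs_mult)
  also have "\<dots> \<le> \<bar>a\<bar> * (C * mdist E x y) + \<bar>b\<bar> * (D * mdist E x y)"
    using lipschitz_boundD[OF assms(1) xy] lipschitz_boundD[OF assms(2) xy]
    by (intro add_mono mult_left_mono) auto
  finally show "a * p x + b * q x - (a * p y + b * q y) \<le> (\<bar>a\<bar> * C + \<bar>b\<bar> * D) * mdist E x y"
    by (simp add: algebra_simps)
qed

lemma lipschitz_bound_max:
  assumes "lipschitz_bound E C p" "lipschitz_bound E C q"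
  shows "lipschitz_bound E C (\<lambda>x. max (p x) (q x))"
proof (rule lipschitz_boundI)
  show "0 \<le> C" using assms(1) by (rule lipschitz_bound_nonneg)
  fix x y assume xy: "x \<in> mspace E" "y \<in> mspace E"
  show "max (p x) (q x) - max (p y) (q y) \<le> C * mdist E x y"
    using lipschitz_boundD[OF assms(1) xy] lipschitz_boundD[OF assms(2) xy] by linarith
qed

lemma lipschitz_bound_min:
  assumes "lipschitz_bound E C p" "lipschitz_bound E C q"
  shows "lipschitz_bound E C (\<lambda>x. min (p x) (q x))"
proof (rule lipschitz_boundI)
  show "0 \<le> C" using assms(1) by (rule lipschitz_bound_nonneg)
  fix x y assume xy: "x \<in> mspace E" "y \<in> mspace E"
  show "min (p x) (q x) - min (p y) (q y) \<le> C * mdist E x y"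
    using lipschitz_boundD[OF assms(1) xy] lipschitz_boundD[OF assms(2) xy] by linarith
qed

lemma lipschitz_bound_mono: "lipschitz_bound E C p \<Longrightarrow> C \<le> D \<Longrightarrow> lipschitz_bound E D p"
  unfolding lipschitz_bound_def
  by (auto intro: order_trans[OF _ mult_right_mono[OF _ mdist_nonneg]])

lemma lipschitz_bound_clip:
  assumes "lipschitz_bound E C p"
  shows "lipschitz_bound E C (\<lambda>x. max (- b) (min b (p x)))"
  using lipschitz_bound_mono[OF lipschitz_bound_const lipschitz_bound_nonneg[OF assms]]
  by (intro lipschitz_bound_max lipschitz_bound_min assms)

lemma lip_functions_const [simp, intro]: "(\<lambda>_. c) \<in> lip_functions E"
  using lip_functionsI[OF lipschitz_bound_const] .

lemma lip_functions_lincomb [intro]: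
  "p \<in> lip_functions E \<Longrightarrow> q \<in> lip_functions E \<Longrightarrow> (\<lambda>x. a * p x + b * q x) \<in> lip_functions E"
  by (auto simp: lip_functions_iff dest: lipschitz_bound_lincomb)

lemma lip_functions_max:
  "p \<in> lip_functions E \<Longrightarrow> q \<in> lip_functions E \<Longrightarrow> (\<lambda>x. max (p x) (q x)) \<in> lip_functions E"
  by (rule lip_functionsI[where C = "max (lip_const E p) (lip_const E q)"], rule lipschitz_bound_max)
    (rule lipschitz_bound_mono[OF lip_const_bound], assumption, simp)+

lemma lip_functions_min:
  "p \<in> lip_functions E \<Longrightarrow> q \<in> lip_functions E \<Longrightarrow> (\<lambda>x. min (p x) (q x)) \<in> lip_functions E"
  by (rule lip_functionsI[where C = "max (lip_const E p) (lip_const E q)"], rule lipschitz_bound_min)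
    (rule lipschitz_bound_mono[OF lip_const_bound], assumption, simp)+

lemma lip_functions_uminus: "p \<in> lip_functions E \<Longrightarrow> (\<lambda>x. - p x) \<in> lip_functions E"
  using lip_functions_lincomb[of p E p "-1" 0] by simp

lemma lip_functions_scale: "p \<in> lip_functions E \<Longrightarrow> (\<lambda>x. c * p x) \<in> lip_functions E"
  using lip_functions_lincomb[of p E p c 0] by simp

lemma lip_functions_diff:
  "p \<in> lip_functions E \<Longrightarrow> q \<in> lip_functions E \<Longrightarrow> (\<lambda>x. p x - q x) \<in> lip_functions E"
  using lip_functions_lincomb[of p E q 1 "-1"] by simp

lemma bounded_lip_iff:
  "f \<in> bounded_lip_functions E \<longleftrightarrow> f \<in> lip_functions E \<and> (\<exists>B\<ge>0. \<forall>x\<in>mspace E. \<bar>f x\<bar> \<le> B)"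
proof -
  have "bounded (f ` mspace E) \<longleftrightarrow> (\<exists>B\<ge>0. \<forall>x\<in>mspace E. \<bar>f x\<bar> \<le> B)"
  proof
    assume "bounded (f ` mspace E)"
    then obtain B where "\<forall>x\<in>mspace E. \<bar>f x\<bar> \<le> B" by (auto simp: bounded_iff)
    then show "\<exists>B\<ge>0. \<forall>x\<in>mspace E. \<bar>f x\<bar> \<le> B"
      by (intro exI[of _ "\<bar>B\<bar>"]) (auto intro: order_trans[OF _ abs_ge_self])
  qed (auto simp: bounded_iff)
  then show ?thesis by (auto simp: bounded_lip_functions_def)
qed

lemma bounded_lipI:
  "f \<in> lip_functions E \<Longrightarrow> (\<And>x. x \<in> mspace E \<Longrightarrow> \<bar>f x\<bar> \<le> B) \<Longrightarrow> f \<in> bounded_lip_functions E"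
  unfolding bounded_lip_iff by (intro conjI exI[of _ "\<bar>B\<bar>"]) (auto intro: order_trans[OF _ abs_ge_self])

lemma bounded_lipD: "f \<in> bounded_lip_functions E \<Longrightarrow> f \<in> lip_functions E"
  by (simp add: bounded_lip_iff)

lemma bounded_lip_bound:
  assumes "f \<in> bounded_lip_functions E"
  obtains B where "0 \<le> B" "\<And>x. x \<in> mspace E \<Longrightarrow> \<bar>f x\<bar> \<le> B"
  using assms by (auto simp: bounded_lip_iff)

lemma bounded_lip_const [simp, intro]: "(\<lambda>_. c) \<in> bounded_lip_functions E"
  by (rule bounded_lipI[of _ _ "\<bar>c\<bar>"]) auto

lemma bounded_lip_mult:
  assumes "f \<in> bounded_lip_functions E" "g \<in> bounded_lip_functions E"
  shows "(\<lambda>x. f x * g x) \<in> bounded_lip_functions E"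
proof -
  obtain A where A: "0 \<le> A" "\<And>x. x \<in> mspace E \<Longrightarrow> \<bar>f x\<bar> \<le> A"
    using bounded_lip_bound[OF assms(1)] by blast
  obtain B where B: "0 \<le> B" "\<And>x. x \<in> mspace E \<Longrightarrow> \<bar>g x\<bar> \<le> B"
    using bounded_lip_bound[OF assms(2)] by blast
  obtain C where C: "lipschitz_bound E C f" using assms(1) by (auto simp: bounded_lip_iff lip_functions_iff)
  obtain D where D: "lipschitz_bound E D g" using assms(2) by (auto simp: bounded_lip_iff lip_functions_iff)
  have "lipschitz_bound E (A * D + B * C) (\<lambda>x. f x * g x)"
  proof (rule lipschitz_boundI)
    show "0 \<le> A * D + B * C" using A B C D by (simp add: lipschitz_bound_nonneg)
    fix x y assume xy: "x \<in> mspace E" "y \<in> mspace E"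
    have "f x * g x - f y * g y = f x * (g x - g y) + g y * (f x - f y)" by (simp add: algebra_simps)
    also have "\<dots> \<le> \<bar>f x\<bar> * \<bar>g x - g y\<bar> + \<bar>g y\<bar> * \<bar>f x - f y\<bar>"
      by (intro add_mono) (simp_all flip: abs_mult)
    also have "\<dots> \<le> A * (D * mdist E x y) + B * (C * mdist E x y)"
      using A B lipschitz_boundD[OF C xy] lipschitz_boundD[OF D xy] xy
      by (intro add_mono mult_mono) auto
    finally show "f x * g x - f y * g y \<le> (A * D + B * C) * mdist E x y" by (simp add: algebra_simps)
  qed
  moreover have "\<bar>f x * g x\<bar> \<le> A * B" if "x \<in> mspace E" for x
    using A B that by (simp add: abs_mult mult_mono)
  ultimately show ?thesis by (blast intro: bounded_lipI lip_functionsI)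
qed

lemma bounded_lip_lincomb:
  assumes "f \<in> bounded_lip_functions E" "g \<in> bounded_lip_functions E"
  shows "(\<lambda>x. a * f x + b * g x) \<in> bounded_lip_functions E"
proof -
  obtain A where A: "0 \<le> A" "\<And>x. x \<in> mspace E \<Longrightarrow> \<bar>f x\<bar> \<le> A"
    using bounded_lip_bound[OF assms(1)] by blast
  obtain B where B: "0 \<le> B" "\<And>x. x \<in> mspace E \<Longrightarrow> \<bar>g x\<bar> \<le> B"
    using bounded_lip_bound[OF assms(2)] by blast
  have "\<bar>a * f x + b * g x\<bar> \<le> \<bar>a\<bar> * A + \<bar>b\<bar> * B" if "x \<in> mspace E" for x
    by (rule order_trans[OF abs_triangle_ineq]) (use A B that in \<open>auto simp: abs_mult intro!: add_mono mult_left_mono\<close>)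
  then show ?thesis using assms by (blast intro: bounded_lipI bounded_lipD)
qed

lemma bounded_lip_diff:
  "f \<in> bounded_lip_functions E \<Longrightarrow> g \<in> bounded_lip_functions E \<Longrightarrow>
     (\<lambda>x. f x - g x) \<in> bounded_lip_functions E"
  using bounded_lip_lincomb[of f E g 1 "-1"] by simp

lemma lipschitz_bound_mdist:
  assumes "a \<in> mspace E"
  shows "lipschitz_bound E 1 (mdist E a)"
proof (rule lipschitz_boundI)
  fix x y assume "x \<in> mspace E" "y \<in> mspace E"
  then show "mdist E a x - mdist E a y \<le> 1 * mdist E x y"
    using mdist_triangle[of a E y x] assms by (simp add: mdist_commute)
qed simp

text \<open>Proved by McShane's formula \<open>q x = inf (p a + C d(x,a))\<close>, the largest \<open>C\<close>-Lipschitz extension.\<close>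

lemma McShane_extension:
  assumes A: "A \<subseteq> mspace E" and C: "0 \<le> C"
    and p: "\<And>x y. x \<in> A \<Longrightarrow> y \<in> A \<Longrightarrow> \<bar>p x - p y\<bar> \<le> C * mdist E x y"
  obtains q where "lipschitz_bound E C q" "\<And>x. x \<in> A \<Longrightarrow> q x = p x"
proof (cases "A = {}")
  case True
  then show ?thesis using that lipschitz_bound_mono[OF lipschitz_bound_const C] by blast
next
  case False
  define q where "q x = (INF a\<in>A. p a + C * mdist E x a)" for x
  have below: "p b - C * mdist E x b \<le> p a + C * mdist E x a"
    if "x \<in> mspace E" "a \<in> A" "b \<in> A" for x a b
  proof -
    have "C * mdist E b a \<le> C * (mdist E x b + mdist E x a)"
      using mdist_triangle[of b E x a] that A C by (intro mult_left_mono) (auto simp: mdist_commute)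
    then show ?thesis using p[of b a] that by (simp add: algebra_simps abs_le_iff)
  qed
  have bdd: "bdd_below ((\<lambda>a. p a + C * mdist E x a) ` A)" if "x \<in> mspace E" for x
  proof -
    obtain b where "b \<in> A" using False by blast
    then show ?thesis using below[OF that] by (intro bdd_belowI2[of _ "p b - C * mdist E x b"]) blast
  qed
  have le: "q x \<le> p a + C * mdist E x a" if "x \<in> mspace E" "a \<in> A" for x a
    unfolding q_def using bdd[OF that(1)] that(2) by (rule cINF_lower)
  have "lipschitz_bound E C q"
  proof (rule lipschitz_boundI[OF C])
    fix x y assume xy: "x \<in> mspace E" "y \<in> mspace E"
    have "q x - C * mdist E x y \<le> p a + C * mdist E y a" if "a \<in> A" for a
    proof -
      have "C * mdist E x a \<le> C * (mdist E x y + mdist E y a)"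
        using mdist_triangle[of x E y a] that A xy C by (intro mult_left_mono) auto
      then show ?thesis using le[OF xy(1) that] by (simp add: algebra_simps)
    qed
    then have "q x - C * mdist E x y \<le> q y"
      unfolding q_def[of y] using False by (intro cINF_greatest) auto
    then show "q x - q y \<le> C * mdist E x y" by simp
  qed
  moreover have "q x = p x" if "x \<in> A" for x
  proof (rule antisym)
    have x: "x \<in> mspace E" using that A by auto
    then show "q x \<le> p x" using le[OF x that] by simp
    show "p x \<le> q x"
      unfolding q_def using below[OF x _ that] x False by (intro cINF_greatest) auto
  qed
  ultimately show ?thesis using that by blast
qed

lemma openin_mtopology_of_iff:
  "openin (mtopology_of E) U \<longleftrightarrow>
     U \<subseteq> mspace E \<and> (\<forall>x\<in>U. \<exists>r>0. \<forall>y\<in>mspace E. mdist E x y < r \<longrightarrow> y \<in> U)"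
proof -
  interpret Metric_space "mspace E" "mdist E" by simp
  have "openin (mtopology_of E) U \<longleftrightarrow> U \<subseteq> mspace E \<and> (\<forall>x\<in>U. \<exists>r>0. mball x r \<subseteq> U)"
    by (auto simp: mtopology_of_def openin_mtopology)
  also have "\<dots> \<longleftrightarrow> U \<subseteq> mspace E \<and> (\<forall>x\<in>U. \<exists>r>0. \<forall>y\<in>mspace E. mdist E x y < r \<longrightarrow> y \<in> U)"
    by (rule conj_cong[OF refl], rule ball_cong[OF refl]) (auto simp: mball_def subset_iff)
  finally show ?thesis .
qed

lemma in_closure_of_iff:
  "x \<in> mtopology_of E closure_of A \<longleftrightarrow>
     x \<in> mspace E \<and> (\<forall>r>0. \<exists>y\<in>A. y \<in> mspace E \<and> mdist E x y < r)"
proof -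
  interpret Metric_space "mspace E" "mdist E" by simp
  show ?thesis unfolding mtopology_of_def metric_closure_of by auto
qed

lemma openin_lip_vimage:
  assumes p: "p \<in> lip_functions E" and S: "open S"
  shows "openin (mtopology_of E) {x \<in> mspace E. p x \<in> S}"
proof -
  obtain C where C: "lipschitz_bound E C p" using p by (auto simp: lip_functions_iff)
  show ?thesis
    unfolding openin_mtopology_of_iff
  proof (intro conjI ballI)
    fix x assume "x \<in> {x \<in> mspace E. p x \<in> S}"
    then have x: "x \<in> mspace E" "p x \<in> S" by auto
    then obtain e where e: "e > 0" "\<And>y. \<bar>y - p x\<bar> < e \<Longrightarrow> y \<in> S"
      using S by (auto simp: open_dist dist_real_def)
    have pos: "0 < C + 1" using lipschitz_bound_nonneg[OF C] by simp
    show "\<exists>r>0. \<forall>y\<in>mspace E. mdist E x y < r \<longrightarrow> y \<in> {x \<in> mspace E. p x \<in> S}"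
    proof (intro exI[of _ "e / (C + 1)"] conjI ballI impI)
      show "0 < e / (C + 1)" using e pos by simp
      fix y assume y: "y \<in> mspace E" "mdist E x y < e / (C + 1)"
      have "\<bar>p y - p x\<bar> \<le> C * mdist E x y"
        using lipschitz_boundD[OF C y(1) x(1)] by (simp add: mdist_commute)
      also have "\<dots> \<le> (C + 1) * mdist E x y" by (intro mult_right_mono) auto
      also have "\<dots> < e" using y(2) pos by (simp add: field_simps)
      finally show "y \<in> {x \<in> mspace E. p x \<in> S}" using e(2) y(1) by auto
    qed
  qed auto
qed

text \<open>A Lipschitz function whose zero set is a prescribed closed set: the distance to it.\<close>

lemma closed_set_distance:
  assumes F: "closedin (mtopology_of E) F"
  obtains \<rho> where "lipschitz_bound E 1 \<rho>" "\<And>x. x \<in> mspace E \<Longrightarrow> 0 \<le> \<rho> x"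
    "\<And>x. x \<in> mspace E \<Longrightarrow> \<rho> x = 0 \<longleftrightarrow> x \<in> F"
proof (cases "F = {}")
  case True
  then show ?thesis
    using that[of "\<lambda>_. 1"] lipschitz_bound_mono[OF lipschitz_bound_const, of 1 E 1] by simp
next
  case False
  have FE: "F \<subseteq> mspace E" using closedin_subset[OF F] by simp
  define \<rho> where "\<rho> x = (INF a\<in>F. mdist E x a)" for x
  have bdd: "bdd_below ((\<lambda>a. mdist E x a) ` F)" for x by (auto intro!: bdd_belowI2[of _ 0])
  have le: "\<rho> x \<le> mdist E x a" if "a \<in> F" for x a
    unfolding \<rho>_def using bdd that by (intro cINF_lower) auto
  have nonneg: "0 \<le> \<rho> x" for x unfolding \<rho>_def using False by (intro cINF_greatest) auto
  have "lipschitz_bound E 1 \<rho>"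
  proof (rule lipschitz_boundI)
    fix x y assume xy: "x \<in> mspace E" "y \<in> mspace E"
    have "\<rho> x - mdist E x y \<le> mdist E y a" if "a \<in> F" for a
      using le[OF that, of x] mdist_triangle[of x E y a] that FE xy by auto
    then have "\<rho> x - mdist E x y \<le> \<rho> y"
      unfolding \<rho>_def[of y] using False by (intro cINF_greatest) auto
    then show "\<rho> x - \<rho> y \<le> 1 * mdist E x y" by simp
  qed simp
  moreover have "\<rho> x = 0 \<longleftrightarrow> x \<in> F" if x: "x \<in> mspace E" for x
  proof
    assume "x \<in> F" then show "\<rho> x = 0" using le[of x x] nonneg[of x] x by simp
  next
    assume 0: "\<rho> x = 0"
    have "x \<in> mtopology_of E closure_of F"
      unfolding in_closure_of_iff
    proof (intro conjI x allI impI)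
      fix r :: real assume "r > 0"
      then have "(INF a\<in>F. mdist E x a) < r" using 0 by (simp add: \<rho>_def)
      then obtain a where "a \<in> F" "mdist E x a < r"
        using cINF_less_iff[OF False bdd] by blast
      then show "\<exists>y\<in>F. y \<in> mspace E \<and> mdist E x y < r" using FE by auto
    qed
    then show "x \<in> F" using F by (simp add: closure_of_closedin)
  qed
  ultimately show ?thesis using that nonneg by blast
qed

section \<open>Approximation of Borel sets by Lipschitz functions\<close>

lemma space_metric_borel [simp]: "space (metric_borel E) = mspace E"
  unfolding metric_borel_def
  by (rule space_measure_of) (use openin_subset[of "mtopology_of E"] in auto)

lemma sets_metric_borel:
  "sets (metric_borel E) = sigma_sets (mspace E) {U. openin (mtopology_of E) U}"
  unfolding metric_borel_def
  by (rule sets_measure_of) (use openin_subset[of "mtopology_of E"] in auto)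

lemma openin_sets_borel: "openin (mtopology_of E) U \<Longrightarrow> U \<in> sets (metric_borel E)"
  by (auto simp: sets_metric_borel intro: sigma_sets.Basic)

lemma closedin_sets_borel:
  assumes "closedin (mtopology_of E) F"
  shows "F \<in> sets (metric_borel E)"
proof -
  have "mspace E - F \<in> sets (metric_borel E)"
    using assms by (intro openin_sets_borel) (auto simp: closedin_def)
  then have "space (metric_borel E) - (mspace E - F) \<in> sets (metric_borel E)"
    by (rule sets.compl_sets)
  moreover have "space (metric_borel E) - (mspace E - F) = F"
    using closedin_subset[OF assms] by auto
  ultimately show ?thesis by simp
qed

lemma mball_of_sets_borel: "mball_of E x r \<in> sets (metric_borel E)"
proof -
  interpret Metric_space "mspace E" "mdist E" by simp
  show ?thesis using openin_mball by (intro openin_sets_borel) (simp add: mball_of_def mtopology_of_def)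
qed

lemma lip_borel_measurable:
  assumes "p \<in> lip_functions E"
  shows "p \<in> borel_measurable (metric_borel E)"
proof (rule borel_measurableI)
  fix S :: "real set" assume "open S"
  have "p -` S \<inter> space (metric_borel E) = {x \<in> mspace E. p x \<in> S}" by auto
  then show "p -` S \<inter> space (metric_borel E) \<in> sets (metric_borel E)"
    using openin_sets_borel[OF openin_lip_vimage[OF assms \<open>open S\<close>]] by simp
qed

text \<open>Several measures are treated at once: below, a form is split by means of a single function that
  approximates a Borel set with respect to two mass bounds.\<close>

definition finite_borel_measures :: "'a metric \<Rightarrow> 'a measure set \<Rightarrow> bool" where
  "finite_borel_measures E \<M> \<longleftrightarrow> finite \<M> \<and>
     (\<forall>\<mu>\<in>\<M>. finite_measure \<mu> \<and> sets \<mu> = sets (metric_borel E))"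

definition l1_gap :: "'a measure \<Rightarrow> ('a \<Rightarrow> real) \<Rightarrow> 'a set \<Rightarrow> ennreal" where
  "l1_gap \<mu> g A = (\<integral>\<^sup>+x. ennreal \<bar>g x - indicator A x\<bar> \<partial>\<mu>)"

definition lip_approximable :: "'a metric \<Rightarrow> 'a measure set \<Rightarrow> 'a set \<Rightarrow> bool" where
  "lip_approximable E \<M> A \<longleftrightarrow> A \<in> sets (metric_borel E) \<and>
     (\<forall>e::real>0. \<exists>g\<in>lip_functions E. (\<forall>x. 0 \<le> g x \<and> g x \<le> 1) \<and> (\<forall>\<mu>\<in>\<M>. l1_gap \<mu> g A < ennreal e))"

lemma lip_approximableD:
  assumes "lip_approximable E \<M> A" "0 < (e::real)"
  obtains g where "g \<in> lip_functions E" "\<And>x. 0 \<le> g x \<and> g x \<le> 1"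
    "\<And>\<mu>. \<mu> \<in> \<M> \<Longrightarrow> l1_gap \<mu> g A < ennreal e"
proof -
  obtain g where g: "g \<in> lip_functions E" "\<forall>x. 0 \<le> g x \<and> g x \<le> 1"
    "\<forall>\<mu>\<in>\<M>. l1_gap \<mu> g A < ennreal e"
    using assms unfolding lip_approximable_def by auto
  show ?thesis by (rule that[OF g(1)]) (simp_all add: g(2,3))
qed

lemma l1_gap_tendsto_0:
  fixes g :: "nat \<Rightarrow> 'a \<Rightarrow> real"
  assumes "finite_measure \<mu>" and [measurable]: "\<And>m. g m \<in> borel_measurable \<mu>" "A \<in> sets \<mu>"
    and g: "\<And>m x. 0 \<le> g m x \<and> g m x \<le> 1"
    and lim: "\<And>x. x \<in> space \<mu> \<Longrightarrow> (\<lambda>m. g m x) \<longlonglongrightarrow> indicator A x"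
  shows "(\<lambda>m. l1_gap \<mu> (g m) A) \<longlonglongrightarrow> 0"
proof -
  interpret finite_measure \<mu> by fact
  have "(\<lambda>m. l1_gap \<mu> (g m) A) \<longlonglongrightarrow> (\<integral>\<^sup>+x. 0 \<partial>\<mu>)"
    unfolding l1_gap_def
  proof (rule nn_integral_dominated_convergence[where w = "\<lambda>_. 1"])
    show "AE x in \<mu>. ennreal \<bar>g m x - indicator A x\<bar> \<le> 1" for m
    proof (rule AE_I2)
      show "ennreal \<bar>g m x - indicator A x\<bar> \<le> 1" for x
        using g[of m x] by (auto simp: ennreal_le_1 indicator_def abs_le_iff)
    qed
    show "(\<integral>\<^sup>+x. 1 \<partial>\<mu>) < \<infinity>" by (simp add: less_top[symmetric])
    show "AE x in \<mu>. (\<lambda>m. ennreal \<bar>g m x - indicator A x\<bar>) \<longlonglongrightarrow> 0"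
    proof (rule AE_I2)
      fix x assume "x \<in> space \<mu>"
      then have "(\<lambda>m. \<bar>g m x - indicator A x\<bar>) \<longlonglongrightarrow> \<bar>indicator A x - indicator A x\<bar>"
        by (intro tendsto_intros lim)
      then show "(\<lambda>m. ennreal \<bar>g m x - indicator A x\<bar>) \<longlonglongrightarrow> 0"
        using tendsto_ennrealI by fastforce
    qed
  qed auto
  then show ?thesis by simp
qed

lemma eventually_l1_gap_less:
  assumes \<M>: "finite_borel_measures E \<M>" and A: "A \<in> sets (metric_borel E)" and e: "0 < (e::real)"
    and g: "\<And>m. g m \<in> borel_measurable (metric_borel E)" "\<And>m x. 0 \<le> g m x \<and> g m x \<le> 1"
    and lim: "\<And>x. x \<in> mspace E \<Longrightarrow> (\<lambda>m. g m x) \<longlonglongrightarrow> indicator A x"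
  shows "\<forall>\<^sub>F m in sequentially. \<forall>\<mu>\<in>\<M>. l1_gap \<mu> (g m) A < ennreal e"
proof (rule eventually_ball_finite)
  show "finite \<M>" using \<M> by (simp add: finite_borel_measures_def)
  show "\<forall>\<mu>\<in>\<M>. \<forall>\<^sub>F m in sequentially. l1_gap \<mu> (g m) A < ennreal e"
  proof
    fix \<mu> assume "\<mu> \<in> \<M>"
    then have \<mu>: "finite_measure \<mu>" "sets \<mu> = sets (metric_borel E)"
      using \<M> by (auto simp: finite_borel_measures_def)
    note [measurable_cong] = \<mu>(2) and [measurable] = g(1) A
    have "(\<lambda>m. l1_gap \<mu> (g m) A) \<longlonglongrightarrow> 0"
      by (rule l1_gap_tendsto_0[OF \<mu>(1) _ _ g(2)])
        (use lim sets_eq_imp_space_eq[OF \<mu>(2)] in auto)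
    then show "\<forall>\<^sub>F m in sequentially. l1_gap \<mu> (g m) A < ennreal e"
      using e by (intro order_tendstoD(2)) auto
  qed
qed

text \<open>With \<open>\<rho>\<close> the distance to the complement of \<open>U\<close>, the truncations of \<open>m \<rho>\<close> at \<open>1\<close> increase to the
  indicator of \<open>U\<close>.\<close>

lemma lip_approximable_open:
  assumes \<M>: "finite_borel_measures E \<M>" and U: "openin (mtopology_of E) U"
  shows "lip_approximable E \<M> U"
  unfolding lip_approximable_def
proof (intro conjI allI impI openin_sets_borel[OF U])
  fix e :: real assume e: "0 < e"
  have "closedin (mtopology_of E) (mspace E - U)"
    using U by (metis openin_closedin_eq topspace_mtopology_of)
  then obtain \<rho> where \<rho>: "lipschitz_bound E 1 \<rho>" "\<And>x. x \<in> mspace E \<Longrightarrow> 0 \<le> \<rho> x"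
    "\<And>x. x \<in> mspace E \<Longrightarrow> \<rho> x = 0 \<longleftrightarrow> x \<in> mspace E - U"
    using closed_set_distance by blast
  define g where "g m x = max 0 (min 1 (real m * \<rho> x))" for m x
  have g: "g m \<in> lip_functions E" for m
    unfolding g_def[abs_def]
    by (intro lip_functions_max lip_functions_min lip_functions_const lip_functions_scale
        lip_functionsI[OF \<rho>(1)])
  have g01: "0 \<le> g m x \<and> g m x \<le> 1" for m x by (auto simp: g_def)
  have "(\<lambda>m. g m x) \<longlonglongrightarrow> indicator U x" if x: "x \<in> mspace E" for x
  proof (cases "x \<in> U")
    case True
    then have pos: "0 < \<rho> x" using \<rho>(2,3)[OF x] x by force
    obtain N where N: "real N * \<rho> x > 1" using reals_Archimedean3[OF pos] by blast
    have "g m x = 1" if "m \<ge> N" for m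
    proof -
      have "real N * \<rho> x \<le> real m * \<rho> x" using that pos by (intro mult_right_mono) auto
      then show ?thesis using N by (simp add: g_def)
    qed
    then show ?thesis using True by (intro tendsto_eventually) (auto simp: eventually_sequentially)
  next
    case False
    then have "\<rho> x = 0" using \<rho>(3)[OF x] x by auto
    then show ?thesis using False by (simp add: g_def)
  qed
  then have "\<forall>\<^sub>F m in sequentially. \<forall>\<mu>\<in>\<M>. l1_gap \<mu> (g m) U < ennreal e"
    by (rule eventually_l1_gap_less[OF \<M> openin_sets_borel[OF U] e lip_borel_measurable[OF g] g01])
  then obtain m where "\<forall>\<mu>\<in>\<M>. l1_gap \<mu> (g m) U < ennreal e"
    using eventually_happens by fastforce
  then show "\<exists>g\<in>lip_functions E. (\<forall>x. 0 \<le> g x \<and> g x \<le> 1) \<and> (\<forall>\<mu>\<in>\<M>. l1_gap \<mu> g U < ennreal e)"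
    using g g01 by blast
qed

lemma lip_approximable_compl:
  assumes \<M>: "finite_borel_measures E \<M>" and A: "lip_approximable E \<M> A"
  shows "lip_approximable E \<M> (mspace E - A)"
  unfolding lip_approximable_def
proof (intro conjI allI impI)
  show "mspace E - A \<in> sets (metric_borel E)"
    using A sets.compl_sets[of A "metric_borel E"] by (simp add: lip_approximable_def)
  fix e :: real assume "e > 0"
  then obtain g where g: "g \<in> lip_functions E" "\<And>x. 0 \<le> g x \<and> g x \<le> 1"
    "\<And>\<mu>. \<mu> \<in> \<M> \<Longrightarrow> l1_gap \<mu> g A < ennreal e"
    using lip_approximableD[OF A] by blast
  have "l1_gap \<mu> (\<lambda>x. 1 - g x) (mspace E - A) = l1_gap \<mu> g A" if "\<mu> \<in> \<M>" for \<mu>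
  proof -
    have "space \<mu> = mspace E"
      using \<M> that sets_eq_imp_space_eq[of \<mu> "metric_borel E"] by (simp add: finite_borel_measures_def)
    then show ?thesis unfolding l1_gap_def by (intro nn_integral_cong) (auto simp: indicator_def)
  qed
  then show "\<exists>g\<in>lip_functions E. (\<forall>x. 0 \<le> g x \<and> g x \<le> 1) \<and>
      (\<forall>\<mu>\<in>\<M>. l1_gap \<mu> g (mspace E - A) < ennreal e)"
    using g by (intro bexI[of _ "\<lambda>x. 1 - g x"]) (auto intro: lip_functions_diff)
qed

lemma integral_triangle_less:
  fixes a b c :: "'a \<Rightarrow> real"
  assumes "(\<integral>\<^sup>+x. ennreal \<bar>a x\<bar> \<partial>\<mu>) < ennreal (e/2)" "(\<integral>\<^sup>+x. ennreal \<bar>b x\<bar> \<partial>\<mu>) < ennreal (e/2)"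
    and [measurable]: "a \<in> borel_measurable \<mu>" "b \<in> borel_measurable \<mu>"
    and "\<And>x. \<bar>c x\<bar> \<le> \<bar>a x\<bar> + \<bar>b x\<bar>" "0 < e"
  shows "(\<integral>\<^sup>+x. ennreal \<bar>c x\<bar> \<partial>\<mu>) < ennreal e"
proof -
  have "(\<integral>\<^sup>+x. ennreal \<bar>c x\<bar> \<partial>\<mu>) \<le> (\<integral>\<^sup>+x. ennreal \<bar>a x\<bar> + ennreal \<bar>b x\<bar> \<partial>\<mu>)"
    using assms(5) by (intro nn_integral_mono) (simp flip: ennreal_plus)
  also have "\<dots> = (\<integral>\<^sup>+x. ennreal \<bar>a x\<bar> \<partial>\<mu>) + (\<integral>\<^sup>+x. ennreal \<bar>b x\<bar> \<partial>\<mu>)"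
    by (rule nn_integral_add) auto
  also have "\<dots> < ennreal (e/2) + ennreal (e/2)"
    using assms(1,2) by (rule add_strict_mono)
  also have "\<dots> = ennreal e" using assms(6) by (simp flip: ennreal_plus)
  finally show ?thesis .
qed

lemma lip_approximable_Un:
  assumes \<M>: "finite_borel_measures E \<M>" and A: "lip_approximable E \<M> A" and B: "lip_approximable E \<M> B"
  shows "lip_approximable E \<M> (A \<union> B)"
  unfolding lip_approximable_def
proof (intro conjI allI impI)
  have AB [measurable]: "A \<in> sets (metric_borel E)" "B \<in> sets (metric_borel E)"
    using A B by (auto simp: lip_approximable_def)
  then show "A \<union> B \<in> sets (metric_borel E)" by auto
  fix e :: real assume e: "0 < e"
  then have e2: "0 < e / 2" by simp
  obtain g where g: "g \<in> lip_functions E" "\<And>x. 0 \<le> g x \<and> g x \<le> 1"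
    "\<And>\<mu>. \<mu> \<in> \<M> \<Longrightarrow> l1_gap \<mu> g A < ennreal (e/2)"
    using lip_approximableD[OF A e2] by blast
  obtain h where h: "h \<in> lip_functions E" "\<And>x. 0 \<le> h x \<and> h x \<le> 1"
    "\<And>\<mu>. \<mu> \<in> \<M> \<Longrightarrow> l1_gap \<mu> h B < ennreal (e/2)"
    using lip_approximableD[OF B e2] by blast
  note [measurable] = lip_borel_measurable[OF g(1)] lip_borel_measurable[OF h(1)]
  have ptw: "\<bar>max (g x) (h x) - indicator (A \<union> B) x\<bar>
      \<le> \<bar>g x - indicator A x\<bar> + \<bar>h x - indicator B x\<bar>" for x
    using g(2)[of x] h(2)[of x] by (auto simp: indicator_def)
  show "\<exists>g\<in>lip_functions E. (\<forall>x. 0 \<le> g x \<and> g x \<le> 1) \<and> (\<forall>\<mu>\<in>\<M>. l1_gap \<mu> g (A \<union> B) < ennreal e)"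
  proof (intro bexI[of _ "\<lambda>x. max (g x) (h x)"] conjI ballI)
    show "\<forall>x. 0 \<le> max (g x) (h x) \<and> max (g x) (h x) \<le> 1"
      using g(2) h(2) by (simp add: le_max_iff_disj)
    fix \<mu> assume \<mu>: "\<mu> \<in> \<M>"
    then have [measurable_cong]: "sets \<mu> = sets (metric_borel E)" using \<M> by (simp add: finite_borel_measures_def)
    show "l1_gap \<mu> (\<lambda>x. max (g x) (h x)) (A \<union> B) < ennreal e"
      unfolding l1_gap_def
      by (rule integral_triangle_less[OF g(3)[OF \<mu>, unfolded l1_gap_def] h(3)[OF \<mu>, unfolded l1_gap_def] _ _ ptw e]) measurable
  qed (rule lip_functions_max[OF g(1) h(1)])
qed

lemma lip_approximable_UN:
  assumes \<M>: "finite_borel_measures E \<M>" and A: "\<And>i::nat. lip_approximable E \<M> (A i)"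
  shows "lip_approximable E \<M> (\<Union>i. A i)"
  unfolding lip_approximable_def
proof (intro conjI allI impI)
  define B where "B n = (\<Union>i\<le>n. A i)" for n
  have B: "lip_approximable E \<M> (B n)" for n
  proof (induction n)
    case 0 then show ?case using A by (simp add: B_def)
  next
    case (Suc n)
    have "B (Suc n) = B n \<union> A (Suc n)" by (auto simp: B_def atMost_Suc)
    then show ?case using lip_approximable_Un[OF \<M> Suc A] by simp
  qed
  have [measurable]: "A i \<in> sets (metric_borel E)" "B i \<in> sets (metric_borel E)" for i
    using A B by (auto simp: lip_approximable_def)
  show UN [measurable]: "(\<Union>i. A i) \<in> sets (metric_borel E)" by auto
  fix e :: real assume e: "0 < e"
  then have e2: "0 < e / 2" by simp
  have "\<forall>\<^sub>F n in sequentially. \<forall>\<mu>\<in>\<M>. l1_gap \<mu> (indicator (B n)) (\<Union>i. A i) < ennreal (e/2)"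
  proof (rule eventually_l1_gap_less[OF \<M> UN e2])
    show "(\<lambda>n. indicator (B n) x) \<longlonglongrightarrow> (indicator (\<Union>i. A i) x :: real)" for x
    proof (cases "x \<in> (\<Union>i. A i)")
      case True
      then obtain i where "x \<in> A i" by auto
      then have "\<forall>n\<ge>i. indicator (B n) x = (indicator (\<Union>i. A i) x :: real)"
        using True by (auto simp: B_def indicator_def)
      then show ?thesis by (intro tendsto_eventually) (auto simp: eventually_sequentially)
    qed (auto simp: B_def)
  qed auto
  then obtain n where n: "\<And>\<mu>. \<mu> \<in> \<M> \<Longrightarrow> l1_gap \<mu> (indicator (B n)) (\<Union>i. A i) < ennreal (e/2)"
    using eventually_happens by fastforce
  obtain g where g: "g \<in> lip_functions E" "\<And>x. 0 \<le> g x \<and> g x \<le> 1"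
    "\<And>\<mu>. \<mu> \<in> \<M> \<Longrightarrow> l1_gap \<mu> g (B n) < ennreal (e/2)"
    using lip_approximableD[OF B e2] by blast
  note [measurable] = lip_borel_measurable[OF g(1)]
  have ptw: "\<bar>g x - indicator (\<Union>i. A i) x\<bar>
      \<le> \<bar>g x - indicator (B n) x\<bar> + \<bar>indicator (B n) x - indicator (\<Union>i. A i) x\<bar>" for x
    by linarith
  have "l1_gap \<mu> g (\<Union>i. A i) < ennreal e" if \<mu>: "\<mu> \<in> \<M>" for \<mu>
  proof -
    have [measurable_cong]: "sets \<mu> = sets (metric_borel E)" using \<M> \<mu> by (simp add: finite_borel_measures_def)
    show ?thesis
      unfolding l1_gap_def
      by (rule integral_triangle_less[OF g(3)[OF \<mu>, unfolded l1_gap_def] n[OF \<mu>, unfolded l1_gap_def] _ _ ptw e]) measurable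
  qed
  then show "\<exists>g\<in>lip_functions E. (\<forall>x. 0 \<le> g x \<and> g x \<le> 1) \<and> (\<forall>\<mu>\<in>\<M>. l1_gap \<mu> g (\<Union>i. A i) < ennreal e)"
    using g(1,2) by blast
qed

lemma borel_lip_approximable:
  assumes \<M>: "finite_borel_measures E \<M>" and A: "A \<in> sets (metric_borel E)"
  shows "lip_approximable E \<M> A"
  using A unfolding sets_metric_borel
proof (induction rule: sigma_sets.induct)
  case (Basic U) then show ?case using lip_approximable_open[OF \<M>] by simp
next
  case Empty show ?case using lip_approximable_open[OF \<M>, of "{}"] by simp
next
  case (Compl A) then show ?case using lip_approximable_compl[OF \<M>] by simp
next
  case (Union A) then show ?case using lip_approximable_UN[OF \<M>] by blast
qed

section \<open>The mass measure of a current\<close>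

abbreviation lip_prod :: "'a metric \<Rightarrow> ('a \<Rightarrow> real) list \<Rightarrow> real" where
  "lip_prod E \<pi> \<equiv> prod_list (map (lip_const E) \<pi>)"

lemma lip_prod_nonneg: "set \<pi> \<subseteq> lip_functions E \<Longrightarrow> 0 \<le> lip_prod E \<pi>"
  by (induction \<pi>) (auto intro!: mult_nonneg_nonneg lip_const_nonneg)

lemma formsI: "f \<in> bounded_lip_functions E \<Longrightarrow> \<pi> \<in> form_tuples k E \<Longrightarrow> (f, \<pi>) \<in> forms k E"
  by (simp add: forms_def)

text \<open>The nonnegative integral replaces the Bochner integral, which would bring integrability side
  conditions into the limit arguments.\<close>

lemma mass_bound_iff_nn:
  "mass_bound k E T \<mu> \<longleftrightarrow> sets \<mu> = sets (metric_borel E) \<and> finite_measure \<mu> \<and>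
     (\<forall>f\<in>bounded_lip_functions E. \<forall>\<pi>\<in>form_tuples k E.
        ennreal \<bar>T f \<pi>\<bar> \<le> ennreal (lip_prod E \<pi>) * (\<integral>\<^sup>+x. ennreal \<bar>f x\<bar> \<partial>\<mu>))"
proof -
  have "\<bar>T f \<pi>\<bar> \<le> lip_prod E \<pi> * (\<integral>x. \<bar>f x\<bar> \<partial>\<mu>) \<longleftrightarrow>
      ennreal \<bar>T f \<pi>\<bar> \<le> ennreal (lip_prod E \<pi>) * (\<integral>\<^sup>+x. ennreal \<bar>f x\<bar> \<partial>\<mu>)"
    if sets: "sets \<mu> = sets (metric_borel E)" and fin: "finite_measure \<mu>"
      and f: "f \<in> bounded_lip_functions E" and \<pi>: "\<pi> \<in> form_tuples k E" for f \<pi>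
  proof -
    interpret finite_measure \<mu> by fact
    note [measurable_cong] = sets
    note [measurable] = lip_borel_measurable[OF bounded_lipD[OF f]]
    obtain B where B: "0 \<le> B" "\<And>x. x \<in> mspace E \<Longrightarrow> \<bar>f x\<bar> \<le> B" using bounded_lip_bound[OF f] by blast
    have "integrable \<mu> (\<lambda>x. \<bar>f x\<bar>)"
      using B(2) sets_eq_imp_space_eq[OF sets] by (intro integrable_const_bound[of _ B]) auto
    then have "(\<integral>\<^sup>+x. ennreal \<bar>f x\<bar> \<partial>\<mu>) = ennreal (\<integral>x. \<bar>f x\<bar> \<partial>\<mu>)"
      by (rule nn_integral_eq_integral) auto
    moreover have "0 \<le> lip_prod E \<pi>" using \<pi> by (intro lip_prod_nonneg) (auto simp: form_tuples_def)
    moreover have "0 \<le> (\<integral>x. \<bar>f x\<bar> \<partial>\<mu>)" by simp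
    ultimately show ?thesis by (simp flip: ennreal_mult)
  qed
  then show ?thesis unfolding mass_bound_def forms_def by auto
qed

lemma mass_boundD:
  assumes "mass_bound k E T \<mu>"
  shows "sets \<mu> = sets (metric_borel E)" "finite_measure \<mu>" "space \<mu> = mspace E"
    "f \<in> bounded_lip_functions E \<Longrightarrow> \<pi> \<in> form_tuples k E \<Longrightarrow>
       ennreal \<bar>T f \<pi>\<bar> \<le> ennreal (lip_prod E \<pi>) * (\<integral>\<^sup>+x. ennreal \<bar>f x\<bar> \<partial>\<mu>)"
  using assms sets_eq_imp_space_eq[of \<mu> "metric_borel E"] unfolding mass_bound_iff_nn by auto

lemma functional_add:
  assumes "multilinear_functional k E T" "f \<in> bounded_lip_functions E" "g \<in> bounded_lip_functions E"
    and "\<pi> \<in> form_tuples k E" "\<And>x. h x = f x + g x"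
  shows "T h \<pi> = T f \<pi> + T g \<pi>"
proof -
  have "h = (\<lambda>x. 1 * f x + 1 * g x)" using assms(5) by auto
  moreover have "T (\<lambda>x. 1 * f x + 1 * g x) \<pi> = 1 * T f \<pi> + 1 * T g \<pi>"
    using assms(1-4) unfolding multilinear_functional_def by blast
  ultimately show ?thesis by simp
qed

text \<open>Of two mass bounds, one may be used on a Borel set and the other off it: for a Lipschitz
  approximation \<open>g\<close> of the indicator of \<open>A\<close>, split \<open>f = f g + f (1 - g)\<close>.\<close>

lemma mass_bound_split:
  assumes lin: "multilinear_functional k E T"
    and \<mu>: "mass_bound k E T \<mu>" and \<nu>: "mass_bound k E T \<nu>"
    and A: "A \<in> sets (metric_borel E)"
    and f: "f \<in> bounded_lip_functions E" and \<pi>: "\<pi> \<in> form_tuples k E"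
  shows "ennreal \<bar>T f \<pi>\<bar> \<le> ennreal (lip_prod E \<pi>) *
    ((\<integral>\<^sup>+x. ennreal \<bar>f x\<bar> * indicator A x \<partial>\<mu>) +
     (\<integral>\<^sup>+x. ennreal \<bar>f x\<bar> * indicator (mspace E - A) x \<partial>\<nu>))" (is "_ \<le> ?P * (?I + ?J)")
proof (rule ennreal_le_epsilon)
  fix \<delta> :: real assume \<delta>: "0 < \<delta>"
  note sets = mass_boundD(1)[OF \<mu>] mass_boundD(1)[OF \<nu>]
  note fin = mass_boundD(2)[OF \<mu>] mass_boundD(2)[OF \<nu>]
  note [measurable_cong] = sets
  note [measurable] = lip_borel_measurable[OF bounded_lipD[OF f]] A
  obtain B where B: "0 \<le> B" "\<And>x. x \<in> mspace E \<Longrightarrow> \<bar>f x\<bar> \<le> B" using bounded_lip_bound[OF f] by blast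
  have P: "0 \<le> lip_prod E \<pi>" using \<pi> by (intro lip_prod_nonneg) (auto simp: form_tuples_def)
  \<comment> \<open>chosen so that the two approximation errors, at most \<open>lip_prod E \<pi> * B * e\<close> each, add up to at most \<open>\<delta>\<close>\<close>
  define e where "e = \<delta> / (2 * (lip_prod E \<pi> * B + 1))"
  have D: "0 < lip_prod E \<pi> * B + 1" using P B(1) by (simp add: add_nonneg_pos)
  have e: "0 < e" unfolding e_def using \<delta> D by simp
  have small: "lip_prod E \<pi> * (2 * (B * e)) \<le> \<delta>"
  proof -
    have "lip_prod E \<pi> * (2 * (B * e)) = \<delta> * ((lip_prod E \<pi> * B) / (lip_prod E \<pi> * B + 1))"
      using D by (simp add: e_def field_simps)
    also have "\<dots> \<le> \<delta> * 1" using D \<delta> P B(1) by (intro mult_left_mono) (auto simp: divide_simps)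
    finally show ?thesis by simp
  qed
  obtain g where g: "g \<in> lip_functions E" "\<And>x. 0 \<le> g x \<and> g x \<le> 1"
    "l1_gap \<mu> g A < ennreal e" "l1_gap \<nu> g A < ennreal e"
  proof -
    have "finite_borel_measures E {\<mu>, \<nu>}" using fin sets by (simp add: finite_borel_measures_def)
    from borel_lip_approximable[OF this A] show ?thesis
      by (rule lip_approximableD[OF _ e]) (rule that; blast)
  qed
  note [measurable] = lip_borel_measurable[OF g(1)]
  have gb: "g \<in> bounded_lip_functions E" using g by (intro bounded_lipI[of _ _ 1]) (auto simp: abs_le_iff intro: order_trans)
  have g'b: "(\<lambda>x. 1 - g x) \<in> bounded_lip_functions E" using bounded_lip_diff[OF bounded_lip_const gb] .
  have fg: "(\<lambda>x. f x * g x) \<in> bounded_lip_functions E" "(\<lambda>x. f x * (1 - g x)) \<in> bounded_lip_functions E"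
    using bounded_lip_mult[OF f gb] bounded_lip_mult[OF f g'b] by auto
  have T: "T f \<pi> = T (\<lambda>x. f x * g x) \<pi> + T (\<lambda>x. f x * (1 - g x)) \<pi>"
    by (rule functional_add[OF lin fg \<pi>]) (simp add: algebra_simps)
  have bnd: "(\<integral>\<^sup>+x. ennreal \<bar>f x * h x\<bar> \<partial>\<rho>) \<le> (\<integral>\<^sup>+x. ennreal \<bar>f x\<bar> * indicator C x \<partial>\<rho>) + ennreal (B * e)"
    if sets: "sets \<rho> = sets (metric_borel E)" and [measurable]: "C \<in> sets (metric_borel E)"
      and h: "\<And>x. x \<in> mspace E \<Longrightarrow> 0 \<le> h x \<and> h x \<le> indicator C x + \<bar>g x - indicator A x\<bar>"
      and less: "l1_gap \<rho> g A < ennreal e" for \<rho> C h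
  proof -
    note [measurable_cong] = sets
    have "(\<integral>\<^sup>+x. ennreal \<bar>f x * h x\<bar> \<partial>\<rho>) \<le>
        (\<integral>\<^sup>+x. ennreal \<bar>f x\<bar> * indicator C x + ennreal B * ennreal \<bar>g x - indicator A x\<bar> \<partial>\<rho>)"
    proof (rule nn_integral_mono)
      fix x assume "x \<in> space \<rho>"
      then have x: "x \<in> mspace E" using sets_eq_imp_space_eq[OF sets] by simp
      have "\<bar>f x * h x\<bar> \<le> \<bar>f x\<bar> * (indicator C x + \<bar>g x - indicator A x\<bar>)"
        using h[OF x] by (simp add: abs_mult mult_left_mono)
      also have "\<dots> \<le> \<bar>f x\<bar> * indicator C x + B * \<bar>g x - indicator A x\<bar>"
        using B(2)[OF x] by (simp add: distrib_left mult_right_mono)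
      finally have "ennreal \<bar>f x * h x\<bar> \<le> ennreal (\<bar>f x\<bar> * indicator C x + B * \<bar>g x - indicator A x\<bar>)"
        by (rule ennreal_leI)
      also have "\<dots> = ennreal \<bar>f x\<bar> * indicator C x + ennreal B * ennreal \<bar>g x - indicator A x\<bar>"
        using B(1) by (simp add: ennreal_mult ennreal_indicator ennreal_plus)
      finally show "ennreal \<bar>f x * h x\<bar> \<le> ennreal \<bar>f x\<bar> * indicator C x + ennreal B * ennreal \<bar>g x - indicator A x\<bar>" .
    qed
    also have "\<dots> = (\<integral>\<^sup>+x. ennreal \<bar>f x\<bar> * indicator C x \<partial>\<rho>) +
        ennreal B * l1_gap \<rho> g A"
      by (simp add: nn_integral_add nn_integral_cmult l1_gap_def)
    also have "\<dots> \<le> (\<integral>\<^sup>+x. ennreal \<bar>f x\<bar> * indicator C x \<partial>\<rho>) + ennreal B * ennreal e"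
      using less by (intro add_left_mono mult_left_mono) auto
    finally show ?thesis using B(1) e by (simp add: ennreal_mult)
  qed
  have 1: "ennreal \<bar>T (\<lambda>x. f x * g x) \<pi>\<bar> \<le> ?P * (?I + ennreal (B * e))"
  proof (rule order_trans[OF mass_boundD(4)[OF \<mu> fg(1) \<pi>] mult_left_mono])
    show "(\<integral>\<^sup>+x. ennreal \<bar>f x * g x\<bar> \<partial>\<mu>) \<le> ?I + ennreal (B * e)"
      by (rule bnd[OF sets(1) A _ g(3)]) (use g(2) in \<open>auto simp: indicator_def\<close>)
  qed simp
  have 2: "ennreal \<bar>T (\<lambda>x. f x * (1 - g x)) \<pi>\<bar> \<le> ?P * (?J + ennreal (B * e))"
  proof (rule order_trans[OF mass_boundD(4)[OF \<nu> fg(2) \<pi>] mult_left_mono])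
    have "mspace E - A \<in> sets (metric_borel E)" using sets.compl_sets[OF A] by simp
    then show "(\<integral>\<^sup>+x. ennreal \<bar>f x * (1 - g x)\<bar> \<partial>\<nu>) \<le> ?J + ennreal (B * e)"
      by (rule bnd[OF sets(2) _ _ g(4)]) (use g(2) in \<open>auto simp: indicator_def\<close>)
  qed simp
  have "ennreal \<bar>T f \<pi>\<bar> \<le> ennreal \<bar>T (\<lambda>x. f x * g x) \<pi>\<bar> + ennreal \<bar>T (\<lambda>x. f x * (1 - g x)) \<pi>\<bar>"
    unfolding T by (simp flip: ennreal_plus)
  also have "\<dots> \<le> ?P * (?I + ennreal (B * e)) + ?P * (?J + ennreal (B * e))"
    using 1 2 by (rule add_mono)
  also have "\<dots> = ?P * (?I + ?J) + ?P * (ennreal (B * e) + ennreal (B * e))"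
    by (simp only: distrib_left ac_simps)
  also have "?P * (ennreal (B * e) + ennreal (B * e)) = ennreal (lip_prod E \<pi> * (2 * (B * e)))"
  proof -
    have "ennreal (B * e) + ennreal (B * e) = ennreal (2 * (B * e))"
      using B(1) e by (subst ennreal_plus[symmetric]) auto
    then show ?thesis using P B(1) e by (simp add: ennreal_mult)
  qed
  also have "?P * (?I + ?J) + ennreal (lip_prod E \<pi> * (2 * (B * e))) \<le> ?P * (?I + ?J) + ennreal \<delta>"
    using small by (intro add_left_mono ennreal_leI)
  finally show "ennreal \<bar>T f \<pi>\<bar> \<le> ?P * (?I + ?J) + ennreal \<delta>" .
qed

lemma mass_bound_density_iff:
  assumes \<mu>: "mass_bound k E T \<mu>" and h [measurable]: "h \<in> borel_measurable \<mu>"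
  shows "mass_bound k E T (density \<mu> h) \<longleftrightarrow> (\<integral>\<^sup>+x. h x \<partial>\<mu>) < \<infinity> \<and>
    (\<forall>f\<in>bounded_lip_functions E. \<forall>\<pi>\<in>form_tuples k E.
       ennreal \<bar>T f \<pi>\<bar> \<le> ennreal (lip_prod E \<pi>) * (\<integral>\<^sup>+x. h x * ennreal \<bar>f x\<bar> \<partial>\<mu>))"
proof -
  have eq: "(\<integral>\<^sup>+x. ennreal \<bar>f x\<bar> \<partial>density \<mu> h) = (\<integral>\<^sup>+x. h x * ennreal \<bar>f x\<bar> \<partial>\<mu>)"
    if "f \<in> bounded_lip_functions E" for f
  proof -
    note [measurable_cong] = mass_boundD(1)[OF \<mu>]
    note [measurable] = lip_borel_measurable[OF bounded_lipD[OF that]]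
    show ?thesis by (rule nn_integral_density) auto
  qed
  have "emeasure (density \<mu> h) (space \<mu>) = (\<integral>\<^sup>+x. h x \<partial>\<mu>)"
    by (subst emeasure_density) (auto intro!: nn_integral_cong)
  then have "finite_measure (density \<mu> h) \<longleftrightarrow> (\<integral>\<^sup>+x. h x \<partial>\<mu>) < \<infinity>"
    using finite_measure.emeasure_finite[of "density \<mu> h" "space \<mu>"]
    by (auto simp: less_top intro!: finite_measureI)
  then show ?thesis
    unfolding mass_bound_iff_nn using mass_boundD(1)[OF \<mu>] eq by auto
qed

lemma mass_bound_density_min:
  assumes lin: "multilinear_functional k E T" and \<mu>: "mass_bound k E T \<mu>"
    and [measurable]: "h \<in> borel_measurable \<mu>" "h' \<in> borel_measurable \<mu>"
    and H: "mass_bound k E T (density \<mu> h)" "mass_bound k E T (density \<mu> h')"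
  shows "mass_bound k E T (density \<mu> (\<lambda>x. min (h x) (h' x)))"
proof -
  have "(\<integral>\<^sup>+x. min (h x) (h' x) \<partial>\<mu>) \<le> (\<integral>\<^sup>+x. h x \<partial>\<mu>)" by (intro nn_integral_mono) auto
  also have "\<dots> < \<infinity>" using H(1) by (simp add: mass_bound_density_iff[OF \<mu>])
  finally have fin: "(\<integral>\<^sup>+x. min (h x) (h' x) \<partial>\<mu>) < \<infinity>" .
  note sets[measurable_cong] = mass_boundD(1)[OF \<mu>]
  define A where "A = {x \<in> space \<mu>. h x \<le> h' x}"
  have [measurable]: "A \<in> sets (metric_borel E)" unfolding A_def sets[symmetric] by measurable
  have "ennreal \<bar>T f \<pi>\<bar> \<le> ennreal (lip_prod E \<pi>) * (\<integral>\<^sup>+x. min (h x) (h' x) * ennreal \<bar>f x\<bar> \<partial>\<mu>)"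
    if f: "f \<in> bounded_lip_functions E" and \<pi>: "\<pi> \<in> form_tuples k E" for f \<pi>
  proof -
    note [measurable] = lip_borel_measurable[OF bounded_lipD[OF f]]
    have [measurable]: "mspace E - A \<in> sets (metric_borel E)"
      using sets.compl_sets[of A "metric_borel E"] by simp
    have "(\<integral>\<^sup>+x. ennreal \<bar>f x\<bar> * indicator A x \<partial>density \<mu> h) +
       (\<integral>\<^sup>+x. ennreal \<bar>f x\<bar> * indicator (mspace E - A) x \<partial>density \<mu> h') =
       (\<integral>\<^sup>+x. h x * (ennreal \<bar>f x\<bar> * indicator A x) + h' x * (ennreal \<bar>f x\<bar> * indicator (mspace E - A) x) \<partial>\<mu>)"
      by (simp add: nn_integral_density nn_integral_add)
    also have "\<dots> = (\<integral>\<^sup>+x. min (h x) (h' x) * ennreal \<bar>f x\<bar> \<partial>\<mu>)"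
      using mass_boundD(3)[OF \<mu>] by (intro nn_integral_cong) (auto simp: A_def indicator_def min_def)
    finally show ?thesis
      using mass_bound_split[OF lin H \<open>A \<in> sets (metric_borel E)\<close> f \<pi>] by simp
  qed
  then show ?thesis using fin by (simp add: mass_bound_density_iff[OF \<mu>])
qed

lemma mass_bound_density_decseq:
  assumes \<mu>: "mass_bound k E T \<mu>"
    and [measurable]: "\<And>n. h n \<in> borel_measurable \<mu>" and dec: "\<And>x. decseq (\<lambda>n. h n x)"
    and H: "\<And>n::nat. mass_bound k E T (density \<mu> (h n))"
  shows "mass_bound k E T (density \<mu> (\<lambda>x. INF n. h n x))"
proof -
  have fin0: "(\<integral>\<^sup>+x. h 0 x \<partial>\<mu>) < \<infinity>" using H by (simp add: mass_bound_density_iff[OF \<mu>])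
  have "(\<integral>\<^sup>+x. (INF n. h n x) \<partial>\<mu>) \<le> (\<integral>\<^sup>+x. h 0 x \<partial>\<mu>)" by (intro nn_integral_mono INF_lower) auto
  then have fin: "(\<integral>\<^sup>+x. (INF n. h n x) \<partial>\<mu>) < \<infinity>" using fin0 by (rule le_less_trans)
  have "ennreal \<bar>T f \<pi>\<bar> \<le> ennreal (lip_prod E \<pi>) * (\<integral>\<^sup>+x. (INF n. h n x) * ennreal \<bar>f x\<bar> \<partial>\<mu>)"
    if f: "f \<in> bounded_lip_functions E" and \<pi>: "\<pi> \<in> form_tuples k E" for f \<pi>
  proof -
    note [measurable_cong] = mass_boundD(1)[OF \<mu>]
    note [measurable] = lip_borel_measurable[OF bounded_lipD[OF f]]
    obtain B where B: "0 \<le> B" "\<And>x. x \<in> mspace E \<Longrightarrow> \<bar>f x\<bar> \<le> B" using bounded_lip_bound[OF f] by blast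
    have "(\<lambda>n. \<integral>\<^sup>+x. h n x * ennreal \<bar>f x\<bar> \<partial>\<mu>) \<longlonglongrightarrow> (\<integral>\<^sup>+x. (INF n. h n x) * ennreal \<bar>f x\<bar> \<partial>\<mu>)"
    proof (rule nn_integral_dominated_convergence[where w = "\<lambda>x. h 0 x * ennreal B"])
      show "AE x in \<mu>. h n x * ennreal \<bar>f x\<bar> \<le> h 0 x * ennreal B" for n
        using B mass_boundD(3)[OF \<mu>] by (intro AE_I2 mult_mono ennreal_leI decseqD[OF dec]) auto
      show "(\<integral>\<^sup>+x. h 0 x * ennreal B \<partial>\<mu>) < \<infinity>"
        using fin0 by (simp add: nn_integral_multc ennreal_mult_less_top)
      show "AE x in \<mu>. (\<lambda>n. h n x * ennreal \<bar>f x\<bar>) \<longlonglongrightarrow> (INF n. h n x) * ennreal \<bar>f x\<bar>"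
        using ennreal_tendsto_cmult[OF _ LIMSEQ_INF[OF dec], of "ennreal \<bar>f x\<bar>" for x]
        by (intro AE_I2) (simp add: mult.commute)
    qed auto
    then have "(\<lambda>n. ennreal (lip_prod E \<pi>) * (\<integral>\<^sup>+x. h n x * ennreal \<bar>f x\<bar> \<partial>\<mu>)) \<longlonglongrightarrow>
        ennreal (lip_prod E \<pi>) * (\<integral>\<^sup>+x. (INF n. h n x) * ennreal \<bar>f x\<bar> \<partial>\<mu>)"
      by (intro ennreal_tendsto_cmult) auto
    then show ?thesis
      by (rule LIMSEQ_le_const) (use H f \<pi> in \<open>simp add: mass_bound_density_iff[OF \<mu>]\<close>)
  qed
  then show ?thesis using fin by (simp add: mass_bound_density_iff[OF \<mu>])
qed

text \<open>A minimising sequence of densities may be made decreasing by taking pointwise minima, which are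
  again densities of mass bounds; its infimum is minimal by dominated convergence.\<close>

lemma minimal_density_exists:
  assumes lin: "multilinear_functional k E T" and \<mu>: "mass_bound k E T \<mu>"
  obtains h where "h \<in> borel_measurable \<mu>" "mass_bound k E T (density \<mu> h)"
    "\<And>h'. h' \<in> borel_measurable \<mu> \<Longrightarrow> mass_bound k E T (density \<mu> h') \<Longrightarrow>
       (\<integral>\<^sup>+x. h x \<partial>\<mu>) \<le> (\<integral>\<^sup>+x. h' x \<partial>\<mu>)"
proof -
  define H where "H = {h \<in> borel_measurable \<mu>. mass_bound k E T (density \<mu> h)}"
  have "(\<lambda>_. 1) \<in> H" using \<mu> by (simp add: H_def density_1)
  then have "(\<lambda>h. \<integral>\<^sup>+x. h x \<partial>\<mu>) ` H \<noteq> {}" by auto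
  then obtain a :: "nat \<Rightarrow> ennreal" where a: "range a \<subseteq> (\<lambda>h. \<integral>\<^sup>+x. h x \<partial>\<mu>) ` H"
    "Inf ((\<lambda>h. \<integral>\<^sup>+x. h x \<partial>\<mu>) ` H) = (INF i. a i)"
    using ennreal_Inf_countable_INF by metis
  then have "\<forall>i. \<exists>h\<in>H. a i = (\<integral>\<^sup>+x. h x \<partial>\<mu>)" by auto
  then obtain g where g: "\<And>i. g i \<in> H" "\<And>i. a i = (\<integral>\<^sup>+x. g i x \<partial>\<mu>)" by metis
  define m where "m = rec_nat (g 0) (\<lambda>n h x. min (h x) (g (Suc n) x))"
  have m0: "m 0 = g 0" and mS: "m (Suc n) = (\<lambda>x. min (m n x) (g (Suc n) x))" for n
    by (simp_all add: m_def)
  have mH: "m n \<in> H" for n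
  proof (induction n)
    case 0 then show ?case using g by (simp add: m0)
  next
    case (Suc n)
    then show ?case
      using g(1)[of "Suc n"] mass_bound_density_min[OF lin \<mu>, of "m n" "g (Suc n)"]
      by (auto simp: H_def mS)
  qed
  have dec: "decseq (\<lambda>n. m n x)" for x by (rule decseq_SucI) (simp add: mS)
  have le: "m n x \<le> g n x" for n x by (cases n) (auto simp: m0 mS)
  let ?h = "\<lambda>x. INF n. m n x"
  have [measurable]: "m n \<in> borel_measurable \<mu>" for n using mH by (auto simp: H_def)
  show ?thesis
  proof (rule that[of ?h])
    show "?h \<in> borel_measurable \<mu>" by measurable
    show "mass_bound k E T (density \<mu> ?h)"
      by (rule mass_bound_density_decseq[OF \<mu> _ dec]) (use mH in \<open>auto simp: H_def\<close>)
    fix h' assume "h' \<in> borel_measurable \<mu>" "mass_bound k E T (density \<mu> h')"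
    then have "Inf ((\<lambda>h. \<integral>\<^sup>+x. h x \<partial>\<mu>) ` H) \<le> (\<integral>\<^sup>+x. h' x \<partial>\<mu>)"
      by (intro Inf_lower) (auto simp: H_def)
    moreover have "(\<integral>\<^sup>+x. ?h x \<partial>\<mu>) \<le> (INF i. a i)"
      unfolding g(2) by (intro INF_greatest nn_integral_mono) (meson INF_lower2 UNIV_I le)
    ultimately show "(\<integral>\<^sup>+x. ?h x \<partial>\<mu>) \<le> (\<integral>\<^sup>+x. h' x \<partial>\<mu>)" using a(2) by simp
  qed
qed

lemma emeasure_Int_Diff:
  assumes "X \<in> sets \<rho>" "Y \<in> sets \<rho>"
  shows "emeasure \<rho> X = emeasure \<rho> (X \<inter> Y) + emeasure \<rho> (X - Y)"
  using assms by (subst plus_emeasure) (auto intro!: arg_cong[of _ _ "emeasure _"])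

lemma ennreal_add_right_le_cancel:
  fixes a b c :: ennreal
  assumes "a + c \<le> b + c" "c \<noteq> \<infinity>"
  shows "a \<le> b"
  using assms by (simp add: add.commute[of _ c] ennreal_add_left_cancel_le)

text \<open>A density \<open>h\<close> of minimal integral gives the least bound. Given another bound \<open>\<nu>\<close>, let \<open>Y\<close> be a Hahn set
  on which \<open>\<nu>\<close> is the smaller of the two. Replacing the minimal measure by \<open>\<nu>\<close> on \<open>Y\<close> yields a
  mass bound, again with a density by Radon--Nikodym; by minimality nothing was gained, so the two
  measures agree on \<open>Y\<close>.\<close>

lemma least_mass_bound_exists:
  assumes T: "is_current k E T"
  obtains \<kappa> where "mass_bound k E T \<kappa>"
    "\<And>\<nu> A. mass_bound k E T \<nu> \<Longrightarrow> A \<in> sets \<kappa> \<Longrightarrow> emeasure \<kappa> A \<le> emeasure \<nu> A"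
proof -
  have lin: "multilinear_functional k E T" using T by (simp add: is_current_def)
  obtain \<mu> where \<mu>: "mass_bound k E T \<mu>" using T by (auto simp: is_current_def)
  obtain h where h [measurable]: "h \<in> borel_measurable \<mu>" and \<kappa>: "mass_bound k E T (density \<mu> h)"
    and min: "\<And>h'. h' \<in> borel_measurable \<mu> \<Longrightarrow> mass_bound k E T (density \<mu> h') \<Longrightarrow>
       (\<integral>\<^sup>+x. h x \<partial>\<mu>) \<le> (\<integral>\<^sup>+x. h' x \<partial>\<mu>)"
    using minimal_density_exists[OF lin \<mu>] by blast
  interpret \<mu>: finite_measure \<mu> using mass_boundD(2)[OF \<mu>] .
  let ?\<kappa> = "density \<mu> h"
  interpret \<kappa>: finite_measure ?\<kappa> using mass_boundD(2)[OF \<kappa>] .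
  have "emeasure ?\<kappa> B \<le> emeasure \<nu> B" if \<nu>: "mass_bound k E T \<nu>" and B: "B \<in> sets ?\<kappa>" for \<nu> B
  proof -
    interpret \<nu>: finite_measure \<nu> using mass_boundD(2)[OF \<nu>] .
    have [measurable_cong]: "sets \<mu> = sets (metric_borel E)" "sets \<nu> = sets (metric_borel E)"
      by (rule mass_boundD(1)[OF \<mu>], rule mass_boundD(1)[OF \<nu>])
    have eqs: "sets \<nu> = sets \<mu>" "sets ?\<kappa> = sets \<mu>" "sets (metric_borel E) = sets \<mu>"
      "space \<nu> = mspace E" "space \<mu> = mspace E"
      using mass_boundD(1,3)[OF \<mu>] mass_boundD(1,3)[OF \<nu>] by simp_all
    obtain Y where Y: "Y \<in> sets \<mu>"
      and Y1: "\<And>X. X \<in> sets \<mu> \<Longrightarrow> X \<subseteq> Y \<Longrightarrow> emeasure \<nu> X \<le> emeasure ?\<kappa> X"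
      and Y2: "\<And>X. X \<in> sets \<mu> \<Longrightarrow> X \<inter> Y = {} \<Longrightarrow> emeasure ?\<kappa> X \<le> emeasure \<nu> X"
    proof -
      have "sets \<nu> = sets ?\<kappa>" by (simp add: eqs(1))
      note finite_unsigned_Hahn_decomposition[OF \<kappa>.finite_measure_axioms \<nu>.finite_measure_axioms this]
      then
      obtain Y where "Y \<in> sets \<mu>" "\<forall>X\<in>sets \<mu>. X \<subseteq> Y \<longrightarrow> emeasure \<nu> X \<le> emeasure ?\<kappa> X"
        "\<forall>X\<in>sets \<mu>. X \<inter> Y = {} \<longrightarrow> emeasure ?\<kappa> X \<le> emeasure \<nu> X"
        unfolding sets_density by (elim bexE conjE)
      note q = this
      show ?thesis by (rule that[OF q(1) q(2)[rule_format] q(3)[rule_format]])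
    qed
    note [measurable] = Y
    have Yc [measurable]: "mspace E - Y \<in> sets \<mu>"
      using sets.compl_sets[OF Y] by (simp only: eqs)
    have "absolutely_continuous \<mu> (density \<nu> (indicator Y))"
      unfolding absolutely_continuous_def
    proof
      fix N assume N: "N \<in> null_sets \<mu>"
      then have [measurable]: "N \<in> sets \<mu>" by auto
      have "emeasure ?\<kappa> (N \<inter> Y) = (\<integral>\<^sup>+x. h x * indicator (N \<inter> Y) x \<partial>\<mu>)"
        by (rule emeasure_density) auto
      also have "\<dots> = 0"
        using AE_not_in[OF N] by (subst nn_integral_0_iff_AE) (auto elim!: eventually_mono)
      finally have "emeasure \<nu> (N \<inter> Y) = 0" using Y1[of "N \<inter> Y"] by auto
      then have "emeasure (density \<nu> (indicator Y)) N = 0"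
        by (subst emeasure_density)
          (auto simp: eqs indicator_inter_arith[symmetric] nn_integral_indicator Int_commute)
      then show "N \<in> null_sets (density \<nu> (indicator Y))"
        by (auto simp: null_sets_def eqs)
    qed
    then obtain g where g [measurable]: "g \<in> borel_measurable \<mu>" and dg: "density \<mu> g = density \<nu> (indicator Y)"
      using \<mu>.Radon_Nikodym[of "density \<nu> (indicator Y)"] by (auto simp: eqs)
    have gint: "(\<integral>\<^sup>+x. g x * u x \<partial>\<mu>) = (\<integral>\<^sup>+x. indicator Y x * u x \<partial>\<nu>)"
      if [measurable]: "u \<in> borel_measurable \<mu>" for u
    proof -
      have "(\<integral>\<^sup>+x. g x * u x \<partial>\<mu>) = (\<integral>\<^sup>+x. u x \<partial>density \<mu> g)" by (rule nn_integral_density[symmetric]) auto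
      also have "\<dots> = (\<integral>\<^sup>+x. indicator Y x * u x \<partial>\<nu>)"
        unfolding dg by (rule nn_integral_density) auto
      finally show ?thesis .
    qed
    define h' where "h' x = g x * indicator Y x + h x * indicator (mspace E - Y) x" for x
    have [measurable]: "h' \<in> borel_measurable \<mu>" unfolding h'_def by measurable
    have h'int: "(\<integral>\<^sup>+x. h' x * u x \<partial>\<mu>) = (\<integral>\<^sup>+x. u x * indicator Y x \<partial>\<nu>) +
        (\<integral>\<^sup>+x. u x * indicator (mspace E - Y) x \<partial>?\<kappa>)"
      if [measurable]: "u \<in> borel_measurable \<mu>" for u
    proof -
      have "(\<integral>\<^sup>+x. h' x * u x \<partial>\<mu>) =
          (\<integral>\<^sup>+x. g x * (u x * indicator Y x) + h x * (u x * indicator (mspace E - Y) x) \<partial>\<mu>)"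
        by (intro nn_integral_cong) (simp add: h'_def distrib_left distrib_right ac_simps)
      also have "\<dots> = (\<integral>\<^sup>+x. g x * (u x * indicator Y x) \<partial>\<mu>) +
          (\<integral>\<^sup>+x. h x * (u x * indicator (mspace E - Y) x) \<partial>\<mu>)"
        by (rule nn_integral_add) auto
      also have "(\<integral>\<^sup>+x. g x * (u x * indicator Y x) \<partial>\<mu>) = (\<integral>\<^sup>+x. u x * indicator Y x \<partial>\<nu>)"
        by (subst gint) (auto intro!: nn_integral_cong simp: indicator_def)
      also have "(\<integral>\<^sup>+x. h x * (u x * indicator (mspace E - Y) x) \<partial>\<mu>) =
          (\<integral>\<^sup>+x. u x * indicator (mspace E - Y) x \<partial>?\<kappa>)"
        by (rule nn_integral_density[symmetric]) auto
      finally show ?thesis .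
    qed
    have h'1: "(\<integral>\<^sup>+x. h' x \<partial>\<mu>) = emeasure \<nu> Y + emeasure ?\<kappa> (mspace E - Y)"
    proof -
      have "Y \<in> sets \<nu>" "mspace E - Y \<in> sets ?\<kappa>" using Y Yc by (simp_all only: eqs)
      then show ?thesis using h'int[OF borel_measurable_const, of 1] by (simp only: mult_1 mult_1_right nn_integral_indicator)
    qed
    have "mass_bound k E T (density \<mu> h')"
      unfolding mass_bound_density_iff[OF \<mu> \<open>h' \<in> borel_measurable \<mu>\<close>]
    proof (intro conjI ballI)
      show "(\<integral>\<^sup>+x. h' x \<partial>\<mu>) < \<infinity>"
        unfolding h'1 by (simp add: less_top[symmetric] \<nu>.emeasure_finite \<kappa>.emeasure_finite)
      fix f \<pi> assume f: "f \<in> bounded_lip_functions E" and \<pi>: "\<pi> \<in> form_tuples k E"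
      have [measurable]: "f \<in> borel_measurable \<mu>"
        using lip_borel_measurable[OF bounded_lipD[OF f]] by measurable
      show "ennreal \<bar>T f \<pi>\<bar> \<le> ennreal (lip_prod E \<pi>) * (\<integral>\<^sup>+x. h' x * ennreal \<bar>f x\<bar> \<partial>\<mu>)"
      proof -
        have "Y \<in> sets (metric_borel E)" using Y by (simp only: eqs)
        moreover have "(\<lambda>x. ennreal \<bar>f x\<bar>) \<in> borel_measurable \<mu>" by measurable
        ultimately show ?thesis using mass_bound_split[OF lin \<nu> \<kappa> _ f \<pi>, of Y] by (simp only: h'int)
      qed
    qed
    then have "(\<integral>\<^sup>+x. h x \<partial>\<mu>) \<le> emeasure \<nu> Y + emeasure ?\<kappa> (mspace E - Y)"
      using min[of h'] h'1 by simp
    moreover have "(\<integral>\<^sup>+x. h x \<partial>\<mu>) = emeasure ?\<kappa> (mspace E)"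
    proof -
      have "mspace E \<in> sets \<mu>" using sets.top[of \<mu>] by (simp only: eqs)
      then show ?thesis by (subst emeasure_density) (auto intro!: nn_integral_cong simp: eqs(5))
    qed
    moreover have "emeasure ?\<kappa> (mspace E) = emeasure ?\<kappa> Y + emeasure ?\<kappa> (mspace E - Y)"
    proof -
      have "Y \<subseteq> mspace E" using sets.sets_into_space[OF Y] by (simp only: eqs)
      then show ?thesis
        using Y Yc by (subst plus_emeasure) (auto intro!: arg_cong[of _ _ "emeasure _"])
    qed
    ultimately have "emeasure ?\<kappa> Y + emeasure ?\<kappa> (mspace E - Y)
        \<le> emeasure \<nu> Y + emeasure ?\<kappa> (mspace E - Y)" by (simp only:)
    then have YY: "emeasure ?\<kappa> Y \<le> emeasure \<nu> Y"
      by (rule ennreal_add_right_le_cancel) (simp add: \<kappa>.emeasure_finite)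
    have B': "B \<in> sets \<mu>" "B \<in> sets \<nu>" "Y \<in> sets ?\<kappa>" "Y \<in> sets \<nu>"
      using B Y by (simp_all only: eqs)
    have YB: "Y - B \<in> sets \<mu>" "B - Y \<in> sets \<mu>" using B'(1) Y by (rule sets.Diff[rotated], rule sets.Diff)
    have "emeasure ?\<kappa> (Y \<inter> B) + emeasure ?\<kappa> (Y - B) \<le> emeasure \<nu> (Y \<inter> B) + emeasure \<nu> (Y - B)"
      using YY emeasure_Int_Diff[OF B'(3) B] emeasure_Int_Diff[OF B'(4,2)] by (simp only:)
    also have "\<dots> \<le> emeasure \<nu> (Y \<inter> B) + emeasure ?\<kappa> (Y - B)"
      by (intro add_left_mono Y1 YB) auto
    finally have 1: "emeasure ?\<kappa> (Y \<inter> B) \<le> emeasure \<nu> (Y \<inter> B)"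
      by (rule ennreal_add_right_le_cancel) (simp add: \<kappa>.emeasure_finite)
    have 2: "emeasure ?\<kappa> (B - Y) \<le> emeasure \<nu> (B - Y)" by (intro Y2 YB) auto
    have "emeasure ?\<kappa> B = emeasure ?\<kappa> (Y \<inter> B) + emeasure ?\<kappa> (B - Y)"
      using emeasure_Int_Diff[OF B B'(3)] by (simp only: Int_commute)
    also have "\<dots> \<le> emeasure \<nu> (Y \<inter> B) + emeasure \<nu> (B - Y)" using 1 2 by (rule add_mono)
    also have "\<dots> = emeasure \<nu> B" using emeasure_Int_Diff[OF B'(2,4)] by (simp only: Int_commute)
    finally show ?thesis .
  qed
  then show ?thesis using that \<kappa> by blast
qed

lemma mass_measure_least:
  assumes T: "is_current k E T"
  shows "mass_bound k E T (mass_measure k E T)"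
    and "mass_bound k E T \<nu> \<Longrightarrow> A \<in> sets (metric_borel E) \<Longrightarrow>
      emeasure (mass_measure k E T) A \<le> emeasure \<nu> A"
proof -
  let ?P = "\<lambda>\<mu>. mass_bound k E T \<mu> \<and>
        (\<forall>\<nu>. mass_bound k E T \<nu> \<longrightarrow> (\<forall>A\<in>sets \<mu>. emeasure \<mu> A \<le> emeasure \<nu> A))"
  obtain \<kappa> where \<kappa>: "?P \<kappa>" using least_mass_bound_exists[OF T] by metis
  have "?P (mass_measure k E T)"
    unfolding mass_measure_def
  proof (rule theI[of ?P, OF \<kappa>])
    fix \<mu> assume \<mu>: "?P \<mu>"
    show "\<mu> = \<kappa>"
    proof (rule measure_eqI)
      show "sets \<mu> = sets \<kappa>" using \<mu> \<kappa> mass_boundD(1) by metis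
      then show "emeasure \<mu> A = emeasure \<kappa> A" if "A \<in> sets \<mu>" for A
        using \<mu> \<kappa> that by (intro antisym) auto
    qed
  qed
  then show "mass_bound k E T (mass_measure k E T)"
    and "mass_bound k E T \<nu> \<Longrightarrow> A \<in> sets (metric_borel E) \<Longrightarrow>
      emeasure (mass_measure k E T) A \<le> emeasure \<nu> A"
    using mass_boundD(1) by blast+
qed

section \<open>Dependence of a current on its carrier\<close>

lemma current_local:
  assumes T: "is_current k E T" and f: "f \<in> bounded_lip_functions E" and \<pi>: "\<pi> \<in> form_tuples k E"
    and i: "i < k" and U: "openin (mtopology_of E) U" "{x \<in> mspace E. f x \<noteq> 0} \<subseteq> U"
    and c: "\<forall>x\<in>U. (\<pi> ! i) x = c"
  shows "T f \<pi> = 0"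
proof -
  have "local_functional k E T" using T by (simp add: is_current_def)
  from this[unfolded local_functional_def, THEN bspec, OF formsI[OF f \<pi>], unfolded prod.case, THEN mp]
  show ?thesis using i U c by blast
qed

lemma form_tuples_update:
  "\<pi> \<in> form_tuples k E \<Longrightarrow> q \<in> lip_functions E \<Longrightarrow> \<pi>[i := q] \<in> form_tuples k E"
  unfolding form_tuples_def using set_update_subset_insert[of \<pi> i q] by auto

lemma form_tuples_nth: "\<pi> \<in> form_tuples k E \<Longrightarrow> i < k \<Longrightarrow> \<pi> ! i \<in> lip_functions E"
  by (auto simp: form_tuples_def)

lemma current_cong_first:
  assumes T: "is_current k E T" and C: "C \<in> sets (metric_borel E)"
    and null: "emeasure (mass_measure k E T) (mspace E - C) = 0"
    and f: "f \<in> bounded_lip_functions E" and g: "g \<in> bounded_lip_functions E"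
    and \<pi>: "\<pi> \<in> form_tuples k E" and eq: "\<And>x. x \<in> C \<Longrightarrow> f x = g x"
  shows "T f \<pi> = T g \<pi>"
proof -
  let ?\<mu> = "mass_measure k E T"
  note m = mass_measure_least(1)[OF T]
  have fg: "(\<lambda>x. f x - g x) \<in> bounded_lip_functions E" using f g by (rule bounded_lip_diff)
  have lin: "multilinear_functional k E T" using T by (simp add: is_current_def)
  have T: "T f \<pi> = T g \<pi> + T (\<lambda>x. f x - g x) \<pi>"
    by (rule functional_add[OF lin g fg \<pi>]) simp
  have "mspace E - C \<in> null_sets ?\<mu>"
    using null sets.compl_sets[OF C] mass_boundD(1)[OF m] by auto
  then have "AE x in ?\<mu>. x \<notin> mspace E - C" by (rule AE_not_in)
  then have "AE x in ?\<mu>. ennreal \<bar>f x - g x\<bar> = 0"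
    using AE_space by eventually_elim (use eq mass_boundD(3)[OF m] in auto)
  then have "(\<integral>\<^sup>+x. ennreal \<bar>f x - g x\<bar> \<partial>?\<mu>) = (\<integral>\<^sup>+x. 0 \<partial>?\<mu>)"
    by (rule nn_integral_cong_AE)
  then have "ennreal \<bar>T (\<lambda>x. f x - g x) \<pi>\<bar> \<le> 0"
    using mass_boundD(4)[OF m fg \<pi>] by simp
  then show ?thesis using T by simp
qed

text \<open>If \<open>g\<close> vanishes on a carrier \<open>C\<close> of \<open>T\<close>, cut off \<open>g\<close> at height \<open>1/m\<close>: the remainder
  vanishes on the neighbourhood \<open>{\<bar>g\<bar> < 1/m}\<close> of \<open>C\<close>, so locality applies to it after \<open>f\<close> has been
  multiplied by a cutoff function equal to \<open>1\<close> on \<open>C\<close>. Continuity removes the truncation.\<close>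

lemma current_zero_slot:
  assumes T: "is_current k E T" and C: "C \<in> sets (metric_borel E)"
    and null: "emeasure (mass_measure k E T) (mspace E - C) = 0"
    and f: "f \<in> bounded_lip_functions E" and \<pi>: "\<pi> \<in> form_tuples k E" and i: "i < k"
    and g: "g \<in> lip_functions E" and g0: "\<And>x. x \<in> C \<Longrightarrow> g x = 0"
  shows "T f (\<pi>[i := g]) = 0"
proof -
  \<comment> \<open>what the truncation of \<open>g\<close> at height \<open>1 / Suc m\<close> cuts off\<close>
  define G where "G m x = g x - max (- 1 / real (Suc m)) (min (1 / real (Suc m)) (g x))" for m x
  define D where "D = 2 * lip_const E g"
  have len: "length \<pi> = k" using \<pi> by (simp add: form_tuples_def)
  have Gb: "lipschitz_bound E D (G m)" for m
  proof -
    from lipschitz_bound_lincomb[OF lip_const_bound[OF g] lipschitz_bound_clip[OF lip_const_bound[OF g]],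
        of 1 "-1" "1 / real (Suc m)"]
    show ?thesis unfolding D_def G_def[abs_def] by simp
  qed
  have zero: "T f (\<pi>[i := G m]) = 0" for m
  proof -
    define h where "h x = max 0 (1 - real (Suc m) * max (g x) (- g x))" for x
    have h: "h \<in> bounded_lip_functions E"
    proof (rule bounded_lipI[of _ _ 1])
      show "h \<in> lip_functions E"
        unfolding h_def[abs_def]
        by (intro lip_functions_max lip_functions_diff lip_functions_const lip_functions_scale
            lip_functions_uminus g)
      have "0 \<le> real (Suc m) * max (g x) (- g x)" for x by (intro mult_nonneg_nonneg) auto
      then show "\<bar>h x\<bar> \<le> 1" for x unfolding h_def by (simp add: abs_le_iff)
    qed
    have fh: "(\<lambda>x. f x * h x) \<in> bounded_lip_functions E" using bounded_lip_mult[OF f h] .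
    have \<pi>G: "\<pi>[i := G m] \<in> form_tuples k E" using form_tuples_update[OF \<pi> lip_functionsI[OF Gb]] .
    have "T f (\<pi>[i := G m]) = T (\<lambda>x. f x * h x) (\<pi>[i := G m])"
      by (rule current_cong_first[OF T C null f fh \<pi>G]) (simp add: h_def g0)
    also have "\<dots> = 0"
    proof -
      let ?U = "{x \<in> mspace E. g x \<in> {- 1 / real (Suc m) <..< 1 / real (Suc m)}}"
      have "openin (mtopology_of E) ?U" by (rule openin_lip_vimage[OF g]) simp
      moreover have "{x \<in> mspace E. f x * h x \<noteq> 0} \<subseteq> ?U"
      proof
        fix x assume x: "x \<in> {x \<in> mspace E. f x * h x \<noteq> 0}"
        then have "h x \<noteq> 0" by auto
        then have "real (Suc m) * max (g x) (- g x) < 1" by (simp add: h_def max_def split: if_splits)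
        then have "max (g x) (- g x) < 1 / real (Suc m)"
          by (simp only: pos_less_divide_eq of_nat_0_less_iff zero_less_Suc mult.commute)
        then show "x \<in> ?U" using x by auto
      qed
      moreover have "\<forall>x\<in>?U. (\<pi>[i := G m] ! i) x = 0" using i len by (auto simp: G_def)
      ultimately show ?thesis using current_local[OF T fh \<pi>G i] by blast
    qed
    finally show ?thesis .
  qed
  have "(\<lambda>m. T f (\<pi>[i := G m])) \<longlonglongrightarrow> T f (\<pi>[i := g])"
  proof -
    have 1: "\<forall>m. \<pi>[i := G m] \<in> form_tuples k E"
      using form_tuples_update[OF \<pi> lip_functionsI[OF Gb]] by blast
    let ?K = "D + (\<Sum>j<k. lip_const E (\<pi> ! j))"
    have nn: "0 \<le> lip_const E (\<pi> ! j)" if "j < k" for j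
      using form_tuples_nth[OF \<pi> that] by (rule lip_const_nonneg)
    have D0: "0 \<le> D" unfolding D_def using lip_const_nonneg[OF g] by simp
    have 2: "\<exists>K. \<forall>m. \<forall>j<k. lip_const E (\<pi>[i := G m] ! j) \<le> K"
    proof (intro exI[of _ ?K] allI impI)
      fix m j assume j: "j < k"
      show "lip_const E (\<pi>[i := G m] ! j) \<le> ?K"
      proof (cases "j = i")
        case True
        have "lip_const E (G m) \<le> D" by (rule lip_const_le[OF Gb])
        moreover have "0 \<le> (\<Sum>j<k. lip_const E (\<pi> ! j))" using nn by (intro sum_nonneg) auto
        ultimately show ?thesis using True i len by simp
      next
        case False
        have "lip_const E (\<pi> ! j) \<le> (\<Sum>j<k. lip_const E (\<pi> ! j))"
          using nn j by (intro member_le_sum) auto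
        then show ?thesis using False D0 by simp
      qed
    qed
    have 3: "\<forall>j<k. \<forall>x\<in>mspace E. (\<lambda>m. (\<pi>[i := G m] ! j) x) \<longlonglongrightarrow> (\<pi>[i := g] ! j) x"
    proof (intro allI impI ballI)
      fix j x assume j: "j < k"
      show "(\<lambda>m. (\<pi>[i := G m] ! j) x) \<longlonglongrightarrow> (\<pi>[i := g] ! j) x"
      proof (cases "j = i")
        case True
        have "(\<lambda>m. G m x - g x) \<longlonglongrightarrow> 0"
        proof (rule Lim_null_comparison)
          show "\<forall>\<^sub>F m in sequentially. norm (G m x - g x) \<le> 1 / real (Suc m)"
            by (rule always_eventually) (auto simp: G_def abs_le_iff)
          show "(\<lambda>m. 1 / real (Suc m)) \<longlonglongrightarrow> 0" by (rule LIMSEQ_Suc[OF lim_1_over_n])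
        qed
        then have "(\<lambda>m. G m x) \<longlonglongrightarrow> g x" by (simp add: LIM_zero_iff)
        then show ?thesis using True i len by simp
      qed simp
    qed
    have "continuous_functional k E T" using T by (simp add: is_current_def)
    note cont = this[unfolded continuous_functional_def, THEN bspec, OF f, THEN bspec,
        OF form_tuples_update[OF \<pi> g], THEN spec, of "\<lambda>m. \<pi>[i := G m]"]
    show ?thesis by (rule cont[THEN mp]) (intro conjI 1 2 3)
  qed
  then show ?thesis using zero by (simp add: LIMSEQ_const_iff)
qed

text \<open>The entries of the tuple are exchanged one at a time.\<close>

lemma current_cong_carrier:
  assumes T: "is_current k E T" and C: "C \<in> sets (metric_borel E)"
    and null: "emeasure (mass_measure k E T) (mspace E - C) = 0"
    and f: "f \<in> bounded_lip_functions E" and g: "g \<in> bounded_lip_functions E"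
    and \<pi>: "\<pi> \<in> form_tuples k E" and \<rho>: "\<rho> \<in> form_tuples k E"
    and eq: "\<And>x. x \<in> C \<Longrightarrow> f x = g x" "\<And>x i. x \<in> C \<Longrightarrow> i < k \<Longrightarrow> (\<pi> ! i) x = (\<rho> ! i) x"
  shows "T f \<pi> = T g \<rho>"
proof -
  have len: "length \<pi> = k" "length \<rho> = k" using \<pi> \<rho> by (simp_all add: form_tuples_def)
  have slot: "T g (\<sigma>[i := q]) = T g \<sigma>"
    if \<sigma>: "\<sigma> \<in> form_tuples k E" and i: "i < k" and q: "q \<in> lip_functions E"
      and eq: "\<And>x. x \<in> C \<Longrightarrow> (\<sigma> ! i) x = q x" for \<sigma> i q
  proof -
    note s = form_tuples_nth[OF \<sigma> i]
    have "T g (\<sigma>[i := (\<lambda>x. 1 * (\<sigma> ! i) x + (-1) * q x)]) = 1 * T g (\<sigma>[i := \<sigma> ! i]) + (-1) * T g (\<sigma>[i := q])"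
      using T g \<sigma> i q s unfolding is_current_def multilinear_functional_def by blast
    moreover have "T g (\<sigma>[i := (\<lambda>x. 1 * (\<sigma> ! i) x + (-1) * q x)]) = 0"
      by (rule current_zero_slot[OF T C null g \<sigma> i lip_functions_lincomb[OF s q]]) (simp add: eq)
    ultimately show ?thesis by simp
  qed
  have "T g (take n \<rho> @ drop n \<pi>) = T g \<pi> \<and> take n \<rho> @ drop n \<pi> \<in> form_tuples k E" if "n \<le> k" for n
    using that
  proof (induction n)
    case 0 then show ?case using \<pi> by simp
  next
    case (Suc n)
    let ?\<sigma> = "take n \<rho> @ drop n \<pi>"
    have n: "n < k" using Suc.prems by simp
    have upd: "take (Suc n) \<rho> @ drop (Suc n) \<pi> = ?\<sigma>[n := \<rho> ! n]"
      using n len by (simp add: take_Suc_conv_app_nth list_update_append Cons_nth_drop_Suc[symmetric])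
    have IH: "T g ?\<sigma> = T g \<pi>" "?\<sigma> \<in> form_tuples k E" using Suc by auto
    have "T g (?\<sigma>[n := \<rho> ! n]) = T g ?\<sigma>"
    proof (rule slot[OF IH(2) n form_tuples_nth[OF \<rho> n]])
      fix x assume "x \<in> C"
      then show "(?\<sigma> ! n) x = (\<rho> ! n) x" using eq(2)[OF _ n] n len by (simp add: nth_append)
    qed
    then show ?case
      unfolding upd using IH form_tuples_update[OF IH(2) form_tuples_nth[OF \<rho> n]] by simp
  qed
  from this[of k] have "T g \<rho> = T g \<pi>" using len by simp
  moreover have "T f \<pi> = T g \<pi>" by (rule current_cong_first[OF T C null f g \<pi> eq(1)])
  ultimately show ?thesis by simp
qed

lemma ball_cutoff:
  assumes p: "p \<in> mspace E" and sr: "s < r"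
  obtains h where "h \<in> bounded_lip_functions E" "\<And>x. 0 \<le> h x \<and> h x \<le> 1"
    "\<And>x. mdist E p x < s \<Longrightarrow> h x = 1" "\<And>x. h x \<noteq> 0 \<Longrightarrow> mdist E p x < r"
proof -
  define h where "h x = max 0 (min 1 (1 / (r - s) * (r - mdist E p x)))" for x
  have h01: "0 \<le> h x \<and> h x \<le> 1" for x by (auto simp: h_def)
  show ?thesis
  proof (rule that[of h])
    show "h \<in> bounded_lip_functions E"
    proof (rule bounded_lipI[of _ _ 1])
      show "h \<in> lip_functions E"
        unfolding h_def[abs_def]
        by (intro lip_functions_max lip_functions_min lip_functions_const lip_functions_scale
            lip_functions_diff lip_functionsI[OF lipschitz_bound_mdist[OF p]])
    qed (use h01 in auto)
    show "h x = 1" if "mdist E p x < s" for x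
      using sr that by (simp add: h_def field_simps)
    show "mdist E p x < r" if "h x \<noteq> 0" for x
    proof (rule ccontr)
      assume "\<not> ?thesis"
      then have "1 / (r - s) * (r - mdist E p x) \<le> 0" using sr by (intro mult_nonneg_nonpos) auto
      then show False using that by (simp add: h_def)
    qed
  qed (rule h01)
qed

text \<open>Minimality of the mass measure: if \<open>T\<close> vanished on all forms supported in the ball of radius \<open>r\<close>,
  then, cutting forms off on this ball, the mass measure with the ball of radius \<open>s\<close> removed would
  still bound \<open>T\<close>.\<close>

lemma mass_ball_witness:
  assumes T: "is_current k E T" and p: "p \<in> mspace E" and sr: "s < r"
    and pos: "0 < emeasure (mass_measure k E T) (mball_of E p s)"
  obtains f \<pi> where "f \<in> bounded_lip_functions E" "\<pi> \<in> form_tuples k E" "T f \<pi> \<noteq> 0"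
    "\<And>x. x \<in> mspace E \<Longrightarrow> f x \<noteq> 0 \<Longrightarrow> mdist E p x < r"
proof (rule ccontr)
  note witness = that
  assume neg: "\<not> thesis"
  have vanish: "T f \<pi> = 0"
    if "f \<in> bounded_lip_functions E" "\<pi> \<in> form_tuples k E"
      "\<And>x. x \<in> mspace E \<Longrightarrow> f x \<noteq> 0 \<Longrightarrow> mdist E p x < r" for f \<pi>
    using neg witness[OF that(1,2) _ that(3)] by blast
  let ?\<mu> = "mass_measure k E T" and ?B = "mball_of E p s"
  note m = mass_measure_least(1)[OF T]
  have lin: "multilinear_functional k E T" using T by (simp add: is_current_def)
  interpret finite_measure ?\<mu> by (rule mass_boundD(2)[OF m])
  note [measurable_cong] = mass_boundD(1)[OF m]
  have B [measurable]: "?B \<in> sets (metric_borel E)" by (rule mball_of_sets_borel)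
  have Bc [measurable]: "mspace E - ?B \<in> sets (metric_borel E)" using sets.compl_sets[OF B] by simp
  \<comment> \<open>the density of the mass measure with the smaller ball removed\<close>
  define u :: "'a \<Rightarrow> ennreal" where "u x = indicator (mspace E - ?B) x" for x
  have [measurable]: "u \<in> borel_measurable ?\<mu>" unfolding u_def[abs_def] by measurable
  obtain h where h: "h \<in> bounded_lip_functions E" "\<And>x. 0 \<le> h x \<and> h x \<le> 1"
    "\<And>x. mdist E p x < s \<Longrightarrow> h x = 1" "\<And>x. h x \<noteq> 0 \<Longrightarrow> mdist E p x < r"
    using ball_cutoff[OF p sr] by blast
  have bound: "ennreal \<bar>T f \<pi>\<bar> \<le> ennreal (lip_prod E \<pi>) * (\<integral>\<^sup>+x. u x * ennreal \<bar>f x\<bar> \<partial>?\<mu>)"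
    if f: "f \<in> bounded_lip_functions E" and \<pi>: "\<pi> \<in> form_tuples k E" for f \<pi>
  proof -
    have fh: "(\<lambda>x. f x * h x) \<in> bounded_lip_functions E" "(\<lambda>x. f x * (1 - h x)) \<in> bounded_lip_functions E"
      using bounded_lip_mult[OF f h(1)] bounded_lip_mult[OF f bounded_lip_diff[OF bounded_lip_const h(1)]]
      by auto
    have "T f \<pi> = T (\<lambda>x. f x * h x) \<pi> + T (\<lambda>x. f x * (1 - h x)) \<pi>"
      by (rule functional_add[OF lin fh \<pi>]) (simp add: algebra_simps)
    moreover have "T (\<lambda>x. f x * h x) \<pi> = 0" by (rule vanish[OF fh(1) \<pi>]) (use h(4) in auto)
    ultimately have "ennreal \<bar>T f \<pi>\<bar> \<le>
        ennreal (lip_prod E \<pi>) * (\<integral>\<^sup>+x. ennreal \<bar>f x * (1 - h x)\<bar> \<partial>?\<mu>)"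
      using mass_boundD(4)[OF m fh(2) \<pi>] by simp
    also have "\<dots> \<le> ennreal (lip_prod E \<pi>) * (\<integral>\<^sup>+x. u x * ennreal \<bar>f x\<bar> \<partial>?\<mu>)"
    proof (intro mult_left_mono nn_integral_mono)
      fix x assume "x \<in> space ?\<mu>"
      then have x: "x \<in> mspace E" using mass_boundD(3)[OF m] by simp
      show "ennreal \<bar>f x * (1 - h x)\<bar> \<le> u x * ennreal \<bar>f x\<bar>"
      proof (cases "mdist E p x < s")
        case False
        have "\<bar>f x\<bar> * \<bar>1 - h x\<bar> \<le> \<bar>f x\<bar> * 1" using h(2)[of x] by (intro mult_left_mono) auto
        then show ?thesis using False x by (simp add: u_def abs_mult ennreal_leI)
      qed (simp add: h(3))
    qed simp
    finally show ?thesis .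
  qed
  have "(\<integral>\<^sup>+x. u x \<partial>?\<mu>) \<le> (\<integral>\<^sup>+x. 1 \<partial>?\<mu>)"
    by (intro nn_integral_mono) (auto simp: u_def indicator_def)
  also have "\<dots> < \<infinity>" by (simp add: less_top[symmetric])
  finally have "mass_bound k E T (density ?\<mu> u)"
    using bound by (simp add: mass_bound_density_iff[OF m])
  then have "emeasure ?\<mu> ?B \<le> emeasure (density ?\<mu> u) ?B"
    using mass_measure_least(2)[OF T _ B] by blast
  also have "\<dots> = (\<integral>\<^sup>+x. u x * indicator ?B x \<partial>?\<mu>)"
    by (rule emeasure_density) measurable
  also have "\<dots> = (\<integral>\<^sup>+x. 0 \<partial>?\<mu>)"
    by (rule nn_integral_cong) (auto simp: u_def indicator_def)
  finally show False using pos by simp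
qed

section \<open>Rectifiable measures are carried by their points of positive lower density\<close>

lemma complete_limit:
  assumes E: "mcomplete_of E" and \<sigma>: "\<And>n. \<sigma> n \<in> mspace E"
    and Cauchy: "\<And>e. 0 < e \<Longrightarrow> \<exists>N. \<forall>m\<ge>N. \<forall>n\<ge>m. mdist E (\<sigma> m) (\<sigma> n) < e"
  obtains x where "x \<in> mspace E" "(\<lambda>n. mdist E (\<sigma> n) x) \<longlonglongrightarrow> 0"
proof -
  interpret Metric_space "mspace E" "mdist E" by simp
  have "MCauchy \<sigma>"
    unfolding MCauchy_def
  proof (intro conjI allI impI)
    show "range \<sigma> \<subseteq> mspace E" using \<sigma> by auto
    fix e :: real assume "0 < e"
    then obtain N where N: "\<forall>m\<ge>N. \<forall>n\<ge>m. mdist E (\<sigma> m) (\<sigma> n) < e" using Cauchy by blast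
    show "\<exists>N. \<forall>n n'. N \<le> n \<longrightarrow> N \<le> n' \<longrightarrow> mdist E (\<sigma> n) (\<sigma> n') < e"
    proof (intro exI[of _ N] allI impI)
      fix n n' assume "N \<le> n" "N \<le> n'"
      then show "mdist E (\<sigma> n) (\<sigma> n') < e"
        using N by (cases "n \<le> n'") (auto simp: mdist_commute[of E "\<sigma> n"])
    qed
  qed
  then obtain x where "limitin mtopology \<sigma> x sequentially"
    using E by (auto simp: mcomplete_of_def mcomplete_def)
  then have x: "x \<in> mspace E" "\<And>e. e > 0 \<Longrightarrow> \<exists>N. \<forall>n\<ge>N. mdist E (\<sigma> n) x < e"
    by (auto simp: limit_metric_sequentially) (meson)
  then have "(\<lambda>n. mdist E (\<sigma> n) x) \<longlonglongrightarrow> 0"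
    by (auto simp: LIMSEQ_iff)
  then show ?thesis using that x by blast
qed

lemma outer_measure_of_UN_null:
  assumes "countable I" "\<And>i. i \<in> I \<Longrightarrow> A i \<subseteq> space M" "\<And>i. i \<in> I \<Longrightarrow> outer_measure_of M (A i) = 0"
  shows "outer_measure_of M (\<Union>i\<in>I. A i) = 0"
proof -
  have "\<forall>i\<in>I. \<exists>N\<in>null_sets M. A i \<subseteq> N"
  proof
    fix i assume i: "i \<in> I"
    obtain N where "N \<in> sets M" "A i \<subseteq> N" "outer_measure_of M (A i) = emeasure M N"
      using outer_measure_of_attain[OF assms(2)[OF i]] by blast
    then show "\<exists>N\<in>null_sets M. A i \<subseteq> N" using assms(3)[OF i] by auto
  qed
  then obtain N where N: "\<And>i. i \<in> I \<Longrightarrow> N i \<in> null_sets M" "\<And>i. i \<in> I \<Longrightarrow> A i \<subseteq> N i" by metis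
  have "(\<Union>i\<in>I. N i) \<in> null_sets M" using assms(1) N(1) by (rule null_sets_UN')
  then have "outer_measure_of M (\<Union>i\<in>I. N i) = 0" by (simp add: null_setsD1 null_setsD2)
  moreover have "outer_measure_of M (\<Union>i\<in>I. A i) \<le> outer_measure_of M (\<Union>i\<in>I. N i)"
    using N(2) by (intro outer_measure_of_mono) blast
  ultimately show ?thesis by simp
qed

lemma outer_measure_of_UN_le:
  assumes "finite I" "\<And>i. i \<in> I \<Longrightarrow> A i \<subseteq> space M"
  shows "outer_measure_of M (\<Union>i\<in>I. A i) \<le> (\<Sum>i\<in>I. outer_measure_of M (A i))"
proof -
  have "\<forall>i\<in>I. \<exists>N\<in>sets M. A i \<subseteq> N \<and> outer_measure_of M (A i) = emeasure M N"
  proof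
    fix i assume i: "i \<in> I"
    obtain N where "N \<in> sets M" "A i \<subseteq> N" "outer_measure_of M (A i) = emeasure M N"
      using outer_measure_of_attain[OF assms(2)[OF i]] by blast
    then show "\<exists>N\<in>sets M. A i \<subseteq> N \<and> outer_measure_of M (A i) = emeasure M N" by blast
  qed
  then obtain N where N: "\<And>i. i \<in> I \<Longrightarrow> N i \<in> sets M" "\<And>i. i \<in> I \<Longrightarrow> A i \<subseteq> N i"
    "\<And>i. i \<in> I \<Longrightarrow> outer_measure_of M (A i) = emeasure M (N i)" by metis
  have "outer_measure_of M (\<Union>i\<in>I. A i) \<le> outer_measure_of M (\<Union>i\<in>I. N i)"
    using N(2) by (intro outer_measure_of_mono) blast
  also have "\<dots> = emeasure M (\<Union>i\<in>I. N i)"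
    using assms(1) N(1) by (intro outer_measure_of_eq sets.finite_UN) auto
  also have "\<dots> \<le> (\<Sum>i\<in>I. emeasure M (N i))"
    using assms(1) N(1) by (intro emeasure_subadditive_finite) auto
  also have "\<dots> = (\<Sum>i\<in>I. outer_measure_of M (A i))" using N(3) by simp
  finally show ?thesis .
qed

text \<open>The index of the dyadic cube of side \<open>2\<^sup>-\<^sup>m\<close> that contains \<open>x\<close>.\<close>

definition dyadic_index :: "nat \<Rightarrow> nat \<Rightarrow> (nat \<Rightarrow> real) \<Rightarrow> nat \<Rightarrow> int" where
  "dyadic_index k m x = (\<lambda>i\<in>{..<k}. \<lfloor>2 ^ m * x i\<rfloor>)"

lemma dyadic_cube_diameter:
  assumes "dyadic_index k m x = dyadic_index k m y"
  shows "mdist (euclid k) x y \<le> real k / 2 ^ m"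
proof -
  have "\<bar>x i - y i\<bar> \<le> 1 / 2 ^ m" if i: "i \<in> {..<k}" for i
  proof -
    have "\<lfloor>2 ^ m * x i\<rfloor> = \<lfloor>2 ^ m * y i\<rfloor>"
      using fun_cong[OF assms, of i] i by (simp add: dyadic_index_def)
    then have "\<bar>2 ^ m * x i - 2 ^ m * y i\<bar> \<le> 1" by linarith
    then have "2 ^ m * \<bar>x i - y i\<bar> \<le> 1" by (simp add: abs_mult flip: right_diff_distrib)
    then show ?thesis by (simp add: field_simps)
  qed
  then have "(\<Sum>i<k. \<bar>x i - y i\<bar>) \<le> (\<Sum>i<k. 1 / 2 ^ m)" by (rule sum_mono)
  then show ?thesis using L2_set_le_sum_abs[of "\<lambda>i. x i - y i" "{..<k}"] by simp
qed

lemma dyadic_index_child: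
  assumes "dyadic_index k m x = z"
  shows "dyadic_index k (Suc m) x \<in> (\<Pi>\<^sub>E i\<in>{..<k}. {2 * z i, 2 * z i + 1})"
proof (rule PiE_I)
  fix i assume i: "i \<in> {..<k}"
  have "z i = \<lfloor>2 ^ m * x i\<rfloor>" using assms i by (auto simp: dyadic_index_def)
  moreover have "dyadic_index k (Suc m) x i = \<lfloor>2 * (2 ^ m * x i)\<rfloor>"
    using i by (simp add: dyadic_index_def mult.assoc)
  moreover have "\<lfloor>2 * t\<rfloor> = 2 * \<lfloor>t\<rfloor> \<or> \<lfloor>2 * t\<rfloor> = 2 * \<lfloor>t\<rfloor> + 1" for t :: real by linarith
  ultimately show "dyadic_index k (Suc m) x i \<in> {2 * z i, 2 * z i + 1}" by simp
qed (simp add: dyadic_index_def)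

text \<open>The cube with index \<open>z\<close> has \<open>2\<^sup>k\<close> subcubes of half the side; a subcube whose image has maximal outer
  measure is kept.\<close>

lemma dyadic_bisection:
  assumes f: "f ` B \<subseteq> space M" and B: "\<And>x. x \<in> B \<Longrightarrow> dyadic_index k m x = z"
  obtains B' z' where "B' \<subseteq> B" "\<And>x. x \<in> B' \<Longrightarrow> dyadic_index k (Suc m) x = z'"
    "outer_measure_of M (f ` B) \<le> 2 ^ k * outer_measure_of M (f ` B')"
proof -
  define I where "I = (\<Pi>\<^sub>E i\<in>{..<k}. {2 * z i, 2 * z i + 1})"
  define D where "D w = {x \<in> B. dyadic_index k (Suc m) x = w}" for w
  define F where "F w = outer_measure_of M (f ` D w)" for w
  have I: "finite I" "I \<noteq> {}" by (auto simp: I_def PiE_eq_empty_iff intro!: finite_PiE)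
  have card: "card I = 2 ^ k" by (simp add: I_def card_PiE numeral_2_eq_2)
  have "f ` B = (\<Union>w\<in>I. f ` D w)"
    using dyadic_index_child[OF B] by (auto simp: D_def I_def)
  then have "outer_measure_of M (f ` B) \<le> (\<Sum>w\<in>I. F w)"
    unfolding F_def using outer_measure_of_UN_le[OF I(1), of "\<lambda>w. f ` D w" M] f
    by (auto simp: D_def)
  moreover obtain w where w: "w \<in> I" "F w = Max (F ` I)"
    using Max_in[of "F ` I"] I by fastforce
  moreover have "(\<Sum>v\<in>I. F v) \<le> of_nat (card I) * F w"
    using I w by (intro sum_bounded_above) auto
  ultimately have "outer_measure_of M (f ` B) \<le> 2 ^ k * outer_measure_of M (f ` D w)"
    using card by (auto simp: F_def)
  moreover have "D w \<subseteq> B" "\<And>x. x \<in> D w \<Longrightarrow> dyadic_index k (Suc m) x = w" by (auto simp: D_def)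
  ultimately show ?thesis using that by blast
qed

text \<open>Repeated bisection: of the \<open>2\<^sup>k\<close> subcubes of a dyadic cube, one keeps at least the fraction
  \<open>2\<^sup>-\<^sup>k\<close> of the measure of the image. The images of the cubes chosen shrink to a point \<open>p\<close>, and the
  ball around \<open>p\<close> of radius comparable to \<open>2\<^sup>-\<^sup>m\<close> has measure comparable to \<open>2\<^sup>-\<^sup>k\<^sup>m\<close> at least.\<close>

lemma lipschitz_image_density_point:
  assumes E: "mcomplete_of E" and fin: "finite_measure M" and sets: "sets M = sets (metric_borel E)"
    and f: "\<And>x. x \<in> A \<Longrightarrow> f x \<in> W"
    and L: "0 \<le> L" "\<And>x y. x \<in> A \<Longrightarrow> y \<in> A \<Longrightarrow> mdist E (f x) (f y) \<le> L * mdist (euclid k) x y"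
    and W: "closedin (mtopology_of E) W"
    and pos: "outer_measure_of M (f ` A) \<noteq> 0"
  obtains p where "p \<in> W"
    "0 < Liminf (at_right 0) (\<lambda>r. emeasure M (mball_of E p r) / ennreal (r ^ k))"
proof -
  interpret finite_measure M by fact
  have spM: "space M = mspace E" using sets_eq_imp_space_eq[OF sets] by simp
  have WE: "W \<subseteq> mspace E" using closedin_subset[OF W] by simp
  have sub: "f ` B \<subseteq> space M" if "B \<subseteq> A" for B using f that WE spM by blast
  let ?\<mu> = "outer_measure_of M"
  define I :: "(nat \<Rightarrow> int) set" where "I = ({..<k} \<rightarrow>\<^sub>E UNIV)"
  have "\<exists>z\<in>I. ?\<mu> (f ` {x \<in> A. dyadic_index k 0 x = z}) \<noteq> 0"
  proof (rule ccontr)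
    assume "\<not> ?thesis"
    moreover have "countable I" unfolding I_def by (rule countable_PiE) auto
    ultimately have "?\<mu> (\<Union>z\<in>I. f ` {x \<in> A. dyadic_index k 0 x = z}) = 0"
      by (intro outer_measure_of_UN_null sub) auto
    moreover have "(\<Union>z\<in>I. f ` {x \<in> A. dyadic_index k 0 x = z}) = f ` A"
    proof -
      have "dyadic_index k 0 x \<in> I" for x by (simp add: I_def dyadic_index_def)
      then show ?thesis by blast
    qed
    ultimately show False using pos by simp
  qed
  then obtain z0 where z0: "?\<mu> (f ` {x \<in> A. dyadic_index k 0 x = z0}) \<noteq> 0" by blast
  define a where "a = ?\<mu> (f ` {x \<in> A. dyadic_index k 0 x = z0})"
  let ?P = "\<lambda>m B. B \<subseteq> A \<and> (\<exists>z. \<forall>x\<in>B. dyadic_index k m x = z) \<and> a \<le> (2 ^ k) ^ m * ?\<mu> (f ` B)"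
  have "\<exists>B. \<forall>m. ?P m (B m) \<and> B (Suc m) \<subseteq> B m"
  proof (rule dependent_nat_choice)
    show "\<exists>B. ?P 0 B"
      by (rule exI[of _ "{x \<in> A. dyadic_index k 0 x = z0}"]) (auto simp: a_def)
    fix B m assume P: "?P m B"
    then obtain z where z: "\<And>x. x \<in> B \<Longrightarrow> dyadic_index k m x = z" by blast
    obtain B' z' where B': "B' \<subseteq> B" "\<And>x. x \<in> B' \<Longrightarrow> dyadic_index k (Suc m) x = z'"
      "?\<mu> (f ` B) \<le> 2 ^ k * ?\<mu> (f ` B')"
      using dyadic_bisection[OF sub z] P by metis
    have "a \<le> (2 ^ k) ^ m * ?\<mu> (f ` B)" using P by blast
    also have "\<dots> \<le> (2 ^ k) ^ m * (2 ^ k * ?\<mu> (f ` B'))" using B'(3) by (rule mult_left_mono) simp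
    finally have "a \<le> (2 ^ k) ^ Suc m * ?\<mu> (f ` B')" by (simp add: ac_simps)
    moreover have "B' \<subseteq> A" using B'(1) P by blast
    moreover have "\<exists>z. \<forall>x\<in>B'. dyadic_index k (Suc m) x = z" using B'(2) by blast
    ultimately show "\<exists>B'. ?P (Suc m) B' \<and> B' \<subseteq> B" using B'(1) by (intro exI[of _ B'] conjI)
  qed
  then obtain B where B: "\<And>m. ?P m (B m)" "\<And>m. B (Suc m) \<subseteq> B m" by blast
  have dec: "B n \<subseteq> B m" if "m \<le> n" for m n using lift_Suc_antimono_le[of B, OF B(2) that] .
  have "B m \<noteq> {}" for m
  proof
    assume "B m = {}"
    then have "a \<le> 0" using B(1)[of m] by simp
    then show False using z0 by (simp add: a_def)
  qed
  then have "\<forall>m. \<exists>x. x \<in> B m" by blast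
  then obtain x where x: "\<And>m. x m \<in> B m" by metis
  have fE: "f y \<in> mspace E" if "y \<in> A" for y using f[OF that] WE by blast
  have dist: "mdist E (f y) (f y') \<le> L * real k / 2 ^ m" if "y \<in> B m" "y' \<in> B m" for m y y'
  proof -
    have yA: "y \<in> A" "y' \<in> A" using B(1)[of m] that by auto
    have "dyadic_index k m y = dyadic_index k m y'" using B(1)[of m] that by metis
    then have "L * mdist (euclid k) y y' \<le> L * (real k / 2 ^ m)"
      using L(1) by (intro mult_left_mono dyadic_cube_diameter)
    then show ?thesis using L(2)[OF yA] by simp
  qed
  \<comment> \<open>the summand \<open>1\<close> makes \<open>K\<close> positive and the distance estimates strict, also if \<open>L = 0\<close> or \<open>k = 0\<close>\<close>
  define K where "K = L * real k + 1"
  have K: "0 < K" using L(1) by (simp add: K_def add_nonneg_pos)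
  have distK: "mdist E (f y) (f y') < K / 2 ^ m" if "y \<in> B m" "y' \<in> B m" for m y y'
  proof -
    have "L * real k / 2 ^ m < K / 2 ^ m" by (simp add: K_def divide_strict_right_mono)
    then show ?thesis using dist[OF that] by simp
  qed
  have small: "\<exists>m. K / 2 ^ m < e" if "0 < e" for e
  proof -
    obtain m where "K / e < 2 ^ m" using real_arch_pow[of 2 "K / e"] by auto
    then show ?thesis using that by (intro exI[of _ m]) (simp add: field_simps)
  qed
  obtain p where p: "p \<in> mspace E" "(\<lambda>n. mdist E (f (x n)) p) \<longlonglongrightarrow> 0"
  proof (rule complete_limit[OF E, of "\<lambda>n. f (x n)"])
    show "f (x n) \<in> mspace E" for n using fE B(1)[of n] x[of n] by blast
    fix e :: real assume "0 < e"
    then obtain N where N: "K / 2 ^ N < e" using small by blast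
    show "\<exists>N. \<forall>m\<ge>N. \<forall>n\<ge>m. mdist E (f (x m)) (f (x n)) < e"
    proof (intro exI[of _ N] allI impI)
      fix m n assume "N \<le> m" "m \<le> n"
      then have "x m \<in> B N" "x n \<in> B N" using x dec by (meson order_trans subsetD)+
      then show "mdist E (f (x m)) (f (x n)) < e" using distK N by fastforce
    qed
  qed (rule that)
  have near: "mdist E p (f y) < K / 2 ^ m" if y: "y \<in> B m" for y m
  proof -
    have "mdist E (f y) p \<le> L * real k / 2 ^ m"
    proof (rule field_le_epsilon)
      fix e :: real assume "0 < e"
      then have "\<forall>\<^sub>F n in sequentially. mdist E (f (x n)) p < e" using order_tendstoD(2)[OF p(2)] by blast
      then obtain N where N: "\<And>n. n \<ge> N \<Longrightarrow> mdist E (f (x n)) p < e"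
        by (auto simp: eventually_sequentially)
      let ?n = "max N m"
      have xn: "x ?n \<in> B m" using x[of ?n] dec[of m ?n] by auto
      have "mdist E (f y) p \<le> mdist E (f y) (f (x ?n)) + mdist E (f (x ?n)) p"
        using y xn B(1)[of m] p(1) fE by (intro mdist_triangle) auto
      then show "mdist E (f y) p \<le> L * real k / 2 ^ m + e"
        using dist[OF y xn] N[of ?n] by simp
    qed
    also have "L * real k / 2 ^ m < K / 2 ^ m" by (simp add: K_def divide_strict_right_mono)
    finally show ?thesis by (simp add: mdist_commute)
  qed
  have "p \<in> mtopology_of E closure_of W"
    unfolding in_closure_of_iff
  proof (intro conjI p(1) allI impI)
    fix r :: real assume "r > 0"
    then obtain m where "K / 2 ^ m < r" using small by blast
    then have "mdist E p (f (x m)) < r" using near[OF x[of m]] by simp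
    then show "\<exists>y\<in>W. y \<in> mspace E \<and> mdist E p y < r"
      using f B(1)[of m] x[of m] WE by (intro bexI[of _ "f (x m)"]) auto
  qed
  then have pW: "p \<in> W" using W by (simp add: closure_of_closedin)
  have a_fin: "a \<noteq> \<infinity>"
  proof -
    have "a \<le> ?\<mu> (space M)" unfolding a_def by (intro outer_measure_of_mono sub) auto
    then show ?thesis using emeasure_finite[of "space M"] by (auto simp: top_unique)
  qed
  then obtain ar where ar: "a = ennreal ar" "0 \<le> ar" by (cases a) auto
  have ar0: "0 < ar" using z0 ar by (auto simp: a_def[symmetric] less_le)
  let ?c = "ar / (2 * K) ^ k"
  have "ennreal ?c \<le> emeasure M (mball_of E p r) / ennreal (r ^ k)" if r: "0 < r" "r < K" for r
  proof -
    \<comment> \<open>the scale with \<open>K / 2 ^ m \<le> r < 2 * K / 2 ^ m\<close>\<close>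
    define m where "m = (LEAST m. K / 2 ^ m \<le> r)"
    have ex: "\<exists>m. K / 2 ^ m \<le> r" using small[OF r(1)] by (auto intro: less_imp_le)
    have m: "K / 2 ^ m \<le> r" unfolding m_def using ex by (rule LeastI_ex)
    have "m \<noteq> 0"
    proof
      assume "m = 0" then show False using m r by simp
    qed
    then obtain m' where m': "m = Suc m'" using not0_implies_Suc by blast
    have "\<not> K / 2 ^ m' \<le> r" using not_less_Least[of m' "\<lambda>m. K / 2 ^ m \<le> r"] m' by (simp add: m_def)
    then have rm: "r < 2 * K / 2 ^ m" using m' by simp
    have "f ` B m \<subseteq> mball_of E p r"
      using near m fE B(1)[of m] p(1) by (fastforce simp: subset_iff)
    then have "?\<mu> (f ` B m) \<le> ?\<mu> (mball_of E p r)" by (rule outer_measure_of_mono)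
    also have "\<dots> = emeasure M (mball_of E p r)"
      using mball_of_sets_borel sets by (intro outer_measure_of_eq) simp
    finally have "a \<le> (2 ^ k) ^ m * emeasure M (mball_of E p r)"
      using B(1)[of m] by (meson mult_left_mono order_trans zero_le)
    moreover obtain er where er: "emeasure M (mball_of E p r) = ennreal er" "0 \<le> er"
      using emeasure_finite[of "mball_of E p r"] by (cases "emeasure M (mball_of E p r)") auto
    ultimately have "ennreal ar \<le> ennreal ((2 ^ k) ^ m * er)"
      using ar by (simp add: ennreal_mult flip: ennreal_power)
    then have "ar \<le> (2 ^ k) ^ m * er" using er(2) by (simp add: ennreal_le_iff)
    moreover have "r ^ k \<le> (2 * K / 2 ^ m) ^ k" using r rm by (intro power_mono) auto
    ultimately have "ar * r ^ k \<le> ((2 ^ k) ^ m * er) * (2 * K / 2 ^ m) ^ k"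
      using ar(2) er(2) r by (intro mult_mono) auto
    also have "\<dots> = er * (2 * K) ^ k"
      by (simp add: power_divide power_commutes flip: power_mult) (simp add: mult.commute)
    finally have "?c \<le> er / r ^ k" using K r by (simp add: divide_simps ac_simps)
    then have "ennreal ?c \<le> ennreal (er / r ^ k)" by (rule ennreal_leI)
    then show ?thesis using er r by (simp add: divide_ennreal)
  qed
  then have "\<forall>\<^sub>F r in at_right 0. ennreal ?c \<le> emeasure M (mball_of E p r) / ennreal (r ^ k)"
    using K by (auto simp: eventually_at_right_field intro!: exI[of _ K])
  then have "ennreal ?c \<le> Liminf (at_right 0) (\<lambda>r. emeasure M (mball_of E p r) / ennreal (r ^ k))"
    by (rule Liminf_bounded)
  moreover have "0 < ennreal ?c" using ar0 K by simp
  ultimately show ?thesis using that[OF pW] by (meson less_le_trans)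
qed

lemma ediam_closure:
  assumes "B \<subseteq> mspace E"
  shows "ediam E (mtopology_of E closure_of B) \<le> ediam E B"
  unfolding ediam_def[of E "mtopology_of E closure_of B"]
proof (intro SUP_least)
  fix x y assume x: "x \<in> mtopology_of E closure_of B" and y: "y \<in> mtopology_of E closure_of B"
  show "ennreal (mdist E x y) \<le> ediam E B"
  proof (rule ennreal_le_epsilon)
    fix e :: real assume e: "0 < e"
    obtain x' where x': "x' \<in> B" "mdist E x x' < e / 2" using x e unfolding in_closure_of_iff by (meson half_gt_zero)
    obtain y' where y': "y' \<in> B" "mdist E y y' < e / 2" using y e unfolding in_closure_of_iff by (meson half_gt_zero)
    have E: "x \<in> mspace E" "y \<in> mspace E" "x' \<in> mspace E" "y' \<in> mspace E"
      using x y x' y' assms by (auto simp: in_closure_of_iff)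
    have "mdist E x y \<le> mdist E x x' + mdist E x' y" using E by (intro mdist_triangle) auto
    also have "mdist E x' y \<le> mdist E x' y' + mdist E y' y" using E by (intro mdist_triangle) auto
    finally have "mdist E x y \<le> mdist E x' y' + e" using x' y' by (simp add: mdist_commute[of E y' y])
    then have "ennreal (mdist E x y) \<le> ennreal (mdist E x' y') + ennreal e"
      using e by (simp add: ennreal_leI flip: ennreal_plus)
    also have "ennreal (mdist E x' y') \<le> ediam E B"
      unfolding ediam_def using x' y' by (meson SUP_upper2 order_refl)
    finally show "ennreal (mdist E x y) \<le> ediam E B + ennreal e" by (simp add: add_right_mono)
  qed
qed

lemma hausdorff_gauge_closure:
  assumes "B \<subseteq> mspace E"
  shows "hausdorff_gauge k E (mtopology_of E closure_of B) \<le> hausdorff_gauge k E B"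
  using assms ediam_closure[OF assms] closure_of_eq_empty[of B "mtopology_of E"]
  by (auto simp: hausdorff_gauge_def intro!: mult_left_mono power_mono)

text \<open>The closure of a set has the same diameter, so the members of fine efficient covers may be replaced
  by their closures; the hull is the intersection of the resulting \<open>F\<^sub>\<sigma>\<close> sets.\<close>

lemma hausdorff_null_borel_hull:
  assumes null: "hausdorff_measure k E A = 0"
  obtains G where "G \<in> sets (metric_borel E)" "A \<subseteq> G" "hausdorff_measure k E G = 0"
proof -
  define cover where "cover \<delta> A (B :: nat \<Rightarrow> 'a set) \<longleftrightarrow>
    (\<forall>i. B i \<subseteq> mspace E \<and> ediam E (B i) \<le> ennreal \<delta>) \<and> A \<subseteq> (\<Union>i. B i)" for \<delta> A B
  have H: "hausdorff_measure k E X =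
      (SUP \<delta>\<in>{0<..}. INF B \<in> {B. cover \<delta> X B}. \<Sum>i. hausdorff_gauge k E (B i))" for X
    unfolding hausdorff_measure_def cover_def ..
  let ?d = "\<lambda>m. 1 / real (Suc m)"
  have "\<exists>B. cover (?d m) A B \<and> (\<Sum>i. hausdorff_gauge k E (B i)) < ennreal (?d m)" for m
  proof -
    have "(INF B \<in> {B. cover (?d m) A B}. \<Sum>i. hausdorff_gauge k E (B i)) \<le> hausdorff_measure k E A"
      unfolding H by (rule SUP_upper) simp
    also have "\<dots> < ennreal (?d m)" using null by simp
    finally show ?thesis by (auto simp: INF_less_iff)
  qed
  then obtain B where B: "\<And>m. cover (?d m) A (B m)"
    "\<And>m. (\<Sum>i. hausdorff_gauge k E (B m i)) < ennreal (?d m)" by metis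
  define cl where "cl m i = mtopology_of E closure_of B m i" for m i
  define G where "G = (\<Inter>m. \<Union>i. cl m i)"
  have BE: "B m i \<subseteq> mspace E" for m i using B(1)[of m] by (auto simp: cover_def)
  have "cl m i \<in> sets (metric_borel E)" for m i
    unfolding cl_def by (intro closedin_sets_borel closedin_closure_of)
  then have "G \<in> sets (metric_borel E)" unfolding G_def by auto
  moreover have "A \<subseteq> G"
  proof -
    have "B m i \<subseteq> cl m i" for m i unfolding cl_def using BE by (intro closure_of_subset) simp
    then have "(\<Union>i. B m i) \<subseteq> (\<Union>i. cl m i)" for m by blast
    moreover have "A \<subseteq> (\<Union>i. B m i)" for m using B(1)[of m] by (simp add: cover_def)
    ultimately have "A \<subseteq> (\<Union>i. cl m i)" for m by (meson order_trans)
    then show ?thesis unfolding G_def by (rule INT_greatest)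
  qed
  moreover have "hausdorff_measure k E G = 0"
  proof -
    have "(INF B \<in> {B. cover \<delta> G B}. \<Sum>i. hausdorff_gauge k E (B i)) \<le> 0" if \<delta>: "0 < \<delta>" for \<delta>
    proof (rule ennreal_le_epsilon)
      fix e :: real assume e: "0 < e"
      then obtain m where m: "?d m < min \<delta> e"
        using reals_Archimedean[of "min \<delta> e"] \<delta> by (auto simp: inverse_eq_divide)
      have "cover \<delta> G (cl m)"
        unfolding cover_def
      proof (intro conjI allI)
        show "cl m i \<subseteq> mspace E" for i unfolding cl_def using closure_of_subset_topspace[of "mtopology_of E"] by simp
        have "ediam E (cl m i) \<le> ennreal (?d m)" for i
          using ediam_closure[OF BE, of m i] B(1)[of m] by (auto simp: cl_def cover_def intro: order_trans)
        moreover have "ennreal (?d m) \<le> ennreal \<delta>" using m by (intro ennreal_leI) simp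
        ultimately show "ediam E (cl m i) \<le> ennreal \<delta>" for i by (meson order_trans)
        show "G \<subseteq> (\<Union>i. cl m i)" by (auto simp: G_def)
      qed
      then have "(INF B \<in> {B. cover \<delta> G B}. \<Sum>i. hausdorff_gauge k E (B i)) \<le>
          (\<Sum>i. hausdorff_gauge k E (cl m i))" by (intro INF_lower) simp
      also have "\<dots> \<le> (\<Sum>i. hausdorff_gauge k E (B m i))"
        unfolding cl_def by (intro suminf_le hausdorff_gauge_closure BE) auto
      also have "\<dots> \<le> ennreal e"
      proof -
        have "ennreal (?d m) \<le> ennreal e" using m by (intro ennreal_leI) simp
        then show ?thesis using B(2)[of m] by simp
      qed
      finally show "(INF B \<in> {B. cover \<delta> G B}. \<Sum>i. hausdorff_gauge k E (B i)) \<le> 0 + ennreal e" by simp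
    qed
    then have "hausdorff_measure k E G \<le> 0" unfolding H by (intro SUP_least) auto
    then show ?thesis by simp
  qed
  ultimately show ?thesis using that by blast
qed

text \<open>The complement of the closure of \<open>set(T)\<close> is exhausted by the closed sets \<open>W\<^sub>n\<close> of points at distance
  at least \<open>1/(n+1)\<close> from \<open>set(T)\<close>. If one of them had positive mass, a Lipschitz piece of the carrier inside
  it would produce a point of positive lower density, that is, a point of \<open>set(T)\<close> in \<open>W\<^sub>n\<close>.\<close>

lemma rectifiable_mass_carried_by_set:
  assumes E: "mcomplete_of E" and T: "rectifiable_current k E T"
  shows "emeasure (mass_measure k E T) (mspace E - mtopology_of E closure_of cur_set k E T) = 0"
proof (rule ccontr)
  let ?\<mu> = "mass_measure k E T" and ?C = "mtopology_of E closure_of cur_set k E T"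
  assume pos: "emeasure ?\<mu> (mspace E - ?C) \<noteq> 0"
  have cur: "is_current k E T" using T by (simp add: rectifiable_current_def)
  note m = mass_measure_least(1)[OF cur]
  have sets: "sets ?\<mu> = sets (metric_borel E)" and sp: "space ?\<mu> = mspace E"
    using mass_boundD[OF m] by auto
  have "closedin (mtopology_of E) ?C" by (rule closedin_closure_of)
  then obtain \<rho> where \<rho>: "lipschitz_bound E 1 \<rho>" "\<And>x. x \<in> mspace E \<Longrightarrow> 0 \<le> \<rho> x"
    "\<And>x. x \<in> mspace E \<Longrightarrow> \<rho> x = 0 \<longleftrightarrow> x \<in> ?C" using closed_set_distance by blast
  define W where "W n = {x \<in> mspace E. 1 / real (Suc n) \<le> \<rho> x}" for n
  have W: "closedin (mtopology_of E) (W n)" for n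
  proof -
    have "mspace E - W n = {x \<in> mspace E. \<rho> x \<in> {..<1 / real (Suc n)}}" by (auto simp: W_def)
    then have "openin (mtopology_of E) (mspace E - W n)"
      using openin_lip_vimage[OF lip_functionsI[OF \<rho>(1)], of "{..<1 / real (Suc n)}"] by simp
    then show ?thesis unfolding closedin_def by (auto simp: W_def)
  qed
  have "mspace E - ?C = (\<Union>n. W n)"
  proof (intro subset_antisym subsetI)
    fix x assume x: "x \<in> mspace E - ?C"
    then have "0 < \<rho> x" using \<rho>(2)[of x] \<rho>(3)[of x] by force
    then obtain n where "1 / real (Suc n) < \<rho> x" using reals_Archimedean[of "\<rho> x"] by (auto simp: inverse_eq_divide)
    then show "x \<in> (\<Union>n. W n)" using x by (auto simp: W_def intro!: exI[of _ n])
  next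
    fix x assume "x \<in> (\<Union>n. W n)"
    then obtain n where "x \<in> mspace E" "1 / real (Suc n) \<le> \<rho> x" by (auto simp: W_def)
    moreover have "0 < 1 / real (Suc n)" by simp
    ultimately have "x \<in> mspace E" "\<rho> x \<noteq> 0" by linarith+
    then show "x \<in> mspace E - ?C" using \<rho>(3) by blast
  qed
  then obtain n where n: "emeasure ?\<mu> (W n) \<noteq> 0"
    using pos emeasure_UN_eq_0[of ?\<mu> W] closedin_sets_borel[OF W] sets by auto
  obtain S N where S: "countably_rectifiable k E S" and N: "N \<in> null_sets ?\<mu>" "mspace E - S \<subseteq> N"
    using T unfolding rectifiable_current_def by (elim conjE exE bexE) (rule that)
  obtain A f where Af: "\<forall>i::nat. A i \<subseteq> mspace (euclid k) \<and>
      Lipschitz_continuous_map (submetric (euclid k) (A i)) E (f i)"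
    and H: "hausdorff_measure k E (S - (\<Union>i. f i ` A i)) = 0"
    using S unfolding countably_rectifiable_def by (elim conjE exE) (rule that)
  have f: "A i \<subseteq> mspace (euclid k)" "Lipschitz_continuous_map (submetric (euclid k) (A i)) E (f i)" for i
    using Af by auto
  obtain G where G: "G \<in> sets (metric_borel E)" "S - (\<Union>i. f i ` A i) \<subseteq> G" "hausdorff_measure k E G = 0"
    using hausdorff_null_borel_hull[OF H] by blast
  have "emeasure ?\<mu> G = 0" using T G(1,3) by (auto simp: rectifiable_current_def)
  then have G0: "G \<in> null_sets ?\<mu>" using G(1) sets by auto
  let ?D = "\<lambda>i. {x \<in> A i. f i x \<in> W n}"
  have WE: "W n \<subseteq> space ?\<mu>" by (auto simp: W_def sp)
  have "\<exists>i. outer_measure_of ?\<mu> (f i ` ?D i) \<noteq> 0"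
  proof (rule ccontr)
    assume "\<not> ?thesis"
    then have D0: "outer_measure_of ?\<mu> (\<Union>i\<in>UNIV. f i ` ?D i) = 0"
      using WE by (intro outer_measure_of_UN_null) auto
    obtain N' where N': "N' \<in> sets ?\<mu>" "(\<Union>i. f i ` ?D i) \<subseteq> N'" "emeasure ?\<mu> N' = 0"
      using outer_measure_of_attain[of "\<Union>i\<in>UNIV. f i ` ?D i" ?\<mu>] D0 WE by auto
    have "W n \<subseteq> N \<union> G \<union> N'"
    proof
      fix x assume x: "x \<in> W n"
      then have "x \<in> mspace E" using WE sp by auto
      moreover have "x \<in> N'" if "x \<in> f i ` A i" for i using that x N'(2) by blast
      ultimately show "x \<in> N \<union> G \<union> N'" using N(2) G(2) by blast
    qed
    moreover have "N \<union> G \<union> N' \<in> null_sets ?\<mu>" using N(1) G0 N' by auto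
    moreover have "W n \<in> sets ?\<mu>" unfolding sets by (rule closedin_sets_borel[OF W])
    ultimately have "emeasure ?\<mu> (W n) = 0" by (metis null_setsD1 null_sets_subset)
    then show False using n by blast
  qed
  then obtain i where i: "outer_measure_of ?\<mu> (f i ` ?D i) \<noteq> 0" by blast
  obtain L where L: "L > 0" "\<forall>x\<in>A i \<inter> mspace (euclid k). \<forall>y\<in>A i \<inter> mspace (euclid k).
      mdist E (f i x) (f i y) \<le> L * mdist (euclid k) x y"
    using f(2)[of i] unfolding Lipschitz_continuous_map_pos mspace_submetric mdist_submetric by blast
  obtain p where p: "p \<in> W n"
    "0 < Liminf (at_right 0) (\<lambda>r. emeasure ?\<mu> (mball_of E p r) / ennreal (r ^ k))"
  proof (rule lipschitz_image_density_point[OF E mass_boundD(2)[OF m] sets _ _ _ W i])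
    show "f i x \<in> W n" if "x \<in> ?D i" for x using that by blast
    show "0 \<le> L" using L(1) by simp
    show "mdist E (f i x) (f i y) \<le> L * mdist (euclid k) x y" if "x \<in> ?D i" "y \<in> ?D i" for x y
      using that L(2) f(1)[of i] by blast
  qed (rule that)
  have pE: "p \<in> mspace E" using p(1) by (auto simp: W_def)
  then have "p \<in> cur_set k E T" using p(2) by (simp add: cur_set_def)
  then have "p \<in> ?C" using closure_of_subset[of "cur_set k E T" "mtopology_of E"]
    by (auto simp: cur_set_def)
  then have "\<rho> p = 0" using \<rho>(3)[OF pE] by simp
  then show False using p(1) by (simp add: W_def)
qed

section \<open>Isometric embeddings\<close>

lemma isometric_embeddingD:
  assumes "metric_isometric_embedding E Z \<psi>"
  shows "x \<in> mspace E \<Longrightarrow> \<psi> x \<in> mspace Z"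
    and "x \<in> mspace E \<Longrightarrow> y \<in> mspace E \<Longrightarrow> mdist Z (\<psi> x) (\<psi> y) = mdist E x y"
  using assms by (auto simp: metric_isometric_embedding_def)

lemma mdist_quadrilateral:
  assumes "a \<in> mspace E" "b \<in> mspace E" "a' \<in> mspace E" "b' \<in> mspace E"
  shows "\<bar>mdist E a b - mdist E a' b'\<bar> \<le> mdist E a a' + mdist E b b'"
  using mdist_triangle[OF assms(1,3,2)] mdist_triangle[OF assms(3,4,2)]
    mdist_triangle[OF assms(3,1,4)] mdist_triangle[OF assms(1,2,4)]
  by (simp add: abs_le_iff mdist_commute)

text \<open>The Lipschitz extension to the closure of \<open>X\<close> preserves distances because \<open>\<phi>\<close> does on the dense set \<open>X\<close>.\<close>

lemma isometric_extension_exists: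
  assumes Z: "mcomplete_of Z" and dense: "mtopology_of E closure_of X = mspace E"
    and X: "X \<subseteq> mspace E" and \<phi>: "metric_isometric_embedding (submetric E X) Z \<phi>"
  obtains \<psi> where "\<psi> \<in> extensional (mspace E)" "metric_isometric_embedding E Z \<psi>"
    "\<And>x. x \<in> X \<Longrightarrow> \<psi> x = \<phi> x"
proof -
  have "Lipschitz_continuous_map (submetric E X) Z \<phi>"
    using \<phi> unfolding Lipschitz_continuous_map_def metric_isometric_embedding_def
    by (intro conjI exI[of _ 1]) auto
  then obtain g where "Lipschitz_continuous_map (submetric E (mtopology_of E closure_of X)) Z g"
    and ext: "\<And>x. x \<in> X \<Longrightarrow> g x = \<phi> x"
    using Lipschitz_continuous_map_extends_to_closure_of[OF Z] by blast
  then obtain C where gZ: "g \<in> mspace E \<rightarrow> mspace Z" and C: "0 < C"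
    "\<And>x y. x \<in> mspace E \<Longrightarrow> y \<in> mspace E \<Longrightarrow> mdist Z (g x) (g y) \<le> C * mdist E x y"
    unfolding dense submetric_mspace Lipschitz_continuous_map_pos by blast
  have iso: "mdist Z (g x) (g y) = mdist E x y" if xy: "x \<in> mspace E" "y \<in> mspace E" for x y
  proof -
    have "\<bar>mdist Z (g x) (g y) - mdist E x y\<bar> \<le> 0"
    proof (rule field_le_epsilon)
      fix e :: real assume e: "0 < e"
      define \<delta> where "\<delta> = e / (2 * (C + 1))"
      have \<delta>: "0 < \<delta>" "2 * (C + 1) * \<delta> = e" using e C(1) by (simp_all add: \<delta>_def)
      have near: "\<exists>z'. z' \<in> X \<and> z' \<in> mspace E \<and> mdist E z z' < \<delta> \<and> mdist Z (g z) (g z') \<le> C * \<delta>"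
        if z: "z \<in> mspace E" for z
      proof -
        have "z \<in> mtopology_of E closure_of X" using z dense by simp
        then obtain z' where z': "z' \<in> X" "z' \<in> mspace E" "mdist E z z' < \<delta>"
          using \<delta>(1) unfolding in_closure_of_iff by blast
        have "C * mdist E z z' \<le> C * \<delta>" using z'(3) C(1) by simp
        then show ?thesis using z' C(2)[OF z z'(2)] by force
      qed
      obtain x' y' where x': "x' \<in> X" "x' \<in> mspace E" "mdist E x x' < \<delta>" "mdist Z (g x) (g x') \<le> C * \<delta>"
        and y': "y' \<in> X" "y' \<in> mspace E" "mdist E y y' < \<delta>" "mdist Z (g y) (g y') \<le> C * \<delta>"
        using near[OF xy(1)] near[OF xy(2)] by blast
      have "mdist Z (g x') (g y') = mdist E x' y'"
        using isometric_embeddingD(2)[OF \<phi>, of x' y'] x' y' by (simp add: ext)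
      moreover have "g z \<in> mspace Z" if "z \<in> mspace E" for z using gZ that by auto
      ultimately show "\<bar>mdist Z (g x) (g y) - mdist E x y\<bar> \<le> 0 + e"
        using mdist_quadrilateral[of "g x" Z "g y" "g x'" "g y'"] mdist_quadrilateral[of x E y x' y']
          xy x' y' \<delta>(2) by (simp add: algebra_simps)
    qed
    then show ?thesis by simp
  qed
  show ?thesis
  proof (rule that[of "restrict g (mspace E)"])
    show "metric_isometric_embedding E Z (restrict g (mspace E))"
      using gZ iso by (auto simp: metric_isometric_embedding_def)
    show "restrict g (mspace E) x = \<phi> x" if "x \<in> X" for x using ext[OF that] that X by auto
  qed simp
qed

lemma embedding_extension_isometric:
  assumes Z: "mcomplete_of Z" and dense: "mtopology_of E closure_of X = mspace E"
    and X: "X \<subseteq> mspace E" and \<phi>: "metric_isometric_embedding (submetric E X) Z \<phi>"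
  shows "metric_isometric_embedding E Z (embedding_extension E X Z \<phi>)"
proof -
  let ?P = "\<lambda>\<psi>. \<psi> \<in> extensional (mspace E) \<and> metric_isometric_embedding E Z \<psi> \<and> (\<forall>x\<in>X. \<psi> x = \<phi> x)"
  obtain \<psi> where \<psi>: "?P \<psi>" using isometric_extension_exists[OF Z dense X \<phi>] by metis
  have "?P (embedding_extension E X Z \<phi>)"
    unfolding embedding_extension_def
  proof (rule theI[of ?P, OF \<psi>])
    fix \<eta> assume \<eta>: "?P \<eta>"
    show "\<eta> = \<psi>"
    proof (rule extensionalityI[of _ "mspace E"])
      fix x assume x: "x \<in> mspace E"
      note iso = isometric_embeddingD[OF conjunct1[OF conjunct2[OF \<psi>]]]
        isometric_embeddingD[OF conjunct1[OF conjunct2[OF \<eta>]]]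
      have "mdist Z (\<eta> x) (\<psi> x) \<le> 0"
      proof (rule field_le_epsilon)
        fix e :: real assume "0 < e"
        moreover have "x \<in> mtopology_of E closure_of X" using x dense by simp
        ultimately obtain y where y: "y \<in> X" "mdist E x y < e / 2"
          unfolding in_closure_of_iff by (meson half_gt_zero)
        then have yE: "y \<in> mspace E" using X by auto
        have "\<eta> y = \<psi> y" using y \<psi> \<eta> by simp
        then have "mdist Z (\<eta> x) (\<psi> x) \<le> mdist Z (\<eta> x) (\<eta> y) + mdist Z (\<psi> y) (\<psi> x)"
          using mdist_triangle[of "\<eta> x" Z "\<eta> y" "\<psi> x"] iso x yE by simp
        then show "mdist Z (\<eta> x) (\<psi> x) \<le> 0 + e"
          using iso x yE y(2) by (simp add: mdist_commute[of E y x])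
      qed
      then have "mdist Z (\<eta> x) (\<psi> x) = 0" using mdist_nonneg[of Z "\<eta> x" "\<psi> x"] by linarith
      then show "\<eta> x = \<psi> x" using iso x by simp
    qed (use \<psi> \<eta> in auto)
  qed
  then show ?thesis by blast
qed

lemma lipschitz_bound_pullback:
  assumes "metric_isometric_embedding E Z \<psi>" "lipschitz_bound Z C p"
  shows "lipschitz_bound E C (p \<circ> \<psi>)"
  unfolding lipschitz_bound_def
proof (intro conjI ballI)
  show "0 \<le> C" using assms(2) by (rule lipschitz_bound_nonneg)
  fix x y assume xy: "x \<in> mspace E" "y \<in> mspace E"
  note iso = isometric_embeddingD[OF assms(1)]
  show "\<bar>(p \<circ> \<psi>) x - (p \<circ> \<psi>) y\<bar> \<le> C * mdist E x y"
    using lipschitz_boundD[OF assms(2) iso(1)[OF xy(1)] iso(1)[OF xy(2)]] iso(2)[OF xy] by simp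
qed

lemma pullback_lip:
  assumes "metric_isometric_embedding E Z \<psi>" "p \<in> lip_functions Z"
  shows "p \<circ> \<psi> \<in> lip_functions E" "lip_const E (p \<circ> \<psi>) \<le> lip_const Z p"
  using lipschitz_bound_pullback[OF assms(1) lip_const_bound[OF assms(2)]]
  by (auto intro: lip_functionsI lip_const_le)

lemma pullback_bounded_lip:
  assumes \<psi>: "metric_isometric_embedding E Z \<psi>" and f: "f \<in> bounded_lip_functions Z"
  shows "f \<circ> \<psi> \<in> bounded_lip_functions E"
proof -
  obtain B where "\<And>x. x \<in> mspace Z \<Longrightarrow> \<bar>f x\<bar> \<le> B" using bounded_lip_bound[OF f] by blast
  then show ?thesis
    using pullback_lip(1)[OF \<psi> bounded_lipD[OF f]] isometric_embeddingD(1)[OF \<psi>]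
    by (intro bounded_lipI[of _ _ B]) auto
qed

lemma prod_list_map_mono:
  fixes c :: "'a \<Rightarrow> real" and d :: "'b \<Rightarrow> real"
  assumes "list_all2 (\<lambda>x y. 0 \<le> c x \<and> c x \<le> d y) xs ys"
  shows "0 \<le> prod_list (map c xs) \<and> prod_list (map c xs) \<le> prod_list (map d ys)"
  using assms by (induction rule: list_all2_induct) (auto intro!: mult_mono)

lemma pullback_form_tuples:
  assumes \<psi>: "metric_isometric_embedding E Z \<psi>" and \<pi>: "\<pi> \<in> form_tuples k Z"
  shows "map (\<lambda>p. p \<circ> \<psi>) \<pi> \<in> form_tuples k E" "lip_prod E (map (\<lambda>p. p \<circ> \<psi>) \<pi>) \<le> lip_prod Z \<pi>"
proof -
  have lip: "\<forall>p\<in>set \<pi>. p \<in> lip_functions Z" using \<pi> by (auto simp: form_tuples_def)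
  then show "map (\<lambda>p. p \<circ> \<psi>) \<pi> \<in> form_tuples k E"
    using \<pi> pullback_lip(1)[OF \<psi>] by (auto simp: form_tuples_def)
  have "list_all2 (\<lambda>p q. 0 \<le> lip_const E p \<and> lip_const E p \<le> lip_const Z q) (map (\<lambda>p. p \<circ> \<psi>) \<pi>) \<pi>"
    using lip pullback_lip[OF \<psi>] lip_const_nonneg[OF pullback_lip(1)[OF \<psi>]]
    by (auto simp: list_all2_conv_all_nth)
  from prod_list_map_mono[OF this] show "lip_prod E (map (\<lambda>p. p \<circ> \<psi>) \<pi>) \<le> lip_prod Z \<pi>" by simp
qed

text \<open>McShane extension from the isometric copy of \<open>E\<close> in \<open>Z\<close>.\<close>

lemma lipschitz_extend_along:
  assumes \<psi>: "metric_isometric_embedding E Z \<psi>" and f: "lipschitz_bound E C f"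
  obtains F where "lipschitz_bound Z C F" "\<And>x. x \<in> mspace E \<Longrightarrow> F (\<psi> x) = f x"
proof -
  note iso = isometric_embeddingD[OF \<psi>]
  have inj: "inj_on \<psi> (mspace E)"
  proof (rule inj_onI)
    fix x y assume xy: "x \<in> mspace E" "y \<in> mspace E" "\<psi> x = \<psi> y"
    then have "mdist E x y = 0" using iso(2)[of x y] iso(1)[of y] by simp
    then show "x = y" using xy by simp
  qed
  obtain F where F: "lipschitz_bound Z C F" "\<And>y. y \<in> \<psi> ` mspace E \<Longrightarrow> F y = (f \<circ> inv_into (mspace E) \<psi>) y"
  proof (rule McShane_extension[of "\<psi> ` mspace E" Z C "f \<circ> inv_into (mspace E) \<psi>"])
    show "\<psi> ` mspace E \<subseteq> mspace Z" using iso by auto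
    show "0 \<le> C" using f by (rule lipschitz_bound_nonneg)
    fix u v assume "u \<in> \<psi> ` mspace E" "v \<in> \<psi> ` mspace E"
    then show "\<bar>(f \<circ> inv_into (mspace E) \<psi>) u - (f \<circ> inv_into (mspace E) \<psi>) v\<bar> \<le> C * mdist Z u v"
      using lipschitz_boundD[OF f] iso by (auto simp: inv_into_f_f[OF inj])
  qed (rule that)
  show ?thesis by (rule that[OF F(1)]) (simp add: F(2) inv_into_f_f[OF inj])
qed

lemma lipschitz_extend_along_bounded:
  assumes \<psi>: "metric_isometric_embedding E Z \<psi>" and f: "lipschitz_bound E C f"
    and B: "0 \<le> B" "\<And>x. x \<in> mspace E \<Longrightarrow> \<bar>f x\<bar> \<le> B"
  obtains F where "lipschitz_bound Z C F" "\<And>x. x \<in> mspace E \<Longrightarrow> F (\<psi> x) = f x" "\<And>z. \<bar>F z\<bar> \<le> B"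
proof -
  obtain F where F: "lipschitz_bound Z C F" "\<And>x. x \<in> mspace E \<Longrightarrow> F (\<psi> x) = f x"
    using lipschitz_extend_along[OF \<psi> f] by blast
  show ?thesis
  proof (rule that[of "\<lambda>z. max (- B) (min B (F z))"])
    show "lipschitz_bound Z C (\<lambda>z. max (- B) (min B (F z)))"
      by (rule lipschitz_bound_clip[OF F(1)])
    show "max (- B) (min B (F (\<psi> x))) = f x" if "x \<in> mspace E" for x
      using B(2)[OF that] F(2)[OF that] by linarith
    show "\<bar>max (- B) (min B (F z))\<bar> \<le> B" for z using B(1) by linarith
  qed
qed

lemma form_tuples_extend_along:
  assumes \<psi>: "metric_isometric_embedding E Z \<psi>" and \<pi>: "\<pi> \<in> form_tuples k E"
  obtains \<sigma> where "\<sigma> \<in> form_tuples k Z" "lip_prod Z \<sigma> \<le> lip_prod E \<pi>"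
    "\<And>x i. x \<in> mspace E \<Longrightarrow> i < k \<Longrightarrow> (\<sigma> ! i) (\<psi> x) = (\<pi> ! i) x"
proof -
  have len: "length \<pi> = k" and lip: "\<And>p. p \<in> set \<pi> \<Longrightarrow> p \<in> lip_functions E"
    using \<pi> by (auto simp: form_tuples_def)
  have "\<forall>p\<in>set \<pi>. \<exists>F. lipschitz_bound Z (lip_const E p) F \<and> (\<forall>x\<in>mspace E. F (\<psi> x) = p x)"
    using lipschitz_extend_along[OF \<psi> lip_const_bound[OF lip]] by metis
  then obtain F where F: "\<And>p. p \<in> set \<pi> \<Longrightarrow> lipschitz_bound Z (lip_const E p) (F p)"
    "\<And>p x. p \<in> set \<pi> \<Longrightarrow> x \<in> mspace E \<Longrightarrow> F p (\<psi> x) = p x" by metis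
  have FL: "F p \<in> lip_functions Z" "lip_const Z (F p) \<le> lip_const E p" if "p \<in> set \<pi>" for p
    using F(1)[OF that] by (auto intro: lip_functionsI lip_const_le)
  show ?thesis
  proof (rule that[of "map F \<pi>"])
    show "map F \<pi> \<in> form_tuples k Z" using FL len by (auto simp: form_tuples_def)
    have "list_all2 (\<lambda>p q. 0 \<le> lip_const Z p \<and> lip_const Z p \<le> lip_const E q) (map F \<pi>) \<pi>"
      using FL lip_const_nonneg[OF FL(1)] by (auto simp: list_all2_conv_all_nth)
    from prod_list_map_mono[OF this] show "lip_prod Z (map F \<pi>) \<le> lip_prod E \<pi>" by simp
    show "(map F \<pi> ! i) (\<psi> x) = (\<pi> ! i) x" if "x \<in> mspace E" "i < k" for x i
      using that len F(2) by simp
  qed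
qed

section \<open>The flat distance controls the values on forms\<close>

lemma mass_estimate:
  assumes T: "is_current k E T" and f: "f \<in> bounded_lip_functions E" and \<pi>: "\<pi> \<in> form_tuples k E"
    and B: "\<And>x. x \<in> mspace E \<Longrightarrow> \<bar>f x\<bar> \<le> B" "0 \<le> B" and P: "lip_prod E \<pi> \<le> P"
    and m: "mass k E T = ennreal m" "0 \<le> m"
  shows "\<bar>T f \<pi>\<bar> \<le> P * B * m"
proof -
  note M = mass_measure_least(1)[OF T]
  have P0: "0 \<le> lip_prod E \<pi>" using \<pi> by (intro lip_prod_nonneg) (auto simp: form_tuples_def)
  have "ennreal \<bar>T f \<pi>\<bar> \<le> ennreal (lip_prod E \<pi>) * (\<integral>\<^sup>+x. ennreal \<bar>f x\<bar> \<partial>mass_measure k E T)"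
    by (rule mass_boundD(4)[OF M f \<pi>])
  also have "\<dots> \<le> ennreal (lip_prod E \<pi>) * (\<integral>\<^sup>+x. ennreal B \<partial>mass_measure k E T)"
    using B mass_boundD(3)[OF M] by (intro mult_left_mono nn_integral_mono ennreal_leI) auto
  also have "\<dots> = ennreal (lip_prod E \<pi> * B * m)"
    using mass_boundD(3)[OF M] m P0 B(2) by (simp add: ennreal_mult mult.assoc flip: mass_def)
  finally have "\<bar>T f \<pi>\<bar> \<le> lip_prod E \<pi> * B * m"
    using P0 B(2) m(2) by (subst (asm) ennreal_le_iff) auto
  also have "\<dots> \<le> P * B * m" using P B(2) m(2) by (intro mult_right_mono) auto
  finally show ?thesis .
qed

lemma flat_dist_lessE:
  assumes "flat_dist m Z S T < ennreal e"
  obtains U V u v where "is_current m Z U" "is_current (Suc m) Z V"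
    "\<And>f \<pi>. f \<in> bounded_lip_functions Z \<Longrightarrow> \<pi> \<in> form_tuples m Z \<Longrightarrow>
       S f \<pi> - T f \<pi> = U f \<pi> + V (\<lambda>_. 1) (f # \<pi>)"
    "mass m Z U = ennreal u" "mass (Suc m) Z V = ennreal v" "0 \<le> u" "0 \<le> v" "u + v \<le> e"
proof -
  obtain U V where UV: "integral_current m Z U" "integral_current (Suc m) Z V"
    "cur_eq m Z (\<lambda>f \<pi>. S f \<pi> - T f \<pi>) (\<lambda>f \<pi>. U f \<pi> + cur_boundary V f \<pi>)"
    "mass m Z U + mass (Suc m) Z V < ennreal e"
    using assms unfolding flat_dist_def INF_less_iff by auto
  have cur: "is_current m Z U" "is_current (Suc m) Z V"
    using UV(1,2) by (auto simp: integral_current_def normal_current_def)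
  have "mass m Z U + mass (Suc m) Z V \<noteq> top" using UV(4) by auto
  then obtain u v where uv: "mass m Z U = ennreal u" "mass (Suc m) Z V = ennreal v" "0 \<le> u" "0 \<le> v"
    by (cases "mass m Z U"; cases "mass (Suc m) Z V") auto
  have "ennreal (u + v) < ennreal e" using UV(4) uv by (simp add: ennreal_plus)
  moreover have "0 \<le> u + v" using uv by simp
  ultimately have "u + v \<le> e" using ennreal_less_iff less_imp_le by blast
  moreover have "S f \<pi> - T f \<pi> = U f \<pi> + V (\<lambda>_. 1) (f # \<pi>)"
    if "f \<in> bounded_lip_functions Z" "\<pi> \<in> form_tuples m Z" for f \<pi>
    using UV(3) formsI[OF that] by (auto simp: cur_eq_def cur_boundary_def)
  ultimately show ?thesis using that cur uv by blast
qed

lemma form_tuples_Cons: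
  "f \<in> lip_functions E \<Longrightarrow> \<pi> \<in> form_tuples m E \<Longrightarrow> f # \<pi> \<in> form_tuples (Suc m) E"
  by (auto simp: form_tuples_def)

lemma flat_dist_form_estimate:
  assumes "flat_dist m Z S T < ennreal e"
    and f: "f \<in> bounded_lip_functions Z" and \<pi>: "\<pi> \<in> form_tuples m Z"
    and B: "\<And>x. x \<in> mspace Z \<Longrightarrow> \<bar>f x\<bar> \<le> B" "0 \<le> B"
    and L: "lip_const Z f \<le> L" and P: "lip_prod Z \<pi> \<le> P"
  shows "\<bar>S f \<pi> - T f \<pi>\<bar> \<le> P * (B + L) * e"
proof -
  obtain U V u v where UV: "is_current m Z U" "is_current (Suc m) Z V"
    "S f \<pi> - T f \<pi> = U f \<pi> + V (\<lambda>_. 1) (f # \<pi>)"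
    "mass m Z U = ennreal u" "mass (Suc m) Z V = ennreal v" "0 \<le> u" "0 \<le> v" "u + v \<le> e"
    using flat_dist_lessE[OF assms(1)] f \<pi> by metis
  have P0: "0 \<le> P" using P \<pi> lip_prod_nonneg[of \<pi> Z] by (auto simp: form_tuples_def)
  have L0: "0 \<le> L" using L lip_const_nonneg[OF bounded_lipD[OF f]] by simp
  have "\<bar>U f \<pi>\<bar> \<le> P * B * u" by (rule mass_estimate[OF UV(1) f \<pi> B P UV(4,6)])
  moreover have "\<bar>V (\<lambda>_. 1) (f # \<pi>)\<bar> \<le> (L * P) * 1 * v"
  proof (rule mass_estimate[OF UV(2) bounded_lip_const form_tuples_Cons[OF bounded_lipD[OF f] \<pi>] _ _ _ UV(5,7)])
    show "lip_prod Z (f # \<pi>) \<le> L * P"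
      using L P L0 \<pi> lip_prod_nonneg[of \<pi> Z] by (auto simp: form_tuples_def intro!: mult_mono)
  qed auto
  ultimately have "\<bar>S f \<pi> - T f \<pi>\<bar> \<le> P * B * u + P * L * v" unfolding UV(3) by (simp add: ac_simps)
  also have "\<dots> \<le> P * (B + L) * u + P * (B + L) * v"
    using P0 B(2) L0 UV(6,7) by (intro add_mono mult_mono) auto
  also have "\<dots> = P * (B + L) * (u + v)" by (simp add: algebra_simps)
  also have "\<dots> \<le> P * (B + L) * e" using P0 B(2) L0 UV(8) by (intro mult_left_mono) auto
  finally show ?thesis .
qed

text \<open>For the boundaries the filling \<open>V\<close> contributes nothing, since \<open>\<partial>\<partial>V = 0\<close> by locality.\<close>

lemma flat_dist_boundary_estimate:
  assumes "flat_dist (Suc m) Z S T < ennreal e"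
    and f: "f \<in> bounded_lip_functions Z" and \<pi>: "\<pi> \<in> form_tuples m Z"
  shows "\<bar>cur_boundary S f \<pi> - cur_boundary T f \<pi>\<bar> \<le> lip_const Z f * lip_prod Z \<pi> * e"
proof -
  have f\<pi>: "f # \<pi> \<in> form_tuples (Suc m) Z" using form_tuples_Cons[OF bounded_lipD[OF f] \<pi>] .
  obtain U V u v where UV: "is_current (Suc m) Z U" "is_current (Suc (Suc m)) Z V"
    "S (\<lambda>_. 1) (f # \<pi>) - T (\<lambda>_. 1) (f # \<pi>) = U (\<lambda>_. 1) (f # \<pi>) + V (\<lambda>_. 1) ((\<lambda>_. 1) # f # \<pi>)"
    "mass (Suc m) Z U = ennreal u" "mass (Suc (Suc m)) Z V = ennreal v" "0 \<le> u" "0 \<le> v" "u + v \<le> e"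
    using flat_dist_lessE[OF assms(1)] bounded_lip_const f\<pi> by metis
  have "V (\<lambda>_. 1) ((\<lambda>_. 1) # f # \<pi>) = 0"
    by (rule current_local[OF UV(2) bounded_lip_const form_tuples_Cons[OF lip_functions_const f\<pi>],
          of 0 "mspace Z" 1]) (use openin_topspace[of "mtopology_of Z"] in auto)
  moreover have "\<bar>U (\<lambda>_. 1) (f # \<pi>)\<bar> \<le> lip_prod Z (f # \<pi>) * 1 * u"
    by (rule mass_estimate[OF UV(1) bounded_lip_const f\<pi> _ _ order_refl UV(4,6)]) auto
  moreover have "lip_prod Z (f # \<pi>) * u \<le> lip_prod Z (f # \<pi>) * e"
    using UV(7,8) f\<pi> by (intro mult_left_mono lip_prod_nonneg) (auto simp: form_tuples_def)
  ultimately show ?thesis using UV(3) by (simp add: cur_boundary_def)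
qed

lemma lip_extension_spec:
  assumes C: "C \<subseteq> mspace E" and g: "lipschitz_bound (submetric E C) L g"
  shows "lip_extension E C g \<in> lip_functions E" "\<And>x. x \<in> C \<Longrightarrow> lip_extension E C g x = g x"
    "bounded (g ` C) \<Longrightarrow> lip_extension E C g \<in> bounded_lip_functions E"
proof -
  have gL: "\<bar>g x - g y\<bar> \<le> L * mdist E x y" if "x \<in> C" "y \<in> C" for x y
    using lipschitz_boundD[OF g, of x y] that C by auto
  have L: "0 \<le> L" using g by (rule lipschitz_bound_nonneg)
  let ?P = "\<lambda>h. h \<in> lip_functions E \<and> (\<forall>x\<in>C. h x = g x) \<and>
        (bounded (g ` C) \<longrightarrow> bounded (h ` mspace E))"
  obtain h where h: "lipschitz_bound E L h" "\<And>x. x \<in> C \<Longrightarrow> h x = g x"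
    using McShane_extension[OF C L gL] by blast
  have "\<exists>h. ?P h"
  proof (cases "bounded (g ` C)")
    case True
    then obtain B where B: "\<forall>x\<in>C. \<bar>g x\<bar> \<le> B" by (auto simp: bounded_iff)
    let ?h = "\<lambda>x. max (- \<bar>B\<bar>) (min \<bar>B\<bar> (h x))"
    have "?h x = g x" if "x \<in> C" for x using B h(2)[OF that] that by fastforce
    moreover have "\<bar>?h x\<bar> \<le> \<bar>B\<bar>" for x by linarith
    then have "bounded (?h ` mspace E)" unfolding bounded_iff by auto
    ultimately show ?thesis using lip_functionsI[OF lipschitz_bound_clip[OF h(1)]] by blast
  next
    case False
    then show ?thesis using h lip_functionsI by blast
  qed
  then have "?P (lip_extension E C g)" unfolding lip_extension_def by (rule someI_ex)
  then show "lip_extension E C g \<in> lip_functions E" "\<And>x. x \<in> C \<Longrightarrow> lip_extension E C g x = g x"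
    "bounded (g ` C) \<Longrightarrow> lip_extension E C g \<in> bounded_lip_functions E"
    by (auto simp: bounded_lip_functions_def)
qed

text \<open>The filling lives in another space than \<open>E\<close>. The form is extended from the carrier of \<open>S\<close> to
  that space with the same bound and the same Lipschitz constants; the values of \<open>S\<close> see only the
  carrier.\<close>

lemma intrinsic_flat_dist_zero_estimate:
  assumes E: "mcomplete_of E" and S: "integral_current m E S"
    and less: "intrinsic_flat_dist m (space_of_current m E S) (zero_space :: 'b current_space) < ennreal e"
    and f: "f \<in> bounded_lip_functions E" and \<pi>: "\<pi> \<in> form_tuples m E"
    and B: "\<And>x. x \<in> mspace E \<Longrightarrow> \<bar>f x\<bar> \<le> B" "0 \<le> B"
  shows "\<bar>S f \<pi>\<bar> \<le> lip_prod E \<pi> * (B + lip_const E f) * e"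
proof -
  define C where "C = mtopology_of E closure_of cur_set m E S"
  let ?N = "space_of_current m E S"
  have N: "sp_set ?N = cur_set m E S" "sp_compl ?N = submetric E C" "sp_cur ?N = cur_on_subset E C S"
    by (simp_all add: space_of_current_def Let_def C_def)
  have csE: "cur_set m E S \<subseteq> mspace E" by (auto simp: cur_set_def)
  have CE: "C \<subseteq> mspace E" unfolding C_def using closure_of_subset_topspace[of "mtopology_of E"] by simp
  have csC: "cur_set m E S \<subseteq> C" unfolding C_def using csE by (intro closure_of_subset) simp
  have spC: "mspace (submetric E C) = C" using CE by auto
  have cur: "is_current m E S" and rect: "rectifiable_current m E S"
    using S by (auto simp: integral_current_def integer_rectifiable_current_def rectifiable_current_def)
  have C_borel: "C \<in> sets (metric_borel E)" unfolding C_def by (intro closedin_sets_borel closedin_closure_of)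
  have null: "emeasure (mass_measure m E S) (mspace E - C) = 0"
    unfolding C_def by (rule rectifiable_mass_carried_by_set[OF E rect])
  obtain Z :: "real metric" and \<phi> \<phi>0 where Z: "mcomplete_of Z"
    and \<phi>: "metric_isometric_embedding (sp_metric ?N) Z \<phi>"
    and less: "flat_dist m Z (sp_push ?N Z \<phi>) (sp_push (zero_space :: 'b current_space) Z \<phi>0) < ennreal e"
    using less unfolding intrinsic_flat_dist_def INF_less_iff by auto
  define \<psi> where "\<psi> = sp_extension ?N Z \<phi>"
  have \<psi>: "metric_isometric_embedding (submetric E C) Z \<psi>"
    unfolding \<psi>_def N(1,2)
  proof (rule embedding_extension_isometric[OF Z])
    show "mtopology_of (submetric E C) closure_of cur_set m E S = mspace (submetric E C)"
      using csC spC by (simp add: mtopology_of_submetric closure_of_subtopology Int_absorb1 flip: C_def)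
    show "cur_set m E S \<subseteq> mspace (submetric E C)" using csC spC by simp
    show "metric_isometric_embedding (submetric (submetric E C) (cur_set m E S)) Z \<phi>" using \<phi> N by simp
  qed
  have restrict: "lipschitz_bound (submetric E C) L g" if "lipschitz_bound E L g" for L g
    using that by (auto simp: lipschitz_bound_def)
  note fL = bounded_lipD[OF f]
  obtain F where F: "lipschitz_bound Z (lip_const E f) F" "\<And>x. x \<in> C \<Longrightarrow> F (\<psi> x) = f x" "\<And>z. \<bar>F z\<bar> \<le> B"
    using lipschitz_extend_along_bounded[OF \<psi> restrict[OF lip_const_bound[OF fL]] B(2)] B(1) spC CE
    by (metis subsetD)
  have Fb: "F \<in> bounded_lip_functions Z" using F lip_functionsI bounded_lipI by metis
  have \<pi>C: "\<pi> \<in> form_tuples m (submetric E C)"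
    using \<pi> restrict unfolding form_tuples_def subset_iff lip_functions_iff by blast
  obtain \<sigma> where \<sigma>: "\<sigma> \<in> form_tuples m Z" "lip_prod Z \<sigma> \<le> lip_prod (submetric E C) \<pi>"
    "\<And>x i. x \<in> C \<Longrightarrow> i < m \<Longrightarrow> (\<sigma> ! i) (\<psi> x) = (\<pi> ! i) x"
    using form_tuples_extend_along[OF \<psi> \<pi>C] spC by metis
  have "lip_prod (submetric E C) \<pi> \<le> lip_prod E \<pi>"
  proof -
    have "list_all2 (\<lambda>p q. 0 \<le> lip_const (submetric E C) p \<and> lip_const (submetric E C) p \<le> lip_const E q) \<pi> \<pi>"
      unfolding list_all2_same
    proof (intro ballI conjI)
      fix p assume "p \<in> set \<pi>"
      then have p: "p \<in> lip_functions E" "p \<in> lip_functions (submetric E C)"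
        using \<pi> \<pi>C by (auto simp: form_tuples_def)
      show "0 \<le> lip_const (submetric E C) p" by (rule lip_const_nonneg[OF p(2)])
      show "lip_const (submetric E C) p \<le> lip_const E p"
        by (rule lip_const_le[OF restrict[OF lip_const_bound[OF p(1)]]])
    qed
    from prod_list_map_mono[OF this] show ?thesis by simp
  qed
  then have P: "lip_prod Z \<sigma> \<le> lip_prod E \<pi>" using \<sigma>(2) by simp
  have est: "\<bar>sp_push ?N Z \<phi> F \<sigma> - sp_push (zero_space :: 'b current_space) Z \<phi>0 F \<sigma>\<bar>
      \<le> lip_prod E \<pi> * (B + lip_const E f) * e"
    by (rule flat_dist_form_estimate[OF less Fb \<sigma>(1) F(3) B(2) lip_const_le[OF F(1)] P])
  have "sp_push ?N Z \<phi> F \<sigma> = S (lip_extension E C (F \<circ> \<psi>)) (map (lip_extension E C) (map (\<lambda>p. p \<circ> \<psi>) \<sigma>))"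
    by (simp add: sp_push_def push_forward_def N(3) cur_on_subset_def \<psi>_def)
  also have "\<dots> = S f \<pi>"
  proof (rule current_cong_carrier[OF cur C_borel null _ f _ \<pi>])
    have F\<psi>: "lipschitz_bound (submetric E C) (lip_const E f) (F \<circ> \<psi>)"
      by (rule lipschitz_bound_pullback[OF \<psi> F(1)])
    have "bounded ((F \<circ> \<psi>) ` C)" using F(3) by (auto simp: bounded_iff)
    then show "lip_extension E C (F \<circ> \<psi>) \<in> bounded_lip_functions E" by (rule lip_extension_spec(3)[OF CE F\<psi>])
    show "lip_extension E C (F \<circ> \<psi>) x = f x" if "x \<in> C" for x
      using lip_extension_spec(2)[OF CE F\<psi> that] F(2)[OF that] by simp
    have len: "length \<sigma> = m" using \<sigma>(1) by (simp add: form_tuples_def)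
    have \<sigma>\<psi>: "lipschitz_bound (submetric E C) (lip_const Z (\<sigma> ! i)) (\<sigma> ! i \<circ> \<psi>)" if "i < m" for i
      by (rule lipschitz_bound_pullback[OF \<psi> lip_const_bound[OF form_tuples_nth[OF \<sigma>(1) that]]])
    show "map (lip_extension E C) (map (\<lambda>p. p \<circ> \<psi>) \<sigma>) \<in> form_tuples m E"
      using lip_extension_spec(1)[OF CE \<sigma>\<psi>] len by (auto simp: form_tuples_def in_set_conv_nth)
    show "(map (lip_extension E C) (map (\<lambda>p. p \<circ> \<psi>) \<sigma>) ! i) x = (\<pi> ! i) x" if "x \<in> C" "i < m" for x i
      using lip_extension_spec(2)[OF CE \<sigma>\<psi>[OF that(2)] that(1)] \<sigma>(3)[OF that] len that(2) by simp
  qed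
  finally have "sp_push ?N Z \<phi> F \<sigma> = S f \<pi>" .
  moreover have "sp_push (zero_space :: 'b current_space) Z \<phi>0 F \<sigma> = 0"
    by (simp add: sp_push_def push_forward_def zero_space_def)
  ultimately show ?thesis using est by simp
qed

section \<open>Points of the limit boundary are limits of boundary points\<close>

lemma integral_current_space_extension:
  assumes "integral_current_space n M" "mcomplete_of Z" "metric_isometric_embedding (sp_metric M) Z \<phi>"
  shows "metric_isometric_embedding (sp_compl M) Z (sp_extension M Z \<phi>)"
  using assms by (intro embedding_extension_isometric) (auto simp: integral_current_space_def)

lemma ennreal_tendsto_0_less:
  assumes "(\<lambda>j. u j) \<longlonglongrightarrow> (0 :: ennreal)" "0 < (e::real)"
  shows "\<forall>\<^sub>F j in sequentially. u j < ennreal e"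
  using order_tendstoD(2)[OF assms(1), of "ennreal e"] assms(2) by simp

text \<open>Here \<open>m\<close> is the dimension of the boundaries; \<open>S\<^sub>2\<close> is the part that vanishes in the limit.\<close>

locale flat_convergence_with_vanishing_boundary_part =
  fixes m :: nat and M :: "enat \<Rightarrow> 'a current_space" and Z :: "'z metric" and \<phi> :: "enat \<Rightarrow> 'a \<Rightarrow> 'z"
    and S\<^sub>1 S\<^sub>2 :: "nat \<Rightarrow> 'a functional"
  assumes M: "\<And>j. integral_current_space (Suc m) (M j)" and Z: "mcomplete_of Z"
    and \<phi>: "\<And>j. metric_isometric_embedding (sp_metric (M j)) Z (\<phi> j)"
    and conv: "flat_converges_in (Suc m) Z M \<phi>"
    and decomp: "\<And>j. boundary_decomposition (Suc m) (M (enat j)) (S\<^sub>1 j) (S\<^sub>2 j)"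
    and S2: "intrinsic_flat_converges m (\<lambda>j. space_of_current m (sp_compl (M (enat j))) (S\<^sub>2 j))
           (zero_space :: 'a current_space)"
begin

abbreviation "E j \<equiv> sp_compl (M j)"

definition "\<psi> j = sp_extension (M j) Z (\<phi> j)"

lemma \<psi>: "metric_isometric_embedding (E j) Z (\<psi> j)"
  unfolding \<psi>_def by (rule integral_current_space_extension[OF M Z \<phi>])

text \<open>\<open>S\<^sub>1 = \<partial>T\<^sub>j - S\<^sub>2\<close> on forms, and the two terms on the right converge to \<open>\<partial>T\<^sub>\<infinity>\<close> and \<open>0\<close>.\<close>

lemma boundary_weak_convergence:
  assumes f: "f \<in> bounded_lip_functions Z" and \<pi>: "\<pi> \<in> form_tuples m Z"
  shows "(\<lambda>j. S\<^sub>1 j (f \<circ> \<psi> (enat j)) (map (\<lambda>p. p \<circ> \<psi> (enat j)) \<pi>)) \<longlonglongrightarrow>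
    cur_boundary (sp_cur (M \<infinity>)) (f \<circ> \<psi> \<infinity>) (map (\<lambda>p. p \<circ> \<psi> \<infinity>) \<pi>)"
proof -
  define b where "b j = cur_boundary (sp_cur (M j)) (f \<circ> \<psi> j) (map (\<lambda>p. p \<circ> \<psi> j) \<pi>)" for j
  define s where "s j = S\<^sub>2 j (f \<circ> \<psi> (enat j)) (map (\<lambda>p. p \<circ> \<psi> (enat j)) \<pi>)" for j
  note f' = pullback_bounded_lip[OF \<psi> f] and \<pi>' = pullback_form_tuples[OF \<psi> \<pi>]
  obtain B where B: "0 \<le> B" "\<And>x. x \<in> mspace Z \<Longrightarrow> \<bar>f x\<bar> \<le> B" using bounded_lip_bound[OF f] by blast
  have P0: "0 \<le> lip_prod Z \<pi>" using \<pi> by (intro lip_prod_nonneg) (auto simp: form_tuples_def)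
  have L0: "0 \<le> lip_const Z f" by (rule lip_const_nonneg[OF bounded_lipD[OF f]])
  \<comment> \<open>exceeds the constants of both flat estimates\<close>
  define K where "K = lip_prod Z \<pi> * (B + lip_const Z f) + 1"
  have K: "0 < K" unfolding K_def using P0 B(1) L0 by (simp add: add_nonneg_pos)
  have b_push: "cur_boundary (sp_push (M j) Z (\<phi> j)) f \<pi> = b j" for j
    by (simp add: b_def sp_push_def push_forward_def cur_boundary_def \<psi>_def comp_def)
  have lim: "(\<lambda>j. b (enat j) - s j) \<longlonglongrightarrow> b \<infinity> - 0"
  proof (rule tendsto_diff)
    show "(\<lambda>j. b (enat j)) \<longlonglongrightarrow> b \<infinity>"
      unfolding tendsto_iff
    proof (intro allI impI)
      fix e :: real assume e: "0 < e"
      have "\<forall>\<^sub>F j in sequentially. flat_dist (Suc m) Z (sp_push (M (enat j)) Z (\<phi> (enat j)))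
          (sp_push (M \<infinity>) Z (\<phi> \<infinity>)) < ennreal (e / K)"
        using conv e K unfolding flat_converges_in_def by (intro ennreal_tendsto_0_less) auto
      then show "\<forall>\<^sub>F j in sequentially. dist (b (enat j)) (b \<infinity>) < e"
      proof eventually_elim
        case (elim j)
        have "\<bar>b (enat j) - b \<infinity>\<bar> \<le> lip_const Z f * lip_prod Z \<pi> * (e / K)"
          using flat_dist_boundary_estimate[OF elim f \<pi>] by (simp add: b_push)
        also have "\<dots> < K * (e / K)"
          using e K mult_nonneg_nonneg[OF B(1) P0]
          by (intro mult_strict_right_mono) (auto simp: K_def algebra_simps)
        also have "\<dots> = e" using K by simp
        finally show ?case by (simp add: dist_real_def)
      qed
    qed
    show "s \<longlonglongrightarrow> 0"
      unfolding tendsto_iff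
    proof (intro allI impI)
      fix e :: real assume e: "0 < e"
      have "\<forall>\<^sub>F j in sequentially. intrinsic_flat_dist m (space_of_current m (E (enat j)) (S\<^sub>2 j))
          (zero_space :: 'a current_space) < ennreal (e / K)"
        using S2 e K unfolding intrinsic_flat_converges_def by (intro ennreal_tendsto_0_less) auto
      then show "\<forall>\<^sub>F j in sequentially. dist (s j) 0 < e"
      proof eventually_elim
        case (elim j)
        let ?E = "E (enat j)"
        have complete: "mcomplete_of ?E" using M by (simp add: integral_current_space_def)
        have S: "integral_current m ?E (S\<^sub>2 j)" using decomp[of j] by (simp add: boundary_decomposition_def)
        have "\<bar>s j\<bar> \<le> lip_prod ?E (map (\<lambda>p. p \<circ> \<psi> (enat j)) \<pi>) *
            (B + lip_const ?E (f \<circ> \<psi> (enat j))) * (e / K)"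
          unfolding s_def
        proof (rule intrinsic_flat_dist_zero_estimate[OF complete S elim f' \<pi>'(1) _ B(1)])
          show "\<bar>(f \<circ> \<psi> (enat j)) x\<bar> \<le> B" if "x \<in> mspace ?E" for x
            using B(2) isometric_embeddingD(1)[OF \<psi> that] by simp
        qed
        also have "\<dots> \<le> lip_prod Z \<pi> * (B + lip_const Z f) * (e / K)"
          using e K P0 B(1) \<pi>'(2) pullback_lip[OF \<psi> bounded_lipD[OF f]] lip_const_nonneg[OF bounded_lipD[OF f']]
          by (intro mult_right_mono mult_mono add_left_mono) auto
        also have "\<dots> < K * (e / K)"
          using e K by (intro mult_strict_right_mono) (auto simp: K_def)
        also have "\<dots> = e" using K by simp
        finally show ?case by simp
      qed
    qed
  qed
  have "S\<^sub>1 j (f \<circ> \<psi> (enat j)) (map (\<lambda>p. p \<circ> \<psi> (enat j)) \<pi>) = b (enat j) - s j" for j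
    using decomp[of j] formsI[OF f'[of "enat j"] \<pi>'(1)[of "enat j"]]
    by (auto simp: boundary_decomposition_def cur_eq_def b_def s_def)
  then show ?thesis using lim by (simp add: b_def)
qed

text \<open>A form on \<open>X\<^sub>\<infinity>\<close> supported near \<open>p\<close> that \<open>\<partial>T\<^sub>\<infinity>\<close> does not annihilate is extended to \<open>Z\<close> and multiplied by
  a cutoff function around the image of \<open>p\<close>. By weak convergence \<open>S\<^sub>1\<close> does not annihilate it either
  for large \<open>j\<close>, so the carrier of \<open>S\<^sub>1\<close> meets the support of the cutoff.\<close>

lemma boundary_points_approached:
  assumes p: "p \<in> cur_set m (E \<infinity>) (cur_boundary (sp_cur (M \<infinity>)))" and e: "0 < (e::real)"
  shows "\<forall>\<^sub>F j in sequentially. \<exists>y\<in>cur_set m (E (enat j)) (S\<^sub>1 j).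
    mdist Z (\<psi> (enat j) y) (\<psi> \<infinity> p) < e"
proof -
  let ?E = "E \<infinity>" and ?T = "cur_boundary (sp_cur (M \<infinity>))"
  have pE: "p \<in> mspace ?E" using p by (simp add: cur_set_def)
  have cur: "is_current m ?E ?T"
    using M[of \<infinity>] by (simp add: integral_current_space_def integral_current_def normal_current_def)
  let ?R = "\<lambda>r. emeasure (mass_measure m ?E ?T) (mball_of ?E p r)"
  obtain r where r: "r < e / 2" "0 < ?R r"
  proof -
    have "0 < Liminf (at_right 0) (\<lambda>r. ?R r / ennreal (r ^ m))" using p by (simp add: cur_set_def)
    then have "\<forall>\<^sub>F r in at_right 0. 0 < ?R r / ennreal (r ^ m)" by (rule less_LiminfD)
    moreover have "\<forall>\<^sub>F r in at_right (0::real). r < e / 2"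
      using e unfolding eventually_at_right_field by (intro exI[of _ "e / 2"]) auto
    ultimately have "\<forall>\<^sub>F r in at_right (0::real). r < e / 2 \<and> 0 < ?R r"
      by eventually_elim (auto simp: zero_less_iff_neq_zero)
    then show ?thesis using eventually_happens'[OF trivial_limit_at_right_real] that by blast
  qed
  obtain f \<pi> where f: "f \<in> bounded_lip_functions ?E" "\<pi> \<in> form_tuples m ?E" "?T f \<pi> \<noteq> 0"
    "\<And>x. x \<in> mspace ?E \<Longrightarrow> f x \<noteq> 0 \<Longrightarrow> mdist ?E p x < e / 2"
    using mass_ball_witness[OF cur pE r] by blast
  obtain B where B: "0 \<le> B" "\<And>x. x \<in> mspace ?E \<Longrightarrow> \<bar>f x\<bar> \<le> B" using bounded_lip_bound[OF f(1)] by blast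
  obtain F where F: "lipschitz_bound Z (lip_const ?E f) F" "\<And>x. x \<in> mspace ?E \<Longrightarrow> F (\<psi> \<infinity> x) = f x"
    "\<And>z. \<bar>F z\<bar> \<le> B"
    using lipschitz_extend_along_bounded[OF \<psi> lip_const_bound[OF bounded_lipD[OF f(1)]] B] by blast
  obtain \<sigma> where \<sigma>: "\<sigma> \<in> form_tuples m Z"
    "\<And>x i. x \<in> mspace ?E \<Longrightarrow> i < m \<Longrightarrow> (\<sigma> ! i) (\<psi> \<infinity> x) = (\<pi> ! i) x"
    using form_tuples_extend_along[OF \<psi> f(2)] by metis
  define q where "q = \<psi> \<infinity> p"
  have qZ: "q \<in> mspace Z" unfolding q_def by (rule isometric_embeddingD(1)[OF \<psi> pE])
  have "e / 2 < e" using e by simp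
  then obtain \<theta> where \<theta>: "\<theta> \<in> bounded_lip_functions Z" "\<And>z. mdist Z q z < e / 2 \<Longrightarrow> \<theta> z = 1"
    "\<And>z. \<theta> z \<noteq> 0 \<Longrightarrow> mdist Z q z < e" using ball_cutoff[OF qZ] by metis
  define G where "G z = F z * \<theta> z" for z
  have "F \<in> bounded_lip_functions Z" using F lip_functionsI bounded_lipI by metis
  then have G: "G \<in> bounded_lip_functions Z" unfolding G_def[abs_def] using \<theta>(1) by (rule bounded_lip_mult)
  have G\<psi>: "(G \<circ> \<psi> \<infinity>) x = f x" if x: "x \<in> mspace ?E" for x
  proof (cases "f x = 0")
    case False
    have "mdist Z q (\<psi> \<infinity> x) = mdist ?E p x"
      unfolding q_def by (rule isometric_embeddingD(2)[OF \<psi> pE x])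
    then have "mdist Z q (\<psi> \<infinity> x) < e / 2" using f(4)[OF x False] by simp
    then show ?thesis using F(2)[OF x] by (simp add: G_def \<theta>(2))
  qed (use F(2)[OF x] in \<open>simp add: G_def\<close>)
  have sets_E: "mspace ?E \<in> sets (metric_borel ?E)" using sets.top[of "metric_borel ?E"] by simp
  have "?T (G \<circ> \<psi> \<infinity>) (map (\<lambda>p. p \<circ> \<psi> \<infinity>) \<sigma>) = ?T f \<pi>"
  proof (rule current_cong_carrier[OF cur sets_E _ pullback_bounded_lip[OF \<psi> G] f(1)
        pullback_form_tuples(1)[OF \<psi> \<sigma>(1)] f(2)])
    have "length \<sigma> = m" using \<sigma>(1) by (simp add: form_tuples_def)
    then show "(map (\<lambda>p. p \<circ> \<psi> \<infinity>) \<sigma> ! i) x = (\<pi> ! i) x" if "x \<in> mspace ?E" "i < m" for x i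
      using \<sigma>(2)[OF that] that by simp
  qed (use G\<psi> in auto)
  then have "(\<lambda>j. S\<^sub>1 j (G \<circ> \<psi> (enat j)) (map (\<lambda>p. p \<circ> \<psi> (enat j)) \<sigma>)) \<longlonglongrightarrow> ?T f \<pi>"
    using boundary_weak_convergence[OF G \<sigma>(1)] by simp
  then have "\<forall>\<^sub>F j in sequentially. S\<^sub>1 j (G \<circ> \<psi> (enat j)) (map (\<lambda>p. p \<circ> \<psi> (enat j)) \<sigma>) \<noteq> 0"
    using f(3) by (rule tendsto_imp_eventually_ne)
  then show ?thesis
  proof eventually_elim
    case (elim j)
    let ?Ej = "E (enat j)" and ?\<psi> = "\<psi> (enat j)"
    let ?C = "mtopology_of ?Ej closure_of cur_set m ?Ej (S\<^sub>1 j)"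
    have complete: "mcomplete_of ?Ej" using M by (simp add: integral_current_space_def)
    have S: "is_current m ?Ej (S\<^sub>1 j)" "rectifiable_current m ?Ej (S\<^sub>1 j)"
      using decomp[of j] by (auto simp: boundary_decomposition_def integral_current_def
          integer_rectifiable_current_def rectifiable_current_def)
    have C: "?C \<in> sets (metric_borel ?Ej)" by (intro closedin_sets_borel closedin_closure_of)
    note \<pi>' = pullback_form_tuples(1)[OF \<psi>[of "enat j"] \<sigma>(1)]
    have lin: "multilinear_functional m ?Ej (S\<^sub>1 j)" using S(1) by (simp add: is_current_def)
    have zero: "S\<^sub>1 j (\<lambda>_. 0) (map (\<lambda>p. p \<circ> ?\<psi>) \<sigma>) = 0"
      using functional_add[OF lin bounded_lip_const bounded_lip_const \<pi>', of "\<lambda>_. 0" 0 0] by simp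
    have "\<exists>c\<in>?C. G (?\<psi> c) \<noteq> 0"
    proof (rule ccontr)
      assume neg: "\<not> ?thesis"
      have "S\<^sub>1 j (G \<circ> ?\<psi>) (map (\<lambda>p. p \<circ> ?\<psi>) \<sigma>) =
          S\<^sub>1 j (\<lambda>_. 0) (map (\<lambda>p. p \<circ> ?\<psi>) \<sigma>)"
        by (rule current_cong_first[OF S(1) C rectifiable_mass_carried_by_set[OF complete S(2)]
              pullback_bounded_lip[OF \<psi> G] bounded_lip_const \<pi>']) (use neg in auto)
      then show False using elim zero by simp
    qed
    then obtain c where c: "c \<in> ?C" "G (?\<psi> c) \<noteq> 0" by blast
    have cE: "c \<in> mspace ?Ej" using c(1) by (simp add: in_closure_of_iff)
    have cZ: "?\<psi> c \<in> mspace Z" by (rule isometric_embeddingD(1)[OF \<psi> cE])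
    have "mdist Z q (?\<psi> c) < e" using c(2) by (intro \<theta>(3)) (simp add: G_def)
    then have "0 < e - mdist Z q (?\<psi> c)" by simp
    then obtain y where y: "y \<in> cur_set m ?Ej (S\<^sub>1 j)" "y \<in> mspace ?Ej" "mdist ?Ej c y < e - mdist Z q (?\<psi> c)"
      using c(1) unfolding in_closure_of_iff by blast
    have "mdist Z (?\<psi> y) q \<le> mdist Z (?\<psi> y) (?\<psi> c) + mdist Z (?\<psi> c) q"
      using isometric_embeddingD(1)[OF \<psi> y(2)] cZ qZ by (intro mdist_triangle)
    also have "mdist Z (?\<psi> y) (?\<psi> c) = mdist ?Ej c y"
      using isometric_embeddingD(2)[OF \<psi> y(2) cE] by (simp add: mdist_commute)
    finally have "mdist Z (?\<psi> y) q < e" using y(3) by (simp add: mdist_commute)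
    then show ?case using y(1) unfolding q_def by blast
  qed
qed

end

section \<open>Almost isometries into a compact set are almost onto\<close>

text \<open>Pigeonhole: \<open>card K + 1\<close> points are assigned to the \<open>card K\<close> points of a net.\<close>

lemma totally_bounded_separated_bound:
  assumes K: "finite K" "\<And>p. p \<in> A \<Longrightarrow> \<exists>q\<in>K. mdist Z p q < r" and AZ: "A \<subseteq> mspace Z" "K \<subseteq> mspace Z"
    and s: "\<And>i. i \<le> card K \<Longrightarrow> s i \<in> A"
  obtains i l where "i < l" "l \<le> card K" "mdist Z (s i) (s l) < 2 * r"
proof -
  obtain c where c: "\<And>i. i \<le> card K \<Longrightarrow> c i \<in> K" "\<And>i. i \<le> card K \<Longrightarrow> mdist Z (s i) (c i) < r"
    using K(2)[OF s] by metis
  have "card (c ` {..card K}) \<le> card K" using c(1) by (intro card_mono K(1)) auto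
  then have "\<not> inj_on c {..card K}" using card_image by fastforce
  then obtain i l where il: "i \<le> card K" "l \<le> card K" "i \<noteq> l" "c i = c l" by (auto simp: inj_on_def)
  have close: "mdist Z (s i) (s l) < 2 * r" if "i \<le> card K" "l \<le> card K" "c i = c l" for i l
  proof -
    have "mdist Z (s i) (s l) \<le> mdist Z (s i) (c i) + mdist Z (c i) (s l)"
      using s[OF that(1)] s[OF that(2)] c(1)[OF that(1)] AZ by (intro mdist_triangle) auto
    then show ?thesis using c(2)[OF that(1)] c(2)[OF that(2)] that(3) by (simp add: mdist_commute)
  qed
  show ?thesis
  proof (cases "i < l")
    case True then show ?thesis using that close il by blast
  next
    case False
    then have "l < i" using il(3) by simp
    then show ?thesis using that close[of l i] il by metis
  qed
qed

text \<open>If some \<open>y \<in> A\<close> stayed away from \<open>K\<close>, then iterating the almost isometry \<open>g \<circ> h\<close> of \<open>K\<close>, with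
  \<open>h\<close> a nearest-point map from \<open>K\<close> to \<open>A\<close>, on \<open>g y\<close> would yield more separated points than the totally
  bounded set \<open>K\<close> can hold. Each iteration loses at most \<open>3 \<delta>\<close>, so \<open>\<delta>\<close> is chosen such that a
  separation of \<open>e/4\<close> survives \<open>card Q\<close> of them.\<close>

lemma almost_isometry_almost_onto:
  assumes Q: "finite Q" "\<And>p. p \<in> K \<Longrightarrow> \<exists>q\<in>Q. mdist Z p q < e / 8" "Q \<subseteq> mspace Z"
    and KZ: "K \<subseteq> mspace Z" and AZ: "A \<subseteq> mspace Z" and e: "0 < e"
    and \<delta>: "\<delta> = e / (16 * (real (card Q) + 1))"
    and h: "\<And>p. p \<in> K \<Longrightarrow> \<exists>y\<in>A. mdist Z y p < \<delta>"
    and g: "\<And>x. x \<in> A \<Longrightarrow> g x \<in> K" "\<And>x y. x \<in> A \<Longrightarrow> y \<in> A \<Longrightarrow> mdist Z x y - \<delta> \<le> mdist Z (g x) (g y)"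
    and y: "y \<in> A"
  shows "\<exists>p\<in>K. mdist Z y p < e"
proof (rule ccontr)
  assume "\<not> ?thesis"
  then have far: "e \<le> mdist Z y p" if "p \<in> K" for p using that by force
  obtain h where h: "\<And>p. p \<in> K \<Longrightarrow> h p \<in> A" "\<And>p. p \<in> K \<Longrightarrow> mdist Z (h p) p < \<delta>" using h by metis
  define t where "t = g \<circ> h"
  have tK: "t p \<in> K" if "p \<in> K" for p using h g that by (simp add: t_def)
  have hZ: "h p \<in> mspace Z" if "p \<in> K" for p using h(1)[OF that] AZ by auto
  have t: "mdist Z p q - 3 * \<delta> \<le> mdist Z (t p) (t q)" if "p \<in> K" "q \<in> K" for p q
  proof -
    have "mdist Z p q \<le> mdist Z p (h p) + mdist Z (h p) q" using that KZ hZ by (intro mdist_triangle) auto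
    moreover have "mdist Z (h p) q \<le> mdist Z (h p) (h q) + mdist Z (h q) q"
      using that KZ hZ by (intro mdist_triangle) auto
    ultimately show ?thesis
      using h(2)[OF that(1)] h(2)[OF that(2)] g(2)[OF h(1)[OF that(1)] h(1)[OF that(2)]]
      by (simp add: t_def mdist_commute[of Z p "h p"])
  qed
  define s where "s i = (t ^^ i) (g y)" for i
  have sK: "s i \<in> K" for i by (induction i) (simp_all add: s_def g(1) y tK)
  have iter: "mdist Z (s 0) (s l) - 3 * \<delta> * real i \<le> mdist Z (s i) (s (i + l))" for i l
  proof (induction i)
    case (Suc i)
    have "mdist Z (s i) (s (i + l)) - 3 * \<delta> \<le> mdist Z (s (Suc i)) (s (Suc i + l))"
      using t[OF sK sK, of i "i + l"] by (simp add: s_def)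
    then show ?case using Suc by (simp add: algebra_simps)
  qed simp
  have start: "e - 2 * \<delta> \<le> mdist Z (s 0) (s (Suc l))" for l
  proof -
    have "e \<le> mdist Z y (s l)" using far sK by simp
    also have "\<dots> \<le> mdist Z y (h (s l)) + mdist Z (h (s l)) (s l)"
      using y AZ hZ[OF sK] sK[of l] KZ by (intro mdist_triangle) auto
    also have "\<dots> \<le> mdist Z y (h (s l)) + \<delta>" using h(2)[OF sK[of l]] by simp
    also have "mdist Z y (h (s l)) \<le> mdist Z (g y) (g (h (s l))) + \<delta>"
      using g(2)[OF y h(1)[OF sK[of l]]] by simp
    finally show ?thesis by (simp add: s_def t_def)
  qed
  obtain i l where il: "i < l" "l \<le> card Q" "mdist Z (s i) (s l) < 2 * (e / 8)"
    by (rule totally_bounded_separated_bound[where s = s, OF Q(1) Q(2) KZ Q(3) sK])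
      (assumption, rule that)
  obtain l' where l': "l = i + Suc l'" using il(1) less_iff_Suc_add by auto
  have \<delta>0: "0 < \<delta>" using e by (simp add: \<delta>)
  have "e - 2 * \<delta> - 3 * \<delta> * real i \<le> mdist Z (s i) (s l)"
    using iter[where l = "Suc l'" and i = i] start[of l'] by (simp add: l')
  moreover have "2 * \<delta> + 3 * \<delta> * real i \<le> 3 * \<delta> * (real (card Q) + 1)"
  proof -
    have "3 * \<delta> * real i \<le> 3 * \<delta> * real (card Q)" using il \<delta>0 by (intro mult_left_mono) auto
    moreover have "3 * \<delta> * (real (card Q) + 1) = 3 * \<delta> * real (card Q) + 3 * \<delta>"
      by (simp only: distrib_left mult_1_right)
    ultimately show ?thesis using \<delta>0 by linarith
  qed
  moreover have "3 * \<delta> * (real (card Q) + 1) = 3 * e / 16" by (simp add: \<delta> field_simps)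
  ultimately show False using il(3) e by simp
qed

text \<open>\<open>g\<close> sends a point to a nearby point of \<open>Y\<close> in a common ambient space.\<close>

lemma gh_dist_less_almost_isometry:
  assumes "gh_dist X Y < ennreal \<delta>"
  obtains g where "\<And>x. x \<in> mspace X \<Longrightarrow> g x \<in> mspace Y"
    "\<And>x x'. x \<in> mspace X \<Longrightarrow> x' \<in> mspace X \<Longrightarrow> mdist X x x' - 2 * \<delta> \<le> mdist Y (g x) (g x')"
proof -
  obtain Z :: "('a + 'b) metric" and \<phi> \<psi> where \<phi>: "metric_isometric_embedding X Z \<phi>"
    and \<psi>: "metric_isometric_embedding Y Z \<psi>"
    and less: "hausdorff_dist Z (\<phi> ` mspace X) (\<psi> ` mspace Y) < ennreal \<delta>"
    using assms unfolding gh_dist_def INF_less_iff by auto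
  have "\<exists>y\<in>mspace Y. mdist Z (\<phi> x) (\<psi> y) < \<delta>" if "x \<in> mspace X" for x
  proof -
    have "dist_to_set Z (\<phi> x) (\<psi> ` mspace Y) \<le> (SUP a\<in>\<phi> ` mspace X. dist_to_set Z a (\<psi> ` mspace Y))"
      using that by (intro SUP_upper) auto
    also have "\<dots> < ennreal \<delta>" using less by (simp add: hausdorff_dist_def)
    finally obtain y where "y \<in> mspace Y" "ennreal (mdist Z (\<phi> x) (\<psi> y)) < ennreal \<delta>"
      by (auto simp: dist_to_set_def INF_less_iff)
    then show ?thesis by (auto simp: ennreal_less_iff)
  qed
  then obtain g where g: "\<And>x. x \<in> mspace X \<Longrightarrow> g x \<in> mspace Y"
    "\<And>x. x \<in> mspace X \<Longrightarrow> mdist Z (\<phi> x) (\<psi> (g x)) < \<delta>" by metis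
  have "mdist X x x' - 2 * \<delta> \<le> mdist Y (g x) (g x')" if xx: "x \<in> mspace X" "x' \<in> mspace X" for x x'
  proof -
    note m = isometric_embeddingD(1)[OF \<phi> xx(1)] isometric_embeddingD(1)[OF \<phi> xx(2)]
      isometric_embeddingD(1)[OF \<psi> g(1)[OF xx(1)]] isometric_embeddingD(1)[OF \<psi> g(1)[OF xx(2)]]
    have "mdist Z (\<phi> x) (\<phi> x') \<le> mdist Z (\<phi> x) (\<psi> (g x)) + mdist Z (\<psi> (g x)) (\<phi> x')"
      using m by (intro mdist_triangle)
    moreover have "mdist Z (\<psi> (g x)) (\<phi> x') \<le> mdist Z (\<psi> (g x)) (\<psi> (g x')) + mdist Z (\<psi> (g x')) (\<phi> x')"
      using m by (intro mdist_triangle)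
    ultimately show ?thesis
      using g(2)[OF xx(1)] g(2)[OF xx(2)] isometric_embeddingD(2)[OF \<phi> xx]
        isometric_embeddingD(2)[OF \<psi> g(1)[OF xx(1)] g(1)[OF xx(2)]]
      by (simp add: mdist_commute[of Z "\<psi> (g x')"])
  qed
  then show ?thesis using that g(1) by blast
qed

lemma hausdorff_dist_le:
  assumes "\<And>a. a \<in> A \<Longrightarrow> \<exists>b\<in>B. mdist Z a b < e" "\<And>b. b \<in> B \<Longrightarrow> \<exists>a\<in>A. mdist Z b a < e"
  shows "hausdorff_dist Z A B \<le> ennreal e"
proof -
  have "dist_to_set Z a B \<le> ennreal e" if ex: "\<exists>b\<in>B. mdist Z a b < e" for a B
  proof -
    obtain b where "b \<in> B" "mdist Z a b < e" using ex by blast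
    then show ?thesis unfolding dist_to_set_def by (intro INF_lower2[of b] ennreal_leI) auto
  qed
  then show ?thesis unfolding hausdorff_dist_def using assms by (auto intro!: SUP_least)
qed

lemma compact_finite_net:
  assumes "compactin (mtopology_of E) K" "0 < e"
  obtains Q where "finite Q" "Q \<subseteq> K" "\<And>p. p \<in> K \<Longrightarrow> \<exists>q\<in>Q. mdist E p q < e"
proof -
  interpret Metric_space "mspace E" "mdist E" by simp
  have "mtotally_bounded K" using assms(1) by (intro compactin_imp_mtotally_bounded) (simp add: mtopology_of_def)
  then obtain Q where Q: "finite Q" "Q \<subseteq> K" "K \<subseteq> (\<Union>x\<in>Q. mball x e)"
    using assms(2) unfolding mtotally_bounded_def by (elim allE impE exE conjE) (assumption, rule that)
  have "\<exists>q\<in>Q. mdist E p q < e" if p: "p \<in> K" for p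
  proof -
    obtain q where "q \<in> Q" "p \<in> mball q e"
      using p Q(3) by blast
    then show ?thesis by (intro bexI[of _ q]) (simp_all add: mdist_commute[of E p])
  qed
  then show ?thesis by (rule that[OF Q(1,2)])
qed

lemma ennreal_tendsto_0I:
  assumes "\<And>e::real. 0 < e \<Longrightarrow> \<forall>\<^sub>F j in sequentially. u j \<le> ennreal e"
  shows "(\<lambda>j. u j) \<longlonglongrightarrow> (0::ennreal)"
proof (rule order_tendstoI)
  fix a :: ennreal assume "0 < a"
  then obtain b where b: "0 < b" "b < a" using dense by blast
  then obtain e where e: "b = ennreal e" "0 < e" by (cases b) auto
  show "\<forall>\<^sub>F j in sequentially. u j < a"
    using assms[OF e(2)] by eventually_elim (use b e in auto)
qed simp

lemma limitin_mdist_eventually: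
  assumes "limitin (mtopology_of Z) u l F" "0 < e"
  shows "\<forall>\<^sub>F j in F. mdist Z (u j) l < e"
proof -
  have "\<forall>\<epsilon>>0. \<forall>\<^sub>F j in F. u j \<in> mspace Z \<and> mdist Z (u j) l < \<epsilon>"
    using assms(1) by (simp add: mtopology_of_def Metric_space.limitin_metric[OF Metric_space_mspace_mdist])
  then have "\<forall>\<^sub>F j in F. u j \<in> mspace Z \<and> mdist Z (u j) l < e" using assms(2) by blast
  then show ?thesis by (rule eventually_mono) simp
qed

theorem theorem2p11:
  fixes n :: nat
    and M :: "enat \<Rightarrow> 'a current_space"
    and Z :: "'z metric"
    and \<phi> :: "enat \<Rightarrow> 'a \<Rightarrow> 'z"
    and S\<^sub>1 S\<^sub>2 :: "nat \<Rightarrow> 'a functional"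
    and \<Sigma> :: "enat \<Rightarrow> 'a set"
  assumes "n \<ge> 1"
    and "\<And>j. integral_current_space n (M j)"
    and "mcomplete_of Z" and "separable_space (mtopology_of Z)"
    and "\<And>j. metric_isometric_embedding (sp_metric (M j)) Z (\<phi> j)"
    and "flat_converges_in n Z M \<phi>"
    and "\<And>j. boundary_decomposition n (M (enat j)) (S\<^sub>1 j) (S\<^sub>2 j)"
    and "intrinsic_flat_converges (n - 1)
           (\<lambda>j. space_of_current (n - 1) (sp_compl (M (enat j))) (S\<^sub>2 j))
           (zero_space :: 'a current_space)"
    and "\<And>j. \<Sigma> (enat j) = sp_set (space_of_current (n - 1) (sp_compl (M (enat j))) (S\<^sub>1 j))"
    and "\<Sigma> \<infinity> = sp_set (space_boundary n (M \<infinity>))"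
  shows "(\<forall>x. (\<forall>j. x (enat j) \<in> sp_set (M (enat j))) \<and> x \<infinity> \<in> mspace (sp_compl (M \<infinity>)) \<and>
              pointed_flat_converges_in n Z M \<phi> x \<longrightarrow>
            dist_to_set (sp_compl (M \<infinity>)) (x \<infinity>) (\<Sigma> \<infinity>) \<ge>
            limsup (\<lambda>j. dist_to_set (sp_compl (M (enat j))) (x (enat j)) (\<Sigma> (enat j))))
       \<and> ((\<forall>j. compactin (mtopology_of (sp_compl (M j))) (\<Sigma> j)) \<and>
          (\<lambda>j. gh_dist (submetric (sp_compl (M (enat j))) (\<Sigma> (enat j)))
                       (submetric (sp_compl (M \<infinity>)) (\<Sigma> \<infinity>))) \<longlonglongrightarrow> 0 \<longrightarrow>
          (\<lambda>j. hausdorff_dist Z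
                 (sp_extension (M (enat j)) Z (\<phi> (enat j)) ` \<Sigma> (enat j))
                 (sp_extension (M \<infinity>) Z (\<phi> \<infinity>) ` \<Sigma> \<infinity>)) \<longlonglongrightarrow> 0)"
proof -
  obtain m where n: "n = Suc m" using assms(1) by (cases n) auto
  note asm = assms(2-10)[unfolded n diff_Suc_1]
  interpret flat_convergence_with_vanishing_boundary_part m M Z \<phi> S\<^sub>1 S\<^sub>2
    by standard (rule asm)+
  let ?E = "\<lambda>j. sp_compl (M (enat j))" and ?Y = "sp_compl (M \<infinity>)" and ?\<psi> = "\<lambda>j. \<psi> (enat j)"
    and ?\<Sigma> = "\<lambda>j. \<Sigma> (enat j)"
  note iso = isometric_embeddingD[OF \<psi>]
  have \<Sigma>: "?\<Sigma> j = cur_set m (?E j) (S\<^sub>1 j)" for j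
    using asm(8) by (simp add: space_of_current_def Let_def)
  have \<Sigma>_inf: "\<Sigma> \<infinity> = cur_set m ?Y (cur_boundary (sp_cur (M \<infinity>)))"
    using asm(9) by (simp add: space_boundary_def space_of_current_def Let_def)
  have \<Sigma>E: "?\<Sigma> j \<subseteq> mspace (?E j)" "\<Sigma> \<infinity> \<subseteq> mspace ?Y" for j
    unfolding \<Sigma> \<Sigma>_inf by (auto simp: cur_set_def)
  have approach: "\<forall>\<^sub>F j in sequentially. \<exists>y\<in>?\<Sigma> j. mdist Z (?\<psi> j y) (\<psi> \<infinity> p) < e"
    if "p \<in> \<Sigma> \<infinity>" "0 < e" for p e
    using boundary_points_approached[OF that(1)[unfolded \<Sigma>_inf] that(2)] unfolding \<Sigma> .
  show ?thesis
  proof (intro conjI allI impI; (elim conjE)?)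
    fix x assume x: "\<forall>j. x (enat j) \<in> sp_set (M (enat j))" "x \<infinity> \<in> mspace ?Y"
      and conv: "pointed_flat_converges_in n Z M \<phi> x"
    have xE: "x (enat j) \<in> mspace (?E j)" for j
      using x(1) asm(1)[of "enat j"] by (auto simp: integral_current_space_def)
    show "limsup (\<lambda>j. dist_to_set (?E j) (x (enat j)) (?\<Sigma> j)) \<le>
        dist_to_set ?Y (x \<infinity>) (\<Sigma> \<infinity>)"
      unfolding dist_to_set_def[of "?Y"]
    proof (rule INF_greatest)
      fix p assume p: "p \<in> \<Sigma> \<infinity>"
      then have pE: "p \<in> mspace ?Y" using \<Sigma>E(2) by auto
      show "limsup (\<lambda>j. dist_to_set (?E j) (x (enat j)) (?\<Sigma> j)) \<le>
          ennreal (mdist ?Y (x \<infinity>) p)"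
      proof (rule ennreal_le_epsilon)
        fix e :: real assume e: "0 < e"
        have "limitin (mtopology_of Z) (\<lambda>j. ?\<psi> j (x (enat j))) (\<psi> \<infinity> (x \<infinity>)) sequentially"
          using conv by (simp add: pointed_flat_converges_in_def \<psi>_def)
        then have "\<forall>\<^sub>F j in sequentially. mdist Z (?\<psi> j (x (enat j))) (\<psi> \<infinity> (x \<infinity>)) < e / 2"
          using e by (intro limitin_mdist_eventually) auto
        moreover have "\<forall>\<^sub>F j in sequentially. \<exists>y\<in>?\<Sigma> j. mdist Z (?\<psi> j y) (\<psi> \<infinity> p) < e / 2"
          using e by (intro approach[OF p]) simp
        ultimately have "\<forall>\<^sub>F j in sequentially. dist_to_set (?E j) (x (enat j)) (?\<Sigma> j) \<le>
            ennreal (mdist ?Y (x \<infinity>) p + e)"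
        proof eventually_elim
          case (elim j)
          then obtain y where y: "y \<in> ?\<Sigma> j" "mdist Z (?\<psi> j y) (\<psi> \<infinity> p) < e / 2" by blast
          then have yE: "y \<in> mspace (?E j)" using \<Sigma>E(1) by auto
          note z = iso(1)[OF xE] iso(1)[OF yE] iso(1)[OF x(2)] iso(1)[OF pE]
          have "mdist (?E j) (x (enat j)) y = mdist Z (?\<psi> j (x (enat j))) (?\<psi> j y)"
            using iso(2)[OF xE yE] by simp
          also have "\<dots> \<le> mdist Z (?\<psi> j (x (enat j))) (\<psi> \<infinity> (x \<infinity>)) + mdist Z (\<psi> \<infinity> (x \<infinity>)) (?\<psi> j y)"
            by (rule mdist_triangle[OF z(1,3,2)])
          also have "mdist Z (\<psi> \<infinity> (x \<infinity>)) (?\<psi> j y) \<le> mdist Z (\<psi> \<infinity> (x \<infinity>)) (\<psi> \<infinity> p) + mdist Z (\<psi> \<infinity> p) (?\<psi> j y)"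
            by (rule mdist_triangle[OF z(3,4,2)])
          finally have "mdist (?E j) (x (enat j)) y \<le> mdist ?Y (x \<infinity>) p + e"
            using elim(1) y(2) iso(2)[OF x(2) pE] by (simp add: mdist_commute[of Z "\<psi> \<infinity> p"])
          then show ?case
            unfolding dist_to_set_def by (intro INF_lower2[OF y(1)] ennreal_leI)
        qed
        then have "limsup (\<lambda>j. dist_to_set (?E j) (x (enat j)) (?\<Sigma> j)) \<le>
            ennreal (mdist ?Y (x \<infinity>) p + e)" by (rule Limsup_bounded)
        then show "limsup (\<lambda>j. dist_to_set (?E j) (x (enat j)) (?\<Sigma> j)) \<le>
            ennreal (mdist ?Y (x \<infinity>) p) + ennreal e" using e by simp
      qed
    qed
  next
    assume compact: "\<forall>j. compactin (mtopology_of (sp_compl (M j))) (\<Sigma> j)"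
      and gh: "(\<lambda>j. gh_dist (submetric (?E j) (?\<Sigma> j))
                       (submetric ?Y (\<Sigma> \<infinity>))) \<longlonglongrightarrow> 0"
    have net: "\<exists>Q. finite Q \<and> Q \<subseteq> \<Sigma> \<infinity> \<and> (\<forall>p\<in>\<Sigma> \<infinity>. \<exists>q\<in>Q. mdist ?Y p q < r)"
      if "0 < r" for r
      using compact_finite_net[OF compact[rule_format, of \<infinity>] that] by metis
    have uniform: "\<forall>\<^sub>F j in sequentially. \<forall>p\<in>\<Sigma> \<infinity>. \<exists>y\<in>?\<Sigma> j. mdist Z (?\<psi> j y) (\<psi> \<infinity> p) < r"
      if r: "0 < r" for r
    proof -
      obtain Q where Q: "finite Q" "Q \<subseteq> \<Sigma> \<infinity>" "\<forall>p\<in>\<Sigma> \<infinity>. \<exists>q\<in>Q. mdist ?Y p q < r / 2"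
        using net[of "r / 2"] r by auto
      have "\<forall>\<^sub>F j in sequentially. \<forall>q\<in>Q. \<exists>y\<in>?\<Sigma> j. mdist Z (?\<psi> j y) (\<psi> \<infinity> q) < r / 2"
        using r Q(2) by (intro eventually_ball_finite Q(1) ballI approach) auto
      then show ?thesis
      proof eventually_elim
        case (elim j)
        show ?case
        proof
          fix p assume p: "p \<in> \<Sigma> \<infinity>"
          then obtain q where q: "q \<in> Q" "mdist ?Y p q < r / 2" using Q(3) by blast
          then obtain y where y: "y \<in> ?\<Sigma> j" "mdist Z (?\<psi> j y) (\<psi> \<infinity> q) < r / 2" using elim by blast
          have E: "p \<in> mspace ?Y" "q \<in> mspace ?Y" "y \<in> mspace (?E j)"
            using p q y Q(2) \<Sigma>E by auto
          have "mdist Z (?\<psi> j y) (\<psi> \<infinity> p) \<le> mdist Z (?\<psi> j y) (\<psi> \<infinity> q) + mdist Z (\<psi> \<infinity> q) (\<psi> \<infinity> p)"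
            by (rule mdist_triangle[OF iso(1)[OF E(3)] iso(1)[OF E(2)] iso(1)[OF E(1)]])
          also have "mdist Z (\<psi> \<infinity> q) (\<psi> \<infinity> p) = mdist ?Y p q"
            using iso(2)[OF E(2,1)] by (simp add: mdist_commute)
          finally show "\<exists>y\<in>?\<Sigma> j. mdist Z (?\<psi> j y) (\<psi> \<infinity> p) < r" using y q by force
        qed
      qed
    qed
    have "(\<lambda>j. hausdorff_dist Z (?\<psi> j ` ?\<Sigma> j) (\<psi> \<infinity> ` \<Sigma> \<infinity>)) \<longlonglongrightarrow> 0"
    proof (rule ennreal_tendsto_0I)
      fix e :: real assume e: "0 < e"
      obtain Q0 where Q0: "finite Q0" "Q0 \<subseteq> \<Sigma> \<infinity>" "\<forall>p\<in>\<Sigma> \<infinity>. \<exists>q\<in>Q0. mdist ?Y p q < e / 8"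
        using net[of "e / 8"] e by auto
      let ?K = "\<psi> \<infinity> ` \<Sigma> \<infinity>"
      define Q where "Q = \<psi> \<infinity> ` Q0"
      have KZ: "?K \<subseteq> mspace Z" using iso(1) \<Sigma>E(2) by blast
      have Q: "finite Q" "\<And>p. p \<in> ?K \<Longrightarrow> \<exists>q\<in>Q. mdist Z p q < e / 8" "Q \<subseteq> mspace Z"
      proof -
        show "finite Q" using Q0(1) by (simp add: Q_def)
        show "Q \<subseteq> mspace Z" using Q0(2) KZ by (auto simp: Q_def)
        fix p assume "p \<in> ?K"
        then obtain p0 where p0: "p0 \<in> \<Sigma> \<infinity>" "p = \<psi> \<infinity> p0" by blast
        then obtain q where q: "q \<in> Q0" "mdist ?Y p0 q < e / 8" using Q0(3) by blast
        have "p0 \<in> mspace ?Y" "q \<in> mspace ?Y"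
          using p0(1) q(1) Q0(2) \<Sigma>E(2) by blast+
        then have "mdist Z p (\<psi> \<infinity> q) < e / 8" using iso(2)[of p0 \<infinity> q] p0(2) q(2) by simp
        then show "\<exists>q\<in>Q. mdist Z p q < e / 8" using q by (auto simp: Q_def)
      qed
      define \<delta> where "\<delta> = e / (16 * (real (card Q) + 1))"
      have \<delta>: "0 < \<delta>" using e by (simp add: \<delta>_def)
      have "\<forall>\<^sub>F j in sequentially. gh_dist (submetric (?E j) (?\<Sigma> j))
          (submetric ?Y (\<Sigma> \<infinity>)) < ennreal (\<delta> / 2)"
        using gh \<delta> by (intro ennreal_tendsto_0_less) auto
      moreover note uniform[OF \<delta>] uniform[OF e]
      ultimately show "\<forall>\<^sub>F j in sequentially. hausdorff_dist Z (?\<psi> j ` ?\<Sigma> j) ?K \<le> ennreal e"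
      proof eventually_elim
        case (elim j)
        let ?X = "?E j" and ?A = "?\<psi> j ` ?\<Sigma> j"
        have sp: "mspace (submetric ?X (?\<Sigma> j)) = ?\<Sigma> j" "mspace (submetric ?Y (\<Sigma> \<infinity>)) = \<Sigma> \<infinity>"
          using \<Sigma>E by auto
        obtain g where g: "\<And>x. x \<in> ?\<Sigma> j \<Longrightarrow> g x \<in> \<Sigma> \<infinity>"
          "\<And>x x'. x \<in> ?\<Sigma> j \<Longrightarrow> x' \<in> ?\<Sigma> j \<Longrightarrow> mdist ?X x x' - 2 * (\<delta> / 2) \<le> mdist ?Y (g x) (g x')"
          using gh_dist_less_almost_isometry[OF elim(1)] unfolding sp mdist_submetric by blast
        \<comment> \<open>a section of \<open>\<psi> (enat j)\<close>, used to carry \<open>g\<close> over to the images in \<open>Z\<close>\<close>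
        define c where "c = (\<lambda>a. SOME x. x \<in> ?\<Sigma> j \<and> ?\<psi> j x = a)"
        have c: "c a \<in> ?\<Sigma> j" "?\<psi> j (c a) = a" if "a \<in> ?A" for a
          using someI_ex[of "\<lambda>x. x \<in> ?\<Sigma> j \<and> ?\<psi> j x = a"] that unfolding c_def by auto
        have AZ: "?A \<subseteq> mspace Z" using iso(1) \<Sigma>E(1) by blast
        show ?case
        proof (rule hausdorff_dist_le)
          fix a assume a: "a \<in> ?A"
          show "\<exists>b\<in>?K. mdist Z a b < e"
          proof (rule almost_isometry_almost_onto[OF Q KZ AZ e \<delta>_def _ _ _ a, where g = "\<lambda>a. \<psi> \<infinity> (g (c a))"])
            show "\<exists>y\<in>?A. mdist Z y p < \<delta>" if "p \<in> ?K" for p using elim(2) that by auto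
            show "\<psi> \<infinity> (g (c a)) \<in> ?K" if "a \<in> ?A" for a using g(1) c(1)[OF that] by auto
            show "mdist Z a a' - \<delta> \<le> mdist Z (\<psi> \<infinity> (g (c a))) (\<psi> \<infinity> (g (c a')))"
              if a: "a \<in> ?A" "a' \<in> ?A" for a a'
            proof -
              note ca = c[OF a(1)] c[OF a(2)]
              have E: "c a \<in> mspace ?X" "c a' \<in> mspace ?X" using ca(1,3) \<Sigma>E(1) by blast+
              have "mdist Z a a' = mdist ?X (c a) (c a')"
                using iso(2)[OF E] ca(2,4) by simp
              moreover have E': "g (c a) \<in> mspace ?Y" "g (c a') \<in> mspace ?Y"
                using g(1) ca(1,3) \<Sigma>E(2) by blast+
              moreover have "mdist Z (\<psi> \<infinity> (g (c a))) (\<psi> \<infinity> (g (c a'))) = mdist ?Y (g (c a)) (g (c a'))"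
                by (rule iso(2)[OF E'])
              ultimately show ?thesis using g(2)[OF ca(1) ca(3)] by simp
            qed
          qed
        next
          fix b assume "b \<in> ?K"
          then show "\<exists>a\<in>?A. mdist Z b a < e" using elim(3) by (auto simp: mdist_commute)
        qed
      qed
    qed
    then show "(\<lambda>j. hausdorff_dist Z
                 (sp_extension (M (enat j)) Z (\<phi> (enat j)) ` ?\<Sigma> j)
                 (sp_extension (M \<infinity>) Z (\<phi> \<infinity>) ` \<Sigma> \<infinity>)) \<longlonglongrightarrow> 0" by (simp add: \<psi>_def)
  qed
qed

end
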